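(* Let $B_1,\dots,B_k$ be open disks in $\mathbb{R}^2$ with distinct centers. Then there exist a polynomial $P\in\mathbb{R}[x_1,x_2]$ of the form $P(x_1,x_2)=(x_1^2+x_2^2)^k+(\text{terms of total degree}<2k)$ and a finite (possibly empty) set $E\subset\mathbb{R}^2$ such that $$\partial(B_1\oplus\cdots\oplus B_k)=\{(x_1,x_2)\in\mathbb{R}^2:P(x_1,x_2)=0\}\setminus E.$$
   Context: $g(x,y)=-\frac{2}{\pi}\log|x-y|$ on $\mathbb{R}^2$. Superharmonic: lower semicontinuous and $\ge$ its ball averages. For bounded nonnegative compactly supported $\sigma$: $\gamma(x)=-|x|^2-\int g(x,y)\sigma(y)dy$, $s=\inf\{f$ continuous superharmonic on $\mathbb{R}^2$, $f\ge\gamma\}$, $D(\sigma)=\{s>\gamma\}$. Smash sum: $B_1\oplus\cdots\oplus B_k=B_1\cup\cdots\cup B_k\cup D(\sum_i1_{B_i})$. *)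

theory Defs
  imports "HOL-Analysis.Analysis"
begin

definition green :: "real^2 \<Rightarrow> real^2 \<Rightarrow> real" where
  "green x y = - (2 / pi) * ln (dist x y)"

definition lower_semicont :: "(real^2 \<Rightarrow> real) \<Rightarrow> bool" where
  "lower_semicont f \<longleftrightarrow> (\<forall>t. open {x. t < f x})"

definition superharmonic :: "(real^2 \<Rightarrow> real) \<Rightarrow> bool" where
  "superharmonic f \<longleftrightarrow> lower_semicont f \<and>
     (\<forall>x r. 0 < r \<longrightarrow>
        (set_lebesgue_integral lborel (ball x r) f) / measure lborel (ball x r) \<le> f x)"

definition obstacle :: "(real^2 \<Rightarrow> real) \<Rightarrow> real^2 \<Rightarrow> real" where
  "obstacle \<sigma> x = - ((norm x)^2) - (integral\<^sup>L lborel (\<lambda>y. green x y * \<sigma> y))"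

definition odometer_s :: "(real^2 \<Rightarrow> real) \<Rightarrow> real^2 \<Rightarrow> real" where
  "odometer_s \<sigma> x = Inf {f x | f. continuous_on UNIV f \<and> superharmonic f \<and>
                                   (\<forall>y. obstacle \<sigma> y \<le> f y)}"

definition Dset :: "(real^2 \<Rightarrow> real) \<Rightarrow> (real^2) set" where
  "Dset \<sigma> = {x. obstacle \<sigma> x < odometer_s \<sigma> x}"

definition smash_sum :: "nat \<Rightarrow> (nat \<Rightarrow> (real^2) set) \<Rightarrow> (real^2) set" where
  "smash_sum k B = (\<Union>i<k. B i) \<union> Dset (\<lambda>y. \<Sum>i<k. indicator (B i) y)"

end

theory Submission
  imports
    Defs
    "HOL-Complex_Analysis.Complex_Analysis"
    "HOL-Computational_Algebra.Fundamental_Theorem_Algebra"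
begin

text \<open>The least superharmonic majorant \<open>s\<close> of the obstacle is continuous, and harmonic on the smash sum \<open>\<Omega>\<close>. Hence \<open>S z = (\<Sum>i<k. r i\<^sup>2 / (z - c i)) - \<partial>\<^sub>z s\<close> is holomorphic
  on \<open>\<Omega>\<close> except for simple poles at the centers, and as \<open>s\<close> touches the obstacle outside \<open>\<Omega>\<close>,
  it is a Schwarz function: \<open>S z\<close> tends to \<open>cnj w\<close> as \<open>z\<close> tends to a boundary point \<open>w\<close>.

  A function that is holomorphic on \<open>\<Omega>\<close> with real boundary values is constant. So a dimension
  count over polynomials in \<open>z\<close> and \<open>S z\<close>, in which the principal parts at the poles are cancelled,
  gives a nontrivial polynomial relation \<open>Q (z, S z) = 0\<close>. The function
  \<open>(z - w) * (S z - cnj w)\<close> has \<open>k\<close> poles and positive boundary values, so it has at least \<open>k\<close>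
  zeros. Hence for generic \<open>w\<close> the points \<open>cnj z\<close> with \<open>S z = cnj w\<close>, together with \<open>S w\<close> if \<open>w\<close>
  lies in \<open>\<Omega>\<close>, are at least \<open>k\<close> roots of \<open>Q (w, _)\<close>. This forces the
  minimal relation to have bidegree \<open>(k, k)\<close> and to be Hermitian with leading coefficient \<open>1\<close>.
  Then \<open>Q (w, cnj w)\<close> is the polynomial sought; its zeros off the boundary are double roots of
  \<open>Q (w, _)\<close>, and there are only finitely many of these.\<close>

section \<open>Schwarz functions\<close>

text \<open>Nothing is known about the regularity of the frontier, and \<open>Om\<close> may be
  disconnected. Boundary data therefore enter only as limits within \<open>Om\<close>, and contour
  integrals are replaced by the maximum principle and by a connectedness argument for the number of
  preimages. That every component of \<open>Om\<close> contains a center makes up for the missing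
  connectedness. The degrees come from the sheets over a generic \<open>w\<close>: those of the form
  \<open>cnj z\<close> stay in a bounded set, and the single sheet \<open>S w\<close> is unbounded
  only near the centers, where it has a simple pole. This growth alone fixes the leading coefficient
  and the degree in \<open>w\<close>. The formula for \<open>S\<close> has its origin in the
  obstacle: off the disks \<open>- (norm z)^2 + pot z\<close> has as \<open>z\<close>-derivative the
  Cauchy sum minus \<open>cnj z\<close>. The potential theory uses no Laplacian: super-mean
  inequalities are verified by touching a function from above with a harmonic one, and real parts of
  polynomials replace the Poisson integral.\<close>

lemma compact_superlevel_Im:
  fixes f :: "complex \<Rightarrow> complex"
  assumes U: "open U" "bounded U" and f: "continuous_on U f"
    and lim: "\<And>w. w \<in> frontier U \<Longrightarrow> (f \<longlongrightarrow> b w) (at w within U)"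
    and b: "\<And>w. w \<in> frontier U \<Longrightarrow> Im (b w) < e"
  shows "compact {z \<in> U. Im (f z) \<ge> e}"
proof -
  have "closed {z \<in> U. Im (f z) \<ge> e}"
    unfolding closed_sequential_limits
  proof (intro allI impI, elim conjE)
    fix x l assume x: "\<forall>n. x n \<in> {z \<in> U. Im (f z) \<ge> e}" and l: "x \<longlonglongrightarrow> l"
    have xU: "\<And>n. x n \<in> U" and xe: "\<And>n. Im (f (x n)) \<ge> e" using x by auto
    have "l \<in> closure U" using xU l closure_sequential by blast
    then consider "l \<in> U" | "l \<in> frontier U" "l \<notin> U"
      using U(1) by (auto simp: frontier_def interior_open)
    then show "l \<in> {z \<in> U. Im (f z) \<ge> e}"
    proof cases
      case 1
      then have "(\<lambda>n. f (x n)) \<longlonglongrightarrow> f l"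
        using f l xU U(1) by (metis continuous_on_tendsto_compose eventually_sequentiallyI)
      then have "(\<lambda>n. Im (f (x n))) \<longlonglongrightarrow> Im (f l)" by (intro tendsto_intros)
      then have "Im (f l) \<ge> e" using xe by (intro LIMSEQ_le_const) auto
      then show ?thesis using 1 by simp
    next
      \<comment> \<open>An accumulation point on the frontier would force a boundary value with
        imaginary part at least \<open>e\<close>.\<close>
      case 2
      have "filterlim x (at l within U) sequentially"
        unfolding filterlim_at using l xU 2(2) by (auto intro!: always_eventually)
      then have "(\<lambda>n. f (x n)) \<longlonglongrightarrow> b l" using filterlim_compose[OF lim[OF 2(1)]] by blast
      then have "(\<lambda>n. Im (f (x n))) \<longlonglongrightarrow> Im (b l)" by (intro tendsto_intros)
      then have "Im (b l) \<ge> e" using xe by (intro LIMSEQ_le_const) auto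
      then show ?thesis using b[OF 2(1)] by simp
    qed
  qed
  moreover have "bounded {z \<in> U. Im (f z) \<ge> e}" using U(2) by (rule bounded_subset) auto
  ultimately show ?thesis by (simp add: compact_eq_bounded_closed)
qed

text \<open>The modulus of \<open>exp (- \<i> * f z)\<close> is the exponential of
  \<open>Im (f z)\<close>, so the maximum modulus principle applies to \<open>Im f\<close>. A
  positive value would be maximised inside the compact superlevel set, so \<open>U\<close> would
  equal that set; but a nonempty open set is not compact.\<close>

lemma Im_nonpos_of_boundary:
  assumes U: "open U" "connected U" "bounded U" and f: "f holomorphic_on U"
    and lim: "\<And>w. w \<in> frontier U \<Longrightarrow> (f \<longlongrightarrow> b w) (at w within U)"
    and b: "\<And>w. w \<in> frontier U \<Longrightarrow> Im (b w) = 0"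
    and z: "z \<in> U"
  shows "Im (f z) \<le> 0"
proof (rule ccontr)
  assume neg: "\<not> Im (f z) \<le> 0"
  define e where "e = Im (f z)"
  define K where "K = {z \<in> U. Im (f z) \<ge> e}"
  have e: "e > 0" using neg by (simp add: e_def)
  have cont: "continuous_on U f" using f by (rule holomorphic_on_imp_continuous_on)
  have "compact K" unfolding K_def
    by (rule compact_superlevel_Im[OF U(1,3) cont lim]) (use b e in auto)
  moreover have "continuous_on K (\<lambda>z. Im (f z))"
    by (intro continuous_intros continuous_on_subset[OF cont]) (auto simp: K_def)
  moreover have "z \<in> K" using z by (simp add: K_def e_def)
  ultimately obtain z0 where z0: "z0 \<in> K" "\<And>y. y \<in> K \<Longrightarrow> Im (f y) \<le> Im (f z0)"
    using continuous_attains_sup[of K] by blast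
  have max: "Im (f y) \<le> Im (f z0)" if "y \<in> U" for y
    using z0 that by (cases "y \<in> K") (auto simp: K_def)
  have "(\<lambda>z. exp (- \<i> * f z)) constant_on U"
  proof (rule maximum_modulus_principle[OF _ U(1,2) U(1)])
    show "(\<lambda>z. exp (- \<i> * f z)) holomorphic_on U" using f by (intro holomorphic_intros)
    show "z0 \<in> U" using z0 by (simp add: K_def)
    show "norm (exp (- \<i> * f z)) \<le> norm (exp (- \<i> * f z0))" if "z \<in> U" for z
      using max[OF that] by simp
  qed auto
  then obtain c where c: "\<And>y. y \<in> U \<Longrightarrow> exp (- \<i> * f y) = c" by (auto simp: constant_on_def)
  have "Im (f y) \<ge> e" if "y \<in> U" for y
  proof -
    have "norm (exp (- \<i> * f y)) = norm (exp (- \<i> * f z0))"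
      using c[OF that] c[of z0] z0 by (simp add: K_def)
    then have "Im (f y) = Im (f z0)" by simp
    then show ?thesis using z0(1) by (simp add: K_def)
  qed
  then have "U = K" by (auto simp: K_def)
  then show False using \<open>compact K\<close> U(1) compact_open[of U] z by auto
qed

text \<open>Applied to \<open>f\<close> and \<open>- f\<close>, the bound makes \<open>f\<close>
  real on \<open>U\<close>, and a set of real numbers is not open in the plane.\<close>

lemma constant_of_real_boundary:
  assumes U: "open U" "connected U" "bounded U" and f: "f holomorphic_on U"
    and lim: "\<And>w. w \<in> frontier U \<Longrightarrow> (f \<longlongrightarrow> b w) (at w within U)"
    and b: "\<And>w. w \<in> frontier U \<Longrightarrow> Im (b w) = 0"
  shows "f constant_on U"
proof (cases "U = {}")
  case False
  have a: "Im (f z) \<le> 0" if "z \<in> U" for z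
    by (rule Im_nonpos_of_boundary[OF U f lim b that])
  have "Im (- f z) \<le> 0" if "z \<in> U" for z
    by (rule Im_nonpos_of_boundary[OF U, where b="\<lambda>w. - b w"])
       (use that f lim b in \<open>auto intro!: holomorphic_intros tendsto_intros\<close>)
  with a have I: "Im (f z) = 0" if "z \<in> U" for z using that by fastforce
  show ?thesis
  proof (rule ccontr)
    assume "\<not> f constant_on U"
    then have "open (f ` U)"
      using open_mapping_thm[OF f U(1,2) U(1)] by auto
    moreover obtain z where z: "z \<in> U" using False by auto
    ultimately obtain r where r: "r > 0" "ball (f z) r \<subseteq> f ` U"
      by (meson image_eqI open_contains_ball)
    have "f z + \<i> * of_real (r/2) \<in> ball (f z) r" using r(1) by (simp add: dist_norm norm_mult)
    then obtain y where "y \<in> U" "f z + \<i> * of_real (r/2) = f y" using r(2) by blast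
    then have "Im (f z) + r/2 = Im (f y)" by (metis Im_i_times Re_complex_of_real plus_complex.simps(2))
    with I[OF z] I[OF \<open>y \<in> U\<close>] r(1) show False by simp
  qed
qed (auto simp: constant_on_def)

text \<open>Neither connectedness of \<open>Om\<close> nor regularity of its frontier is built in. A
  simple pole is encoded by a nonzero limit of \<open>(z - p) * S z\<close>; the values of
  \<open>S\<close> at the points of \<open>C\<close> are arbitrary.\<close>

locale schwarz_domain =
  fixes Om C :: "complex set" and S :: "complex \<Rightarrow> complex"
  assumes open_Om: "open Om" and bounded_Om: "bounded Om"
    and finite_C: "finite C" and C_sub: "C \<subseteq> Om"
    and hol_S: "S holomorphic_on Om - C"
    and pole_S: "\<And>p. p \<in> C \<Longrightarrow> \<exists>\<rho>. \<rho> \<noteq> 0 \<and> ((\<lambda>z. (z - p) * S z) \<longlongrightarrow> \<rho>) (at p)"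
    and bdry_S: "\<And>w. w \<in> frontier Om \<Longrightarrow> (S \<longlongrightarrow> cnj w) (at w within Om)"
begin

lemma open_punctured: "open (Om - C)"
  using open_Om finite_C by (simp add: finite_imp_closed open_Diff)

lemma frontier_notin: "w \<in> frontier Om \<Longrightarrow> w \<notin> Om"
  using open_Om by (simp add: frontier_def interior_open)

lemma closure_cases: "l \<in> closure Om \<Longrightarrow> l \<in> C \<or> l \<in> Om - C \<or> l \<in> frontier Om"
  using open_Om by (auto simp: frontier_def interior_open)

lemma comp_frontier: "frontier (connected_component_set Om z) \<subseteq> frontier Om"
  by (rule frontier_of_connected_component_subset)

lemma tendsto_comp:
  "w \<in> frontier Om \<Longrightarrow> (f \<longlongrightarrow> l) (at w within Om) \<Longrightarrow> (f \<longlongrightarrow> l) (at w within connected_component_set Om z)"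
  by (erule tendsto_within_subset) (rule connected_component_subset)

text \<open>Without a pole in the component of \<open>z\<close>, the function
  \<open>(y - z) * (S y - cnj z)\<close> is holomorphic there with the real boundary values
  \<open>(norm (v - z))^2\<close>, hence constant. It vanishes at \<open>z\<close>, but its limit at
  a frontier point is positive.\<close>

lemma comp_meets_C:
  assumes "z \<in> Om"
  obtains p where "p \<in> C" "p \<in> connected_component_set Om z"
proof (rule ccontr)
  assume "\<not> thesis"
  then have no: "connected_component_set Om z \<inter> C = {}" using that by blast
  define U where "U = connected_component_set Om z"
  have U: "open U" "connected U" "bounded U" "U \<subseteq> Om - C" "z \<in> U"
    using open_Om bounded_Om no assms connected_component_subset[of Om z]
    unfolding U_def
    by (auto simp: open_connected_component intro: bounded_subset)
  have "frontier U \<noteq> {}"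
    using U by (metis frontier_eq_empty not_bounded_UNIV empty_iff)
  then obtain w where w: "w \<in> frontier U" by auto
  have wO: "w \<in> frontier Om" using w comp_frontier U_def by blast
  define h where "h = (\<lambda>y. (y - z) * (S y - cnj z))"
  have lim: "(h \<longlongrightarrow> (v - z) * (cnj v - cnj z)) (at v within U)" if "v \<in> frontier U" for v
    unfolding h_def using that comp_frontier U_def
    by (intro tendsto_intros tendsto_comp[of v S "cnj v" z, folded U_def] bdry_S) auto
  have "h constant_on U"
  proof (rule constant_of_real_boundary[OF U(1-3) _ lim])
    show "h holomorphic_on U" unfolding h_def
      using U by (intro holomorphic_intros holomorphic_on_subset[OF hol_S])
  qed (auto simp: algebra_simps)
  then obtain c where c: "\<And>y. y \<in> U \<Longrightarrow> h y = c" unfolding constant_on_def by blast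
  have h0: "h y = 0" if "y \<in> U" for y
    using c[OF that] c[OF U(5)] by (simp add: h_def)
  have "w \<notin> U" using w U(1) by (simp add: frontier_def interior_open)
  have "w islimpt U" using w \<open>w \<notin> U\<close> by (auto simp: frontier_def closure_def)
  then have nt: "at w within U \<noteq> bot" by (simp add: trivial_limit_within)
  have "(h \<longlongrightarrow> 0) (at w within U)"
    by (rule Lim_transform_eventually[OF tendsto_const])
       (auto simp: eventually_at_filter h0 intro!: always_eventually)
  with lim[OF w] nt have "(w - z) * (cnj w - cnj z) = 0" by (metis tendsto_unique)
  then have "w = z" by (simp flip: complex_cnj_diff)
  then show False using \<open>w \<notin> U\<close> U(5) by simp
qed

text \<open>The component around \<open>W\<close> contains a pole and stays connected after removing
  the finite set \<open>C\<close>, so the identity theorem carries the constant value up to that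
  pole. This is how nonconstancy is obtained on every component.\<close>

lemma identity_near_pole:
  assumes h: "h holomorphic_on Om - C" and W: "open W" "W \<noteq> {}" "W \<subseteq> Om - C"
    and c: "\<And>z. z \<in> W \<Longrightarrow> h z = c"
  shows "\<exists>p\<in>C. eventually (\<lambda>z. h z = c) (at p)"
proof -
  obtain z where z: "z \<in> W" using W by auto
  define U where "U = connected_component_set Om z"
  obtain p where p: "p \<in> C" "p \<in> U" unfolding U_def
    using comp_meets_C[of z] z W by blast
  have U: "open U" "connected U" "U \<subseteq> Om"
    using open_Om connected_component_subset[of Om z] unfolding U_def
    by (auto simp: open_connected_component)
  have conn: "connected (U - C)" using U finite_C by (intro connected_open_delete_finite) auto
  have oU: "open (U - C)" using U finite_C by (simp add: finite_imp_closed open_Diff)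
  have zU: "z \<in> U - C" using z W unfolding U_def by auto
  have hc: "h y - c = 0" if "y \<in> U - C" for y
  proof (rule analytic_continuation[where f="\<lambda>y. h y - c" and S="U - C" and U="W \<inter> (U - C)" and \<xi>=z])
    show "(\<lambda>y. h y - c) holomorphic_on U - C"
      using U(3) by (intro holomorphic_intros holomorphic_on_subset[OF h]) auto
    show "z islimpt W \<inter> (U - C)" 
      using z zU W(1) oU by (intro interior_limit_point) (auto simp: interior_open open_Int)
  qed (use conn oU zU that c in auto)
  have "eventually (\<lambda>y. y \<in> U - C) (at p)"
  proof -
    have "open (U - (C - {p}))" using U finite_C by (simp add: finite_imp_closed open_Diff)
    then have "eventually (\<lambda>y. y \<in> U - (C - {p}) - {p}) (at p)"
      using p by (intro eventually_at_in_open) auto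
    then show ?thesis by (rule eventually_mono) auto
  qed
  then have "eventually (\<lambda>y. h y = c) (at p)" by (rule eventually_mono) (use hc in force)
  with p show ?thesis by auto
qed

lemma pole_S_infinity:
  assumes "p \<in> C" shows "filterlim S at_infinity (at p)"
proof -
  obtain \<rho> where \<rho>: "\<rho> \<noteq> 0" "((\<lambda>z. (z - p) * S z) \<longlongrightarrow> \<rho>) (at p)" using pole_S[OF assms] by auto
  have "((\<lambda>z. z - p) \<longlongrightarrow> p - p) (at p)" by (intro tendsto_intros)
  then have "filterlim (\<lambda>z. z - p) (at 0) (at p)"
    by (simp add: filterlim_at eventually_at_filter)
  with \<rho> have "filterlim (\<lambda>z. ((z - p) * S z) / (z - p)) at_infinity (at p)"
    by (intro filterlim_divide_at_infinity[OF \<rho>(2) _ \<rho>(1)])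
  then show ?thesis
    by (rule filterlim_mono_eventually[OF _ order_refl order_refl]) (auto simp: eventually_at_filter)
qed

text \<open>The common setting for \<open>S\<close> and \<open>(z - w) * (S z - cnj w)\<close>:
  meromorphic functions on \<open>Om\<close> with poles exactly at the points of \<open>C\<close>,
  of unspecified order.\<close>

definition blowup :: "(complex \<Rightarrow> complex) \<Rightarrow> bool" where
  "blowup h \<longleftrightarrow> h holomorphic_on Om - C \<and> (\<forall>p\<in>C. filterlim h at_infinity (at p))"

lemma blowup_S: "blowup S"
  using hol_S pole_S_infinity by (auto simp: blowup_def)

lemma blowup_not_locally_const:
  assumes "blowup h" "open W" "W \<noteq> {}" "W \<subseteq> Om - C"
  shows "\<not> h constant_on W"
proof
  assume "h constant_on W"
  then obtain c where "\<And>z. z \<in> W \<Longrightarrow> h z = c" by (auto simp: constant_on_def)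
  then obtain p where p: "p \<in> C" "eventually (\<lambda>z. h z = c) (at p)"
    using identity_near_pole[of h W c] assms by (auto simp: blowup_def)
  have "(h \<longlongrightarrow> c) (at p)" using p(2) by (rule tendsto_eventually)
  moreover have "filterlim h at_infinity (at p)" using assms p by (auto simp: blowup_def)
  ultimately show False
    by (meson at_neq_bot not_tendsto_and_filterlim_at_infinity)
qed

lemma blowup_open_image:
  assumes "blowup h" "open W" "W \<subseteq> Om - C"
  shows "open (h ` W)"
proof (rule openI)
  fix v assume "v \<in> h ` W"
  then obtain z where z: "z \<in> W" "v = h z" by auto
  obtain r where r: "r > 0" "ball z r \<subseteq> W" using assms(2) z by (meson open_contains_ball)
  have "open (h ` ball z r)"
    by (rule open_mapping_thm[where S="ball z r"])
       (use assms r blowup_not_locally_const[of h "ball z r"] in \<open>auto simp: blowup_def intro: holomorphic_on_subset\<close>)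
  moreover have "v \<in> h ` ball z r" using z r by auto
  ultimately obtain e where "e > 0" "ball v e \<subseteq> h ` ball z r" by (meson open_contains_ball)
  then show "\<exists>e>0. ball v e \<subseteq> h ` W" using r(2) by blast
qed

text \<open>Critical points may accumulate at the frontier, so countability takes the place of
  finiteness. On a punctured component \<open>deriv h\<close> has countably many zeros unless it is
  constant, and the constant \<open>0\<close> would make \<open>h\<close> constant there.\<close>

lemma countable_critical_points:
  assumes "blowup h"
  shows "countable {z \<in> Om - C. deriv h z = 0}"
proof -
  define U where "U = (\<lambda>p. connected_component_set Om p - C)"
  have oU: "open (U p)" for p
    unfolding U_def using open_Om finite_C
    by (simp add: finite_imp_closed open_Diff open_connected_component)
  have cU: "connected (U p)" for p
    unfolding U_def using open_Om finite_C
    by (intro connected_open_delete_finite) (auto simp: open_connected_component)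
  have sub: "U p \<subseteq> Om - C" for p
    unfolding U_def using connected_component_subset[of Om p] by auto
  have "countable {z \<in> U p. deriv h z = 0}" for p
  proof (cases "deriv h constant_on U p")
    case False
    show ?thesis
    proof (rule holomorphic_countable_zeros[OF _ oU cU _ False])
      show "deriv h holomorphic_on U p"
        using assms sub by (intro holomorphic_deriv oU) (auto simp: blowup_def intro: holomorphic_on_subset)
      show "fsigma (U p)"
        using open_Union_compact_subsets[OF oU[of p]] by (metis compact_imp_closed fsigma.intros)
    qed
  next
    case True
    then obtain c where c: "\<And>z. z \<in> U p \<Longrightarrow> deriv h z = c" by (auto simp: constant_on_def)
    show ?thesis
    proof (cases "c = 0 \<and> U p \<noteq> {}")
      case True
      have hol: "h holomorphic_on U p" using assms sub by (auto simp: blowup_def intro: holomorphic_on_subset)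
      have "(h has_field_derivative 0) (at z)" if "z \<in> U p" for z
        using c[OF that] True hol that oU holomorphic_derivI by metis
      then have "h constant_on U p"
        using has_field_derivative_0_imp_constant_on oU cU by blast
      then show ?thesis using blowup_not_locally_const[OF assms oU _ sub] True by auto
    next
      case False
      then have "{z \<in> U p. deriv h z = 0} = {}" using c by auto
      then show ?thesis by (metis countable_empty)
    qed
  qed
  then have "countable (\<Union>p\<in>C. {z \<in> U p. deriv h z = 0})"
    using finite_C by (intro countable_UN) (auto simp: countable_finite)
  moreover have "{z \<in> Om - C. deriv h z = 0} \<subseteq> (\<Union>p\<in>C. {z \<in> U p. deriv h z = 0})"
  proof
    fix z assume z: "z \<in> {z \<in> Om - C. deriv h z = 0}"
    then obtain p where "p \<in> C" "p \<in> connected_component_set Om z" using comp_meets_C[of z] by auto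
    then show "z \<in> (\<Union>p\<in>C. {z \<in> U p. deriv h z = 0})"
      using z unfolding U_def by (auto intro: connected_component_sym)
  qed
  ultimately show ?thesis by (rule countable_subset[rotated])
qed

text \<open>\<open>inverse (h z)\<close> extends holomorphically by \<open>0\<close> to the pole
  \<open>p\<close>; by the open mapping theorem its image contains a disk around \<open>0\<close>,
  so \<open>h\<close> takes all large values near \<open>p\<close>.\<close>

lemma blowup_solution_near_pole:
  assumes "blowup h" "p \<in> C" "e > 0"
  shows "\<exists>M>0. \<forall>v. norm v > M \<longrightarrow> (\<exists>z \<in> ball p e. z \<in> Om - C \<and> h z = v)"
proof -
  have inf: "filterlim h at_infinity (at p)" and hol: "h holomorphic_on Om - C"
    using assms by (auto simp: blowup_def)
  have "open (Om - (C - {p}))" using open_Om finite_C by (simp add: finite_imp_closed open_Diff)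
  then have 1: "eventually (\<lambda>y. y \<in> Om - (C - {p})) (nhds p)"
    using assms(2) C_sub by (intro eventually_nhds_in_open) auto
  \<comment> \<open>The bound \<open>1\<close> keeps \<open>h\<close> away from zero, so that its
    inverse is holomorphic off \<open>p\<close>.\<close>
  have "eventually (\<lambda>y. norm (h y) \<ge> 1) (at p)"
    using inf by (simp add: filterlim_at_infinity[of 0])
  then have 2: "eventually (\<lambda>y. y \<noteq> p \<longrightarrow> norm (h y) \<ge> 1) (nhds p)"
    by (simp add: eventually_at_filter)
  have "eventually (\<lambda>y. y \<in> ball p e \<and> y \<in> Om - (C - {p}) \<and> (y \<noteq> p \<longrightarrow> norm (h y) \<ge> 1)) (nhds p)"
    using 1 2 eventually_nhds_in_open[of "ball p e" p, simplified, OF assms(3)]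
    by eventually_elim auto
  then obtain r where r: "r > 0"
    "\<And>y. dist y p < r \<Longrightarrow> y \<in> ball p e \<and> y \<in> Om - (C - {p}) \<and> (y \<noteq> p \<longrightarrow> norm (h y) \<ge> 1)"
    unfolding eventually_nhds_metric by blast
  define B where "B = ball p r"
  have B: "y \<in> ball p e" "y \<in> Om - (C - {p})" "y \<noteq> p \<Longrightarrow> norm (h y) \<ge> 1" if "y \<in> B" for y
    using r(2)[of y] that by (auto simp: B_def dist_commute)
  define g where "g z = (if z = p then 0 else inverse (h z))" for z
  have limg: "(g \<longlongrightarrow> 0) (at p)"
    by (rule Lim_transform_eventually[OF tendsto_inverse_0[THEN filterlim_compose, OF inf]])
       (auto simp: g_def eventually_at_filter)
  have holg: "g holomorphic_on B"
  proof (rule no_isolated_singularity'[where K="{p}"])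
    show "(g \<longlongrightarrow> g z) (at z within B)" if "z \<in> {p}" for z
      using limg that by (auto simp: g_def intro: Lim_at_imp_Lim_at_within)
    have "(\<lambda>z. inverse (h z)) holomorphic_on B - {p}"
    proof (intro holomorphic_intros holomorphic_on_subset[OF hol])
      show "B - {p} \<subseteq> Om - C" using B(2) by blast
      show "h z \<noteq> 0" if "z \<in> B - {p}" for z using B(3)[of z] that by auto
    qed
    then show "g holomorphic_on B - {p}"
      by (rule holomorphic_transform) (auto simp: g_def)
  qed (auto simp: B_def)
  have "\<not> g constant_on B"
  proof
    assume "g constant_on B"
    then obtain c where c: "\<And>z. z \<in> B \<Longrightarrow> g z = c" by (auto simp: constant_on_def)
    have "c = 0" using c[of p] r(1) by (simp add: g_def B_def)
    have "p + of_real (r/2) \<in> B" using r(1) by (simp add: B_def dist_norm)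
    with c[OF this] B(3)[OF this] \<open>c = 0\<close> r(1) show False by (simp add: g_def)
  qed
  then have "open (g ` B)"
    by (intro open_mapping_thm[OF holg]) (auto simp: B_def)
  moreover have "0 \<in> g ` B" using r(1) by (auto simp: g_def B_def image_iff intro!: bexI[of _ p])
  ultimately obtain d where d: "d > 0" "ball 0 d \<subseteq> g ` B" by (meson open_contains_ball)
  show ?thesis
  proof (intro exI[of _ "1/d"] conjI allI impI)
    fix v :: complex assume v: "norm v > 1/d"
    then have "v \<noteq> 0" using d(1) by (auto simp: field_simps)
    have "norm (inverse v) < d" using v d(1) \<open>v \<noteq> 0\<close> unfolding norm_inverse
      by (simp add: field_simps)
    then have "inverse v \<in> ball 0 d" by simp
    then have "inverse v \<in> g ` B" using d(2) by blast
    then obtain z where z: "z \<in> B" "g z = inverse v" by auto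
    then have "z \<noteq> p" using \<open>v \<noteq> 0\<close> by (auto simp: g_def)
    then have "h z = v" using z by (simp add: g_def)
    then show "\<exists>z\<in>ball p e. z \<in> Om - C \<and> h z = v" using B(1,2)[OF z(1)] \<open>z \<noteq> p\<close> by auto
  qed (use d in auto)
qed

text \<open>For large \<open>v\<close> each pole has its own solution, in a disk of half the
  distance to the other poles, which keeps the solutions distinct.\<close>

lemma blowup_many_solutions:
  assumes "blowup h"
  shows "\<exists>M>0. \<forall>v. norm v > M \<longrightarrow> (\<exists>T. T \<subseteq> Om - C \<and> finite T \<and> card T = card C \<and> (\<forall>z\<in>T. h z = v))"
proof -
  have "\<forall>p\<in>C. \<exists>d>0. \<forall>q\<in>C. q \<noteq> p \<longrightarrow> d \<le> dist p q"
    using finite_set_avoid[OF finite_C] by blast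
  then obtain d where d: "\<And>p. p \<in> C \<Longrightarrow> d p > (0::real)"
    "\<And>p q. p \<in> C \<Longrightarrow> q \<in> C \<Longrightarrow> q \<noteq> p \<Longrightarrow> d p \<le> dist p q" by metis
  have "\<forall>p\<in>C. \<exists>M>0. \<forall>v. norm v > M \<longrightarrow> (\<exists>z \<in> ball p (d p / 2). z \<in> Om - C \<and> h z = v)"
    using blowup_solution_near_pole[OF assms] d(1) by simp
  then obtain M where M: "\<And>p v. p \<in> C \<Longrightarrow> norm v > M p \<Longrightarrow> \<exists>z \<in> ball p (d p / 2). z \<in> Om - C \<and> h z = v"
    by metis
  define N where "N = Max (insert 1 (M ` C))"
  have N: "N \<ge> 1" "\<And>p. p \<in> C \<Longrightarrow> M p \<le> N" using finite_C by (auto simp: N_def)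
  show ?thesis
  proof (intro exI[of _ N] conjI allI impI)
    fix v :: complex assume "norm v > N"
    have "\<forall>p\<in>C. \<exists>z. z \<in> ball p (d p / 2) \<and> z \<in> Om - C \<and> h z = v"
    proof
      fix p assume p: "p \<in> C"
      have "norm v > M p" using N(2)[OF p] \<open>norm v > N\<close> by simp
      from M[OF p this] show "\<exists>z. z \<in> ball p (d p / 2) \<and> z \<in> Om - C \<and> h z = v" by auto
    qed
    then obtain f where f: "\<forall>p\<in>C. f p \<in> ball p (d p / 2) \<and> f p \<in> Om - C \<and> h (f p) = v"
      by (rule bchoice[THEN exE])
    have inj: "inj_on f C"
    proof (rule inj_onI, rule ccontr)
      fix p q assume pq: "p \<in> C" "q \<in> C" "f p = f q" "p \<noteq> q"
      have "dist p q \<le> dist p (f p) + dist q (f p)" by (rule dist_triangle2)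
      moreover have "dist p (f p) < d p / 2" using f pq(1) by simp
      moreover have "dist q (f p) < d q / 2" using f pq(2,3) by simp
      moreover have "d p \<le> dist p q" using d(2)[of p q] pq by simp
      moreover have "d q \<le> dist p q" using d(2)[of q p] pq by (simp add: dist_commute)
      ultimately show False by linarith
    qed
    show "\<exists>T. T \<subseteq> Om - C \<and> finite T \<and> card T = card C \<and> (\<forall>z\<in>T. h z = v)"
    proof (intro exI[of _ "f ` C"] conjI)
      show "card (f ` C) = card C" by (rule card_image[OF inj])
      show "f ` C \<subseteq> Om - C" using f by blast
      show "\<forall>z\<in>f ` C. h z = v" using f by blast
    qed (use finite_C in auto)
  qed (use N in auto)
qed

end

section \<open>Counting preimages by a connectedness argument\<close>

lemma finite_separation:
  fixes T :: "'a::metric_space set"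
  assumes "finite T"
  shows "\<exists>d>0. \<forall>p\<in>T. \<forall>q\<in>T. p \<noteq> q \<longrightarrow> ball p d \<inter> ball q d = {}"
proof -
  have "\<forall>p\<in>T. \<exists>d>0. \<forall>q\<in>T. q \<noteq> p \<longrightarrow> d \<le> dist p q"
    using finite_set_avoid[OF assms] by blast
  then obtain d where d: "\<forall>p\<in>T. d p > (0::real) \<and> (\<forall>q\<in>T. q \<noteq> p \<longrightarrow> d p \<le> dist p q)"
    by (rule bchoice[THEN exE])
  define e where "e = Min (insert 1 (d ` T))"
  have e: "e > 0" "\<And>p. p \<in> T \<Longrightarrow> e \<le> d p" using assms d by (auto simp: e_def)
  show ?thesis
  proof (intro exI[of _ "e/2"] conjI ballI impI)
    fix p q assume pq: "p \<in> T" "q \<in> T" "p \<noteq> q"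
    have "e \<le> dist p q" using e(2)[OF pq(1)] d pq by force
    then show "ball p (e/2) \<inter> ball q (e/2) = {}" by (intro disjoint_ballI) simp
  qed (use e in auto)
qed

context schwarz_domain
begin

text \<open>Points are counted without multiplicity, which is why critical values have to be avoided
  later; a witness set of exact size also covers infinite fibres.\<close>

definition many :: "(complex \<Rightarrow> complex) \<Rightarrow> complex \<Rightarrow> bool" where
  "many h v \<longleftrightarrow> (\<exists>T. T \<subseteq> Om - C \<and> finite T \<and> card T = card C \<and> (\<forall>z\<in>T. h z = v))"

lemma not_many_imp:
  assumes "\<not> many h v"
  shows "finite {z \<in> Om - C. h z = v}" "card {z \<in> Om - C. h z = v} < card C"
proof -
  show fin: "finite {z \<in> Om - C. h z = v}"
  proof (rule ccontr)
    assume "infinite {z \<in> Om - C. h z = v}"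
    then obtain T where T: "finite T" "card T = card C" "T \<subseteq> {z \<in> Om - C. h z = v}"
      using infinite_arbitrarily_large[of _ "card C"] by blast
    then have "many h v" unfolding many_def by (intro exI[of _ T]) auto
    then show False using assms by simp
  qed
  show "card {z \<in> Om - C. h z = v} < card C"
  proof (rule ccontr)
    assume "\<not> ?thesis"
    then have "card C \<le> card {z \<in> Om - C. h z = v}" by simp
    then obtain T where T: "T \<subseteq> {z \<in> Om - C. h z = v}" "card T = card C" "finite T"
      by (rule obtain_subset_with_card_n)
    then have "many h v" unfolding many_def by (intro exI[of _ T]) auto
    then show False using assms by simp
  qed
qed

text \<open>By the open mapping theorem each of the \<open>card C\<close> preimages persists in its
  own small disk, and the disks are disjoint.\<close>

lemma open_many:
  assumes "blowup h" shows "open {v. many h v}"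
proof (rule openI)
  fix v assume "v \<in> {v. many h v}"
  then obtain T where T: "T \<subseteq> Om - C" "finite T" "card T = card C" "\<forall>z\<in>T. h z = v"
    by (auto simp: many_def)
  obtain d where d: "d > 0" "\<forall>p\<in>T. \<forall>q\<in>T. p \<noteq> q \<longrightarrow> ball p d \<inter> ball q d = {}"
    using finite_separation[OF T(2)] by blast
  define W where "W = (\<Inter>p\<in>T. h ` (ball p d \<inter> (Om - C)))"
  have "open W" unfolding W_def
    using T(2) open_punctured by (intro open_INT blowup_open_image[OF assms] ballI open_Int) auto
  moreover have "v \<in> W" unfolding W_def
  proof
    fix p assume "p \<in> T"
    then show "v \<in> h ` (ball p d \<inter> (Om - C))"
      using T(1,4) d(1) by (intro image_eqI[of _ _ p]) auto
  qed
  ultimately obtain e where e: "e > 0" "ball v e \<subseteq> W" using open_contains_ball[of W] by blast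
  have "many h u" if "u \<in> ball v e" for u
  proof -
    have "\<forall>p\<in>T. \<exists>z. z \<in> ball p d \<and> z \<in> Om - C \<and> h z = u"
    proof
      fix p assume "p \<in> T"
      have "u \<in> W" using that e(2) by blast
      then have "u \<in> h ` (ball p d \<inter> (Om - C))" using \<open>p \<in> T\<close> by (simp add: W_def)
      then show "\<exists>z. z \<in> ball p d \<and> z \<in> Om - C \<and> h z = u" by blast
    qed
    then obtain f where f: "\<forall>p\<in>T. f p \<in> ball p d \<and> f p \<in> Om - C \<and> h (f p) = u"
      by (rule bchoice[THEN exE])
    have inj: "inj_on f T"
    proof (rule inj_onI, rule ccontr)
      fix p q assume pq: "p \<in> T" "q \<in> T" "f p = f q" "p \<noteq> q"
      then have "f p \<in> ball p d" "f p \<in> ball q d" using f by auto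
      then show False using d(2) pq by blast
    qed
    show ?thesis unfolding many_def
    proof (intro exI[of _ "f ` T"] conjI)
      show "card (f ` T) = card C" using card_image[OF inj] T(3) by simp
      show "f ` T \<subseteq> Om - C" "\<forall>z\<in>f ` T. h z = u" using f by blast+
    qed (use T in auto)
  qed
  then show "\<exists>e>0. ball v e \<subseteq> {v. many h v}" using e(1) by blast
qed

lemma subsequence_cases:
  fixes x :: "nat \<Rightarrow> complex"
  assumes "\<And>n. x n \<in> Om"
  obtains l s where "strict_mono s" "(x \<circ> s) \<longlonglongrightarrow> l" "l \<in> closure Om"
proof -
  have "compact (closure Om)" using bounded_Om by simp
  have "\<And>n. x n \<in> closure Om" using assms closure_subset by blast
  then have "\<forall>n. x n \<in> closure Om" by blast
  from seq_compactE[OF compact_imp_seq_compact[OF \<open>compact (closure Om)\<close>] this] show ?thesis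
    using that by metis
qed

lemma filterlim_at_frontier:
  assumes "\<And>n. x n \<in> Om" "x \<longlonglongrightarrow> l" "l \<in> frontier Om"
  shows "filterlim x (at l within Om) sequentially"
  unfolding filterlim_at using assms frontier_notin[of l] by (auto intro!: always_eventually)

lemma tendsto_S_frontier:
  assumes "\<And>n. x n \<in> Om" "x \<longlonglongrightarrow> l" "l \<in> frontier Om"
  shows "(\<lambda>n. S (x n)) \<longlonglongrightarrow> cnj l"
  using filterlim_compose[OF bdry_S[OF assms(3)] filterlim_at_frontier[OF assms]] .

lemma tendsto_hol:
  assumes "h holomorphic_on Om - C" "x \<longlonglongrightarrow> l" "l \<in> Om - C"
  shows "(\<lambda>n. h (x n)) \<longlonglongrightarrow> h l"
proof -
  have "isCont h l"
    using assms(1,3) open_punctured by (metis continuous_on_eq_continuous_at holomorphic_on_imp_continuous_on)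
  then show ?thesis using assms(2) by (rule isCont_tendsto_compose)
qed

lemma blowup_not_convergent:
  assumes "blowup h" "\<And>n. x n \<in> Om - C" "x \<longlonglongrightarrow> l" "l \<in> C" "(\<lambda>n. h (x n)) \<longlonglongrightarrow> v"
  shows False
proof -
  have "filterlim x (at l) sequentially"
    unfolding filterlim_at
  proof
    show "\<forall>\<^sub>F n in sequentially. x n \<in> UNIV \<and> x n \<noteq> l"
      by (rule always_eventually) (use assms(2,4) in blast)
  qed (rule assms(3))
  then have "filterlim (\<lambda>n. h (x n)) at_infinity sequentially"
    using assms(1,4) by (auto simp: blowup_def intro: filterlim_compose)
  then show False using assms(5) not_tendsto_and_filterlim_at_infinity by (metis trivial_limit_sequentially)
qed

text \<open>The counterpart of \<open>open_many\<close>. Preimages of values tending to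
  \<open>v\<close> accumulate neither at a pole, where \<open>G\<close> is large, nor on the
  frontier, whose values differ from \<open>v\<close>; so they lie close to old preimages. As
  \<open>G\<close> is injective near each of these, the count cannot grow.\<close>

lemma few_solutions:
  assumes G: "blowup G"
    and lim: "\<And>w. w \<in> frontier Om \<Longrightarrow> (G \<longlongrightarrow> \<beta> w) (at w within Om)"
    and v: "\<And>w. w \<in> frontier Om \<Longrightarrow> \<beta> w \<noteq> v"
    and few: "\<not> many G v"
    and simple: "\<And>z. z \<in> Om - C \<Longrightarrow> G z = v \<Longrightarrow> deriv G z \<noteq> 0"
  shows "\<exists>\<delta>>0. \<forall>u. dist u v < \<delta> \<longrightarrow> \<not> many G u"
proof -
  define Z where "Z = {z \<in> Om - C. G z = v}"
  have Z: "finite Z" "card Z < card C" using not_many_imp[OF few] by (auto simp: Z_def)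
  have hol: "G holomorphic_on Om - C" using G by (simp add: blowup_def)
  have "\<forall>z\<in>Z. \<exists>r>0. ball z r \<subseteq> Om - C \<and> inj_on G (ball z r)"
  proof
    fix z assume "z \<in> Z"
    then have "z \<in> Om - C" "deriv G z \<noteq> 0" using simple by (auto simp: Z_def)
    then show "\<exists>r>0. ball z r \<subseteq> Om - C \<and> inj_on G (ball z r)"
      using has_complex_derivative_locally_injective[OF hol _ open_punctured] by metis
  qed
  then obtain r where r: "\<forall>z\<in>Z. r z > 0 \<and> ball z (r z) \<subseteq> Om - C \<and> inj_on G (ball z (r z))"
    by (rule bchoice[THEN exE])
  have "\<exists>\<delta>>0. \<forall>y\<in>Om - C. dist (G y) v < \<delta> \<longrightarrow> (\<exists>z\<in>Z. y \<in> ball z (r z))"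
  proof (rule ccontr)
    assume neg: "\<not> ?thesis"
    have "\<forall>n. \<exists>y. y \<in> Om - C \<and> dist (G y) v < 1 / real (Suc n) \<and> \<not> (\<exists>z\<in>Z. y \<in> ball z (r z))"
    proof
      fix n :: nat
      have "1 / real (Suc n) > 0" by simp
      then show "\<exists>y. y \<in> Om - C \<and> dist (G y) v < 1 / real (Suc n) \<and> \<not> (\<exists>z\<in>Z. y \<in> ball z (r z))"
        using neg by blast
    qed
    then obtain x where x: "\<forall>n. x n \<in> Om - C \<and> dist (G (x n)) v < 1 / real (Suc n) \<and> \<not> (\<exists>z\<in>Z. x n \<in> ball z (r z))"
      by (rule choice[THEN exE])
    have "\<And>n. x n \<in> Om" using x by blast
    then obtain l s where s: "strict_mono s" "(x \<circ> s) \<longlonglongrightarrow> l" "l \<in> closure Om"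
      using subsequence_cases[of x] by metis
    have "(\<lambda>n. dist (G (x n)) v) \<longlonglongrightarrow> 0"
      by (rule tendsto_sandwich[OF _ _ tendsto_const LIMSEQ_inverse_real_of_nat])
         (use x in \<open>auto simp: inverse_eq_divide intro!: always_eventually less_imp_le\<close>)
    then have "(\<lambda>n. G (x n)) \<longlonglongrightarrow> v" by (rule iffD2[OF tendsto_dist_iff])
    then have Gv: "(\<lambda>n. G ((x \<circ> s) n)) \<longlonglongrightarrow> v"
      using LIMSEQ_subseq_LIMSEQ[OF _ s(1)] by (force simp: o_def)
    have xs: "\<And>n. (x \<circ> s) n \<in> Om - C" using x by auto
    from closure_cases[OF s(3)] show False
    proof (elim disjE)
      assume "l \<in> C"
      then show False using blowup_not_convergent[OF G xs s(2) _ Gv] by blast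
    next
      assume l: "l \<in> Om - C"
      have "G l = v" using tendsto_hol[OF hol s(2) l] Gv LIMSEQ_unique by blast
      then have "l \<in> Z" using l by (simp add: Z_def)
      then have "eventually (\<lambda>n. dist ((x \<circ> s) n) l < r l) sequentially"
        using s(2) r by (auto simp: tendsto_iff)
      then obtain n where "dist ((x \<circ> s) n) l < r l" by (meson eventually_happens' sequentially_bot)
      then show False using x \<open>l \<in> Z\<close> by (force simp: dist_commute)
    next
      assume l: "l \<in> frontier Om"
      have "filterlim (x \<circ> s) (at l within Om) sequentially"
        using filterlim_at_frontier[OF _ s(2) l] xs by blast
      then have "(\<lambda>n. G ((x \<circ> s) n)) \<longlonglongrightarrow> \<beta> l" using lim[OF l] filterlim_compose by blast
      then show False using Gv LIMSEQ_unique v[OF l] by blast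
    qed
  qed
  then obtain \<delta> where \<delta>: "\<delta> > 0" "\<And>y. y \<in> Om - C \<Longrightarrow> dist (G y) v < \<delta> \<Longrightarrow> \<exists>z\<in>Z. y \<in> ball z (r z)" by blast
  have "\<not> many G u" if u: "dist u v < \<delta>" for u
  proof
    assume "many G u"
    then obtain T where T: "T \<subseteq> Om - C" "finite T" "card T = card C" "\<forall>z\<in>T. G z = u"
      by (auto simp: many_def)
    have "\<forall>y\<in>T. \<exists>z. z \<in> Z \<and> y \<in> ball z (r z)"
    proof
      fix y assume "y \<in> T"
      then have "y \<in> Om - C" "dist (G y) v < \<delta>" using T(1,4) u by auto
      from \<delta>(2)[OF this] show "\<exists>z. z \<in> Z \<and> y \<in> ball z (r z)" by blast
    qed
    then obtain f where f: "\<forall>y\<in>T. f y \<in> Z \<and> y \<in> ball (f y) (r (f y))" by (rule bchoice[THEN exE])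
    have "inj_on f T"
    proof (rule inj_onI)
      fix a b assume ab: "a \<in> T" "b \<in> T" "f a = f b"
      have "inj_on G (ball (f a) (r (f a)))" using r f ab by blast
      moreover have "a \<in> ball (f a) (r (f a))" "b \<in> ball (f a) (r (f a))" "G a = G b"
        using f ab T(4) by auto
      ultimately show "a = b" by (auto dest: inj_onD)
    qed
    then have "card T \<le> card Z" using f Z(1) by (intro card_inj_on_le[of f]) auto
    then show False using Z(2) T(3) by simp
  qed
  then show ?thesis using \<delta>(1) by blast
qed

text \<open>The critical values are avoided inside the upper half plane, which stays connected and whose
  points are no boundary values.\<close>
lemma many_zeros:
  assumes G: "blowup G"
    and lim: "\<And>w. w \<in> frontier Om \<Longrightarrow> (G \<longlongrightarrow> \<beta> w) (at w within Om)"
    and \<beta>: "\<And>w. w \<in> frontier Om \<Longrightarrow> Im (\<beta> w) = 0" "\<And>w. w \<in> frontier Om \<Longrightarrow> \<beta> w \<noteq> 0"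
    and simple: "\<And>z. z \<in> Om - C \<Longrightarrow> G z = 0 \<Longrightarrow> deriv G z \<noteq> 0"
  shows "many G 0"
proof (rule ccontr)
  assume no: "\<not> many G 0"
  define V where "V = G ` {z \<in> Om - C. deriv G z = 0}"
  have cV: "countable V" unfolding V_def by (intro countable_image countable_critical_points G)
  define H where "H = {v :: complex. Im v > 0}"
  define X where "X = H - V"
  have H: "open H" "connected H" unfolding H_def
    by (auto simp: open_halfspace_Im_gt convex_halfspace_Im_gt convex_connected)
  have conn: "connected X" unfolding X_def
    using H cV by (intro connected_open_diff_countable) auto
  \<comment> \<open>\<open>X\<close> is dense in the half plane, because a countable set contains no
    disk.\<close>
  have meet: "\<exists>v\<in>X. v \<in> W" if Wo: "open W" and Wne: "W \<inter> H \<noteq> {}" for W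
  proof (rule ccontr)
    assume "\<not> ?thesis"
    then have "W \<inter> H \<subseteq> V" by (auto simp: X_def)
    then have "countable (W \<inter> H)" using cV countable_subset by blast
    have oWH: "open (W \<inter> H)" using Wo H(1) by (rule open_Int)
    obtain y where y: "y \<in> W \<inter> H" using Wne by blast
    with oWH obtain e where "e > 0" "ball y e \<subseteq> W \<inter> H" using open_contains_ball[of "W \<inter> H"] by blast
    moreover have "countable (W \<inter> H)" by fact
    ultimately have "countable (ball y e)" using countable_subset by blast
    then show False using uncountable_ball \<open>e > 0\<close> by blast
  qed
  define A where "A = {v. many G v}"
  define B where "B = interior {v. \<not> many G v}"
  have "X \<subseteq> A \<union> B"
  proof
    fix v assume v: "v \<in> X"
    show "v \<in> A \<union> B"
    proof (cases "many G v")
      case False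
      have "\<exists>\<delta>>0. \<forall>u. dist u v < \<delta> \<longrightarrow> \<not> many G u"
      proof (rule few_solutions[OF G lim _ False])
        show "\<beta> w \<noteq> v" if "w \<in> frontier Om" for w using \<beta>(1)[OF that] v by (auto simp: X_def H_def)
        show "deriv G z \<noteq> 0" if "z \<in> Om - C" "G z = v" for z using that v by (auto simp: X_def V_def)
      qed
      then have "\<exists>\<delta>>0. ball v \<delta> \<subseteq> {v. \<not> many G v}" by (auto simp: subset_iff dist_commute)
      then show ?thesis by (simp add: B_def mem_interior)
    qed (simp add: A_def)
  qed
  moreover have "open A" unfolding A_def by (rule open_many[OF G])
  moreover have "open B" "A \<inter> B \<inter> X = {}" unfolding A_def B_def using interior_subset by auto
  \<comment> \<open>Having many and having few preimages are both open conditions on the connected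
    set \<open>X\<close>; values of large modulus decide which of the two holds throughout.\<close>
  ultimately have "A \<inter> X = {} \<or> B \<inter> X = {}" using connectedD[OF conn] by blast
  moreover have "A \<inter> X \<noteq> {}"
  proof -
    obtain M where M: "M > 0" "\<And>v. norm v > M \<Longrightarrow> many G v"
      using blowup_many_solutions[OF G] unfolding many_def by blast
    have "open (- cball (0::complex) M)" by auto
    moreover have "\<i> * of_real (M + 1) \<in> - cball 0 M \<inter> H"
      using M(1) by (auto simp: H_def norm_mult)
    ultimately obtain v where "v \<in> X" "v \<in> - cball 0 M" using meet by blast
    then show ?thesis using M(2)[of v] by (auto simp: A_def)
  qed
  ultimately have XA: "X \<subseteq> A" using \<open>X \<subseteq> A \<union> B\<close> by blast
  \<comment> \<open>The value \<open>0\<close> is regular and no boundary value, so too few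
    preimages of \<open>0\<close> would mean too few for nearby points of \<open>X\<close>, against
    \<open>X \<subseteq> A\<close>.\<close>
  obtain \<delta> where \<delta>: "\<delta> > 0" "\<And>u. dist u 0 < \<delta> \<Longrightarrow> \<not> many G u"
    using few_solutions[OF G lim \<beta>(2) no simple] by blast
  have "\<i> * of_real (\<delta>/2) \<in> ball 0 \<delta> \<inter> H" using \<delta>(1) by (auto simp: H_def norm_mult)
  then obtain v where "v \<in> X" "v \<in> ball 0 \<delta>" using meet[of "ball 0 \<delta>"] by blast
  then show False using XA \<delta>(2)[of v] by (auto simp: A_def)
qed


section \<open>Reflection in the boundary and generic points\<close>

lemma open_cnj:
  assumes "open (A :: complex set)" shows "open (cnj ` A)"
proof -
  have "cnj ` A = cnj -` A" by (auto intro!: image_eqI[of _ cnj "cnj _"])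
  moreover have "open (cnj -` A)" by (intro open_vimage assms continuous_intros)
  ultimately show ?thesis by simp
qed

text \<open>The points over which two sheets coincide: for \<open>z = cnj (S w)\<close> the
  condition \<open>S z = cnj w\<close> says that the root \<open>S w\<close> also occurs as
  \<open>cnj z\<close>. Points of \<open>Om - C\<close> with \<open>S w = cnj w\<close> are
  included.\<close>

definition involutive :: "complex set" where
  "involutive = {w \<in> Om - C. cnj (S w) \<in> Om - C \<and> S (cnj (S w)) = cnj w}"

text \<open>The limit could only fail if \<open>cnj (S l)\<close> left \<open>Om - C\<close>. At a
  pole \<open>S\<close> would blow up along a sequence on which it tends to \<open>cnj l\<close>; on
  the frontier the Schwarz condition gives \<open>S l = cnj l\<close>, which puts \<open>l\<close>
  itself on the frontier.\<close>

lemma involutive_closed: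
  assumes x: "\<And>n. x n \<in> involutive" and l: "x \<longlonglongrightarrow> l" "l \<in> Om - C"
  shows "l \<in> involutive"
proof -
  have xs: "\<And>n. x n \<in> Om - C" "\<And>n. cnj (S (x n)) \<in> Om - C" "\<And>n. S (cnj (S (x n))) = cnj (x n)"
    using x by (auto simp: involutive_def)
  have z: "(\<lambda>n. cnj (S (x n))) \<longlonglongrightarrow> cnj (S l)"
    by (intro tendsto_intros tendsto_hol[OF hol_S l])
  have Sz: "(\<lambda>n. S (cnj (S (x n)))) \<longlonglongrightarrow> cnj l"
    unfolding xs(3) by (intro tendsto_intros l)
  have "\<forall>n. cnj (S (x n)) \<in> Om" using xs(2) by blast
  then have "cnj (S l) \<in> closure Om"
    using z closure_sequential[of "cnj (S l)" Om] by (intro iffD2[OF closure_sequential] exI conjI)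
  from closure_cases[OF this] show ?thesis
  proof (elim disjE)
    assume "cnj (S l) \<in> C"
    then show ?thesis using blowup_not_convergent[OF blowup_S xs(2) z _ Sz] by blast
  next
    assume "cnj (S l) \<in> Om - C"
    moreover from tendsto_hol[OF hol_S z this] Sz have "S (cnj (S l)) = cnj l"
      by (rule LIMSEQ_unique)
    ultimately show ?thesis using l(2) by (simp add: involutive_def)
  next
    assume f: "cnj (S l) \<in> frontier Om"
    have "(\<lambda>n. S (cnj (S (x n)))) \<longlonglongrightarrow> cnj (cnj (S l))"
      using tendsto_S_frontier[OF _ z f] xs(2) by blast
    with Sz have "S l = cnj l" using LIMSEQ_unique by fastforce
    then show ?thesis using f l(2) frontier_notin by auto
  qed
qed

text \<open>The set where \<open>w \<mapsto> cnj (S w)\<close> is an involution of \<open>Om\<close> is relatively clopen in its interior, but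
  \<open>cnj (S w)\<close> leaves the bounded set \<open>Om\<close> when \<open>w\<close> approaches a pole.\<close>
lemma involutive_empty_interior: "interior involutive = {}"
proof (rule ccontr)
  assume "interior involutive \<noteq> {}"
  then obtain z where z: "z \<in> interior involutive" by blast
  have zO: "z \<in> Om - C" using z interior_subset by (auto simp: involutive_def)
  define U where "U = connected_component_set Om z - C"
  obtain p where p: "p \<in> C" "p \<in> connected_component_set Om z" using comp_meets_C[of z] zO by blast
  have oc: "open (connected_component_set Om z)" using open_Om by (rule open_connected_component)
  have oU: "open U" unfolding U_def using oc finite_C by (simp add: finite_imp_closed open_Diff)
  have cU: "connected U" unfolding U_def
    using oc finite_C by (intro connected_open_delete_finite) auto
  have sub: "U \<subseteq> Om - C" unfolding U_def using connected_component_subset[of Om z] by auto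
  have zU: "z \<in> U" using zO by (simp add: U_def)
  have cont: "continuous_on (Om - C) S" using hol_S by (rule holomorphic_on_imp_continuous_on)
  have lim: "l \<in> interior involutive" if l: "l \<in> closure (interior involutive)" "l \<in> Om - C" for l
  proof -
    obtain x where x: "\<And>n. x n \<in> interior involutive" "x \<longlonglongrightarrow> l"
      using l(1) closure_sequential by metis
    have "l \<in> involutive"
      by (rule involutive_closed[OF _ x(2) l(2)]) (use x(1) interior_subset in blast)
    then have m: "cnj (S l) \<in> Om - C" by (simp add: involutive_def)
    have "open ((Om - C) \<inter> S -` (cnj ` (Om - C)))"
      using cont open_punctured open_cnj by (intro continuous_open_preimage) auto
    moreover have "l \<in> (Om - C) \<inter> S -` (cnj ` (Om - C))"
      using l(2) m by (auto intro!: image_eqI[of _ cnj "cnj (S l)"])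
    ultimately obtain r where r: "r > 0" "ball l r \<subseteq> (Om - C) \<inter> S -` (cnj ` (Om - C))"
      by (meson open_contains_ball)
    have inO: "y \<in> Om - C" "cnj (S y) \<in> Om - C" if "y \<in> ball l r" for y
    proof -
      have "y \<in> (Om - C) \<inter> S -` (cnj ` (Om - C))" using that r(2) by blast
      then obtain u where "y \<in> Om - C" "u \<in> Om - C" "S y = cnj u" by blast
      then show "y \<in> Om - C" "cnj (S y) \<in> Om - C" by auto
    qed
    \<comment> \<open>Two conjugations cancel: the double reflection is holomorphic, so the identity
      theorem extends \<open>\<psi> y = y\<close> from an open part to the whole ball.\<close>
    define \<psi> where "\<psi> y = (cnj \<circ> S \<circ> cnj) (S y)" for y
    have "(cnj \<circ> S \<circ> cnj) holomorphic_on (cnj ` (Om - C))"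
      using hol_S open_cnj[OF open_punctured]
      by (intro holomorphic_on_compose_cnj_cnj) (auto simp: image_comp o_def)
    then have "((cnj \<circ> S \<circ> cnj) \<circ> S) holomorphic_on ball l r"
    proof (rule holomorphic_on_compose_gen[rotated])
      show "S holomorphic_on ball l r" using r(2) by (intro holomorphic_on_subset[OF hol_S]) blast
      show "S ` ball l r \<subseteq> cnj ` (Om - C)" using r(2) by blast
    qed
    then have hol: "(\<lambda>y. \<psi> y - y) holomorphic_on ball l r"
      unfolding \<psi>_def by (intro holomorphic_intros) (simp add: o_def)
    have "ball l r \<inter> interior involutive \<noteq> {}"
      using l(1) r(1) by (metis centre_in_ball closure_iff_nhds_not_empty Int_commute interior_open open_ball order_refl)
    then obtain y where y: "y \<in> ball l r" "y \<in> interior involutive" by blast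
    have "y islimpt (ball l r \<inter> interior involutive)"
      using y by (intro interior_limit_point) (simp add: interior_open open_Int)
    have "\<psi> v - v = 0" if "v \<in> ball l r" for v
    proof (rule analytic_continuation[OF hol _ _ _ y(1)])
      show "\<psi> u - u = 0" if "u \<in> ball l r \<inter> interior involutive" for u
      proof -
        have "u \<in> involutive" using that interior_subset by blast
        then show ?thesis by (simp add: \<psi>_def involutive_def)
      qed
    qed (use that \<open>y islimpt _\<close> in auto)
    then have "ball l r \<subseteq> involutive"
    proof (intro subsetI)
      fix v assume v: "v \<in> ball l r" and *: "\<And>v. v \<in> ball l r \<Longrightarrow> \<psi> v - v = 0"
      have "cnj (cnj (S (cnj (S v)))) = cnj v" using *[OF v] by (simp add: \<psi>_def)
      then show "v \<in> involutive" using inO[OF v] by (simp add: involutive_def)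
    qed
    then show ?thesis using r(1) mem_interior by blast
  qed
  have "U \<subseteq> interior involutive"
  proof (rule ccontr)
    assume "\<not> ?thesis"
    moreover have "U \<subseteq> interior involutive \<union> - closure (interior involutive)"
      using lim sub by blast
    moreover have "interior involutive \<inter> (- closure (interior involutive)) = {}"
      using closure_subset by blast
    ultimately show False
      using connectedD[OF cU, of "interior involutive" "- closure (interior involutive)"] z zU by blast
  qed
  then have U: "y \<in> U \<Longrightarrow> cnj (S y) \<in> Om" for y
    using interior_subset by (fastforce simp: involutive_def)
  obtain K where K: "\<And>y. y \<in> Om \<Longrightarrow> norm y < K" 
    using bounded_Om bounded_pos_less by metis
  have "open (connected_component_set Om z - (C - {p}))"
    using oc finite_C by (simp add: finite_imp_closed open_Diff)
  then have "eventually (\<lambda>y. y \<in> connected_component_set Om z - (C - {p}) - {p}) (at p)"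
    using p by (intro eventually_at_in_open) auto
  then have "eventually (\<lambda>y. norm (S y) < K) (at p)"
    by (rule eventually_mono) (use K U in \<open>force simp: U_def\<close>)
  moreover have "eventually (\<lambda>y. norm (S y) \<ge> max 1 K) (at p)"
  proof -
    have "max 1 K > 0" by simp
    then show ?thesis
      using pole_S_infinity[OF p(1)] unfolding filterlim_at_infinity[OF order_refl] by blast
  qed
  ultimately have "eventually (\<lambda>y. False) (at p)" by eventually_elim auto
  then show False by simp
qed

text \<open>Over such a point no sheet is infinite, the sheets are pairwise distinct and all
  preimages are simple, so that zeros can be counted without multiplicity.\<close>

definition good :: "complex \<Rightarrow> bool" where
  "good w \<longleftrightarrow> w \<notin> frontier Om \<and> w \<notin> C \<and> w \<notin> involutive \<and>
     (\<forall>z \<in> Om - C. S z = cnj w \<longrightarrow> deriv S z \<noteq> 0)"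

text \<open>The frontier of an open set has empty interior, \<open>involutive\<close> is closed in
  \<open>Om - C\<close> with empty interior, and the critical values are countable. The finite set
  \<open>X\<close> leaves room for the exceptional points of later relations.\<close>

lemma good_dense:
  assumes "open W" "W \<noteq> {}" "finite X"
  shows "\<exists>w\<in>W. good w \<and> w \<notin> X"
proof -
  define W1 where "W1 = W - frontier Om - C - X"
  have "open W1" unfolding W1_def
    using assms finite_C by (intro open_Diff) (auto simp: finite_imp_closed frontier_closed)
  have "interior (frontier Om) = {}"
  proof (rule ccontr)
    assume "interior (frontier Om) \<noteq> {}"
    then obtain y where y: "y \<in> interior (frontier Om)" by blast
    then have "y \<in> closure Om" using interior_subset by (force simp: frontier_def)
    then have "interior (frontier Om) \<inter> Om \<noteq> {}"
      using y open_Int_closure_eq_empty[OF open_interior, of "frontier Om" Om] by blast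
    then show False using interior_subset[of "frontier Om"] frontier_notin by blast
  qed
  then have "\<not> W \<subseteq> frontier Om" using assms interior_maximal by blast
  then obtain a where a: "a \<in> W - frontier Om" by blast
  have "open (W - frontier Om)" using assms by (simp add: frontier_closed open_Diff)
  then have "infinite (W - frontier Om)"
    using a islimpt_finite[of "W - frontier Om" a] interior_limit_point[of a "W - frontier Om"]
    by (auto simp: interior_open)
  then have "W1 \<noteq> {}" unfolding W1_def using assms(3) finite_C
    by (metis Diff_infinite_finite finite.emptyI)
  define W2 where "W2 = {w \<in> W1. w \<notin> involutive}"
  have "\<not> W1 \<subseteq> involutive" using involutive_empty_interior \<open>open W1\<close> \<open>W1 \<noteq> {}\<close> interior_maximal by blast
  then obtain b where b: "b \<in> W1" "b \<notin> involutive" by blast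
  \<comment> \<open>If points of \<open>involutive\<close> accumulated at \<open>b\<close>, then
    \<open>b\<close> would lie in \<open>Om - C\<close>, since \<open>W1\<close> avoids the frontier
    and \<open>C\<close>, and hence in \<open>involutive\<close> by closedness.\<close>
  have "\<exists>e>0. ball b e \<subseteq> W1 - involutive"
  proof (rule ccontr)
    assume neg: "\<not> ?thesis"
    obtain e where e: "e > 0" "ball b e \<subseteq> W1" using b \<open>open W1\<close> open_contains_ball by blast
    have "\<forall>n. \<exists>y. y \<in> involutive \<and> dist b y < e / real (Suc n)"
    proof
      fix n :: nat
      have le: "ball b (e / real (Suc n)) \<subseteq> ball b e" using e(1) by (intro subset_ball) (simp add: field_simps)
      have "e / real (Suc n) > 0" using e(1) by simp
      then have "\<not> ball b (e / real (Suc n)) \<subseteq> W1 - involutive" using neg by blast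
      then show "\<exists>y. y \<in> involutive \<and> dist b y < e / real (Suc n)" using e(2) le by auto
    qed
    then obtain x where x: "\<forall>n. x n \<in> involutive \<and> dist b (x n) < e / real (Suc n)"
      by (rule choice[THEN exE])
    have "(\<lambda>n. e * inverse (real (Suc n))) \<longlonglongrightarrow> e * 0"
      by (intro tendsto_intros LIMSEQ_inverse_real_of_nat)
    then have "(\<lambda>n. e / real (Suc n)) \<longlonglongrightarrow> 0" by (simp add: divide_inverse)
    then have "(\<lambda>n. dist (x n) b) \<longlonglongrightarrow> 0"
    proof (rule tendsto_sandwich[where f="\<lambda>_. 0" and h="\<lambda>n. e / real (Suc n)", rotated 3])
      show "\<forall>\<^sub>F n in sequentially. dist (x n) b \<le> e / real (Suc n)"
        using x by (intro always_eventually) (metis dist_commute less_imp_le)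
    qed auto
    then have xb: "x \<longlonglongrightarrow> b" by (rule iffD2[OF tendsto_dist_iff])
    have "b \<in> closure Om" using xb x closure_sequential[of b Om] unfolding involutive_def by blast
    then have "b \<in> Om - C" using closure_cases b(1) by (auto simp: W1_def)
    then show False using involutive_closed[OF _ xb] x b(2) by blast
  qed
  then obtain e where e: "e > 0" "ball b e \<subseteq> W1 - involutive" by blast
  define V where "V = (\<lambda>z. cnj (S z)) ` {z \<in> Om - C. deriv S z = 0}"
  have "countable V" unfolding V_def by (intro countable_image countable_critical_points blowup_S)
  then have "\<not> ball b e \<subseteq> V" using uncountable_ball[OF e(1)] countable_subset by blast
  then obtain w where w: "w \<in> ball b e" "w \<notin> V" by blast
  then have w1: "w \<in> W1" "w \<notin> involutive" using e(2) by auto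
  moreover have "deriv S z \<noteq> 0" if "z \<in> Om - C" "S z = cnj w" for z
  proof
    assume "deriv S z = 0"
    then have "cnj (S z) \<in> V" using that unfolding V_def by blast
    then show False using w(2) that by simp
  qed
  ultimately have "good w" by (auto simp: good_def W1_def)
  then show ?thesis using w1 by (auto simp: W1_def)
qed

definition sheets :: "complex \<Rightarrow> complex set" where
  "sheets w = cnj ` {z \<in> Om - C. S z = cnj w} \<union> (if w \<in> Om then {S w} else {})"

lemma good_sheets:
  assumes "good w"
  shows "\<exists>T. T \<subseteq> sheets w \<and> finite T \<and> card T = card C"
proof -
  define G where "G = (\<lambda>z. (z - w) * (S z - cnj w))"
  have holG: "G holomorphic_on Om - C" unfolding G_def by (intro holomorphic_intros hol_S)
  have inv: "w \<notin> involutive" "w \<notin> C" "w \<notin> frontier Om" using assms by (auto simp: good_def)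
  have Sw: "S w \<noteq> cnj w" if "w \<in> Om"
    using inv that by (auto simp: involutive_def)
  have blow: "blowup G"
    unfolding blowup_def
  proof (intro conjI ballI)
    fix p assume p: "p \<in> C"
    then have "p \<noteq> w" using inv by auto
    have "filterlim (\<lambda>z. - cnj w + S z) at_infinity (at p)"
      by (rule tendsto_add_filterlim_at_infinity[OF tendsto_const pole_S_infinity[OF p]])
    moreover have "((\<lambda>z. z - w) \<longlongrightarrow> p - w) (at p)" by (intro tendsto_intros)
    ultimately have "filterlim (\<lambda>z. (z - w) * (- cnj w + S z)) at_infinity (at p)"
      using \<open>p \<noteq> w\<close> by (intro tendsto_mult_filterlim_at_infinity) auto
    then show "filterlim G at_infinity (at p)" by (simp add: G_def)
  qed (rule holG)
  have "many G 0"
  proof (rule many_zeros[OF blow])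
    show "(G \<longlongrightarrow> (\<zeta> - w) * (cnj \<zeta> - cnj w)) (at \<zeta> within Om)" if "\<zeta> \<in> frontier Om" for \<zeta>
      unfolding G_def by (intro tendsto_intros bdry_S that)
    show "Im ((\<zeta> - w) * (cnj \<zeta> - cnj w)) = 0" for \<zeta> by (simp add: algebra_simps)
    show "(\<zeta> - w) * (cnj \<zeta> - cnj w) \<noteq> 0" if "\<zeta> \<in> frontier Om" for \<zeta>
    proof -
      have "\<zeta> \<noteq> w" using that inv by auto
      then show ?thesis by (simp flip: complex_cnj_diff)
    qed
    \<comment> \<open>At the zero \<open>z = w\<close> the derivative is \<open>S w - cnj w\<close>,
      nonzero because \<open>w\<close> is not involutive; at the other zeros it is
      \<open>(z - w) * deriv S z\<close>, nonzero by goodness.\<close>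
    show "deriv G z \<noteq> 0" if z: "z \<in> Om - C" "G z = 0" for z
    proof -
      have dS: "(S has_field_derivative deriv S z) (at z)"
        using hol_S open_punctured z(1) by (rule holomorphic_derivI)
      have "(G has_field_derivative (S z - cnj w) + (z - w) * deriv S z) (at z)"
        unfolding G_def by (rule derivative_eq_intros dS refl | simp)+
      then have d: "deriv G z = (S z - cnj w) + (z - w) * deriv S z" by (rule DERIV_imp_deriv)
      show ?thesis
      proof (cases "z = w")
        case True then show ?thesis using d Sw z(1) by auto
      next
        case False
        then have "S z = cnj w" using z(2) by (simp add: G_def)
        then show ?thesis using d False assms z(1) by (auto simp: good_def)
      qed
    qed
  qed
  then obtain T where T: "T \<subseteq> Om - C" "finite T" "card T = card C" "\<forall>z\<in>T. G z = 0"
    by (auto simp: many_def)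
  \<comment> \<open>The zero \<open>w\<close> of \<open>G\<close> is traded for the root
    \<open>S w\<close>, every other zero \<open>z\<close> for \<open>cnj z\<close>; a collision
    would make \<open>w\<close> involutive.\<close>
  define f where "f z = (if z = w then S w else cnj z)" for z
  have "S w \<noteq> cnj z" if "z \<in> T" "z \<noteq> w" "w \<in> T" for z
  proof
    assume e: "S w = cnj z"
    have "S z = cnj w" using T(4) that by (auto simp: G_def)
    then have "w \<in> involutive" using that T(1) e by (auto simp: involutive_def)
    then show False using inv by simp
  qed
  then have "inj_on f T" by (intro inj_onI) (metis complex_cnj_cnj f_def)
  moreover have "f ` T \<subseteq> sheets w"
    using T(1,4) by (auto simp: f_def sheets_def G_def)
  ultimately show ?thesis
    using T by (intro exI[of _ "f ` T"]) (auto simp: card_image)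
qed

end

section \<open>Algebraic relations for the Schwarz function\<close>

text \<open>Gaussian elimination: equation \<open>j\<close> is solved for the unknown
  \<open>i0\<close>, which leaves one equation and one unknown fewer.\<close>

lemma homogeneous_system_solvable:
  fixes \<phi> :: "'j \<Rightarrow> 'i \<Rightarrow> 'a::field"
  assumes "finite J" "finite I" "card J < card I"
  shows "\<exists>f. (\<exists>i\<in>I. f i \<noteq> 0) \<and> (\<forall>j\<in>J. (\<Sum>i\<in>I. f i * \<phi> j i) = 0)"
  using assms
proof (induction J arbitrary: I \<phi> rule: finite_induct)
  case empty
  then show ?case by (intro exI[of _ "\<lambda>_. 1"]) (auto simp: card_gt_0_iff)
next
  case (insert j J)
  show ?case
  proof (cases "\<forall>i\<in>I. \<phi> j i = 0")
    case True
    obtain f where f: "\<exists>i\<in>I. f i \<noteq> 0" "\<forall>j\<in>J. (\<Sum>i\<in>I. f i * \<phi> j i) = 0"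
      using insert.IH[of I \<phi>] insert.prems insert.hyps by auto
    have "(\<Sum>i\<in>I. f i * \<phi> j i) = 0" using True by (intro sum.neutral) auto
    then show ?thesis using f by (intro exI[of _ f]) auto
  next
    case False
    then obtain i0 where i0: "i0 \<in> I" "\<phi> j i0 \<noteq> 0" by blast
    define \<phi>' where "\<phi>' j' i = \<phi> j' i - \<phi> j' i0 * \<phi> j i / \<phi> j i0" for j' i
    have "card J < card (I - {i0})" using insert.prems insert.hyps i0 by simp
    then obtain g where g: "\<exists>i\<in>I - {i0}. g i \<noteq> 0" "\<And>j'. j' \<in> J \<Longrightarrow> (\<Sum>i\<in>I - {i0}. g i * \<phi>' j' i) = 0"
      using insert.IH[of "I - {i0}" \<phi>'] insert.prems by blast
    define s where "s = (\<Sum>i\<in>I - {i0}. g i * \<phi> j i)"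
    define f where "f i = (if i = i0 then - s / \<phi> j i0 else g i)" for i
    have split: "(\<Sum>i\<in>I. f i * \<phi> j' i) = - s / \<phi> j i0 * \<phi> j' i0 + (\<Sum>i\<in>I - {i0}. g i * \<phi> j' i)" for j'
    proof -
      have "(\<Sum>i\<in>I. f i * \<phi> j' i) = f i0 * \<phi> j' i0 + (\<Sum>i\<in>I - {i0}. f i * \<phi> j' i)"
        using insert.prems i0(1) by (simp add: sum.remove)
      also have "(\<Sum>i\<in>I - {i0}. f i * \<phi> j' i) = (\<Sum>i\<in>I - {i0}. g i * \<phi> j' i)"
        by (rule sum.cong) (auto simp: f_def)
      finally show ?thesis by (simp add: f_def)
    qed
    have "(\<Sum>i\<in>I. f i * \<phi> j' i) = 0" if j': "j' \<in> insert j J" for j'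
    proof (cases "j' = j")
      case True then show ?thesis using split[of j] i0(2) by (simp add: s_def)
    next
      case False
      then have "j' \<in> J" using j' by auto
      have "(\<Sum>i\<in>I - {i0}. g i * \<phi>' j' i) = (\<Sum>i\<in>I - {i0}. g i * \<phi> j' i - (\<phi> j' i0 / \<phi> j i0) * (g i * \<phi> j i))"
        by (rule sum.cong) (auto simp: \<phi>'_def algebra_simps)
      also have "\<dots> = (\<Sum>i\<in>I - {i0}. g i * \<phi> j' i) - \<phi> j' i0 / \<phi> j i0 * s"
        unfolding sum_subtractf s_def by (simp only: sum_distrib_left)
      finally have "(\<Sum>i\<in>I - {i0}. g i * \<phi> j' i) = \<phi> j' i0 / \<phi> j i0 * s" using g(2)[OF \<open>j' \<in> J\<close>] by simp
      then show ?thesis using split[of j'] by simp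
    qed
    moreover have "\<exists>i\<in>I. f i \<noteq> 0" using g(1) by (auto simp: f_def)
    ultimately show ?thesis by blast
  qed
qed

lemma higher_deriv_sum_cmult:
  assumes "finite I" "\<And>i. i \<in> I \<Longrightarrow> h i holomorphic_on W" "open W" "z \<in> W"
  shows "(deriv ^^ m) (\<lambda>y. \<Sum>i\<in>I. f i * h i y) z = (\<Sum>i\<in>I. f i * (deriv ^^ m) (h i) z)"
  using assms(1,2)
proof (induction I rule: finite_induct)
  case empty
  then show ?case by simp
next
  case (insert i I)
  have "(deriv ^^ m) (\<lambda>y. \<Sum>i\<in>insert i I. f i * h i y) z = (deriv ^^ m) (\<lambda>y. f i * h i y + (\<Sum>i\<in>I. f i * h i y)) z"
    using insert.hyps by simp
  also have "\<dots> = (deriv ^^ m) (\<lambda>y. f i * h i y) z + (deriv ^^ m) (\<lambda>y. \<Sum>i\<in>I. f i * h i y) z"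
    using insert.prems assms(3,4) by (intro higher_deriv_add[where S=W] holomorphic_intros) auto
  also have "(deriv ^^ m) (\<lambda>y. f i * h i y) z = f i * (deriv ^^ m) (h i) z"
    using insert.prems assms(3,4) by (intro higher_deriv_cmult[where A=W]) auto
  finally show ?case using insert by simp
qed

text \<open>The Taylor series of \<open>h\<close>, shifted by \<open>Suc N\<close> places, is the
  quotient.\<close>

lemma holomorphic_factor_of_vanishing_derivs:
  assumes h: "h holomorphic_on ball p r" and r: "r > 0"
    and d: "\<And>m. m \<le> N \<Longrightarrow> (deriv ^^ m) h p = 0"
  obtains g where "g holomorphic_on ball p r" "\<And>z. z \<in> ball p r \<Longrightarrow> h z = (z - p) ^ Suc N * g z"
proof -
  define a where "a n = (deriv ^^ n) h p / fact n" for n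
  define b where "b n = a (n + Suc N)" for n
  have s: "(\<lambda>n. a n * (w - p) ^ n) sums h w" if "w \<in> ball p r" for w
    using holomorphic_power_series[OF h that] by (simp add: a_def)
  have bs: "(\<lambda>n. b n * (w - p) ^ n) sums (h w / (w - p) ^ Suc N)" if w: "w \<in> ball p r" "w \<noteq> p" for w
  proof -
    have "(\<lambda>n. a (n + Suc N) * (w - p) ^ (n + Suc N)) sums (h w - (\<Sum>i<Suc N. a i * (w - p) ^ i))"
      using s[OF w(1)] by (rule sums_split_initial_segment)
    also have "(\<Sum>i<Suc N. a i * (w - p) ^ i) = 0"
      by (rule sum.neutral) (auto simp: a_def d)
    finally have "(\<lambda>n. a (n + Suc N) * (w - p) ^ (n + Suc N) / (w - p) ^ Suc N) sums (h w / (w - p) ^ Suc N)"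
      by (intro sums_divide) simp
    moreover have "(\<lambda>n. a (n + Suc N) * (w - p) ^ (n + Suc N) / (w - p) ^ Suc N) = (\<lambda>n. b n * (w - p) ^ n)"
      using w(2) by (auto simp: b_def power_add)
    ultimately show ?thesis by simp
  qed
  define g where "g z = (if z = p then b 0 else h z / (z - p) ^ Suc N)" for z
  have gs: "(\<lambda>n. b n * (w - p) ^ n) sums g w" if "w \<in> ball p r" for w
  proof (cases "w = p")
    case True
    have "(\<lambda>n. b n * 0 ^ n) sums b 0" using powser_sums_zero[of b] by simp
    then show ?thesis using True by (simp add: g_def)
  next
    case False then show ?thesis using bs[OF that] by (simp add: g_def)
  qed
  have "g holomorphic_on ball p r" by (rule power_series_holomorphic[OF gs])
  moreover have "h z = (z - p) ^ Suc N * g z" if "z \<in> ball p r" for z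
    using d[of 0] by (auto simp: g_def)
  ultimately show ?thesis using that by blast
qed

context schwarz_domain
begin

lemma pole_removable:
  assumes p: "p \<in> C"
  obtains T r where "r > 0" "T holomorphic_on ball p r" "ball p r - {p} \<subseteq> Om - C"
    "\<And>z. z \<in> ball p r - {p} \<Longrightarrow> T z = (z - p) * S z" "T p \<noteq> 0"
proof -
  obtain \<rho> where \<rho>: "\<rho> \<noteq> 0" "((\<lambda>z. (z - p) * S z) \<longlongrightarrow> \<rho>) (at p)" using pole_S[OF p] by blast
  have "open (Om - (C - {p}))" using open_Om finite_C by (simp add: finite_imp_closed open_Diff)
  moreover have "p \<in> Om - (C - {p})" using p C_sub by auto
  ultimately obtain r where r: "r > 0" "ball p r \<subseteq> Om - (C - {p})"
    using open_contains_ball[of "Om - (C - {p})"] by blast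
  have sub: "ball p r - {p} \<subseteq> Om - C" using r(2) by blast
  define T where "T z = (if z = p then \<rho> else (z - p) * S z)" for z
  have "T holomorphic_on ball p r"
  proof (rule no_isolated_singularity'[where K="{p}"])
    have "(T \<longlongrightarrow> \<rho>) (at p)"
      by (rule Lim_transform_eventually[OF \<rho>(2)]) (auto simp: T_def eventually_at_filter)
    then show "(T \<longlongrightarrow> T z) (at z within ball p r)" if "z \<in> {p}" for z
      using that by (auto simp: T_def intro: Lim_at_imp_Lim_at_within)
    have "(\<lambda>z. (z - p) * S z) holomorphic_on ball p r - {p}"
      by (intro holomorphic_intros holomorphic_on_subset[OF hol_S] sub)
    then show "T holomorphic_on ball p r - {p}"
      by (rule holomorphic_transform) (auto simp: T_def)
  qed auto
  then show ?thesis using that[of r T] r(1) sub \<rho>(1) by (auto simp: T_def)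
qed

text \<open>Multiplication by \<open>(z - p) ^ N\<close> clears the pole. Killing the
  \<open>N + 1\<close> Taylor coefficients of orders \<open>0\<close> to \<open>N\<close> makes the
  limit \<open>0\<close> instead of merely finite, which later pins down a constant. The conditions
  are linear, with coefficients \<open>\<phi>\<close> chosen before \<open>f\<close>.\<close>

lemma pole_cancellation:
  assumes p: "p \<in> C" and I: "finite I" and d: "\<And>i. i \<in> I \<Longrightarrow> d i \<le> N"
  shows "\<exists>\<phi>. \<forall>f. (\<forall>m\<le>N. (\<Sum>i\<in>I. f i * \<phi> m i) = 0) \<longrightarrow>
           ((\<lambda>z. \<Sum>i\<in>I. f i * z ^ e i * S z ^ d i) \<longlongrightarrow> 0) (at p)"
proof -
  obtain T r where T: "r > 0" "T holomorphic_on ball p r" "ball p r - {p} \<subseteq> Om - C"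
    "\<And>z. z \<in> ball p r - {p} \<Longrightarrow> T z = (z - p) * S z" using pole_removable[OF p] by metis
  define h where "h i z = z ^ e i * T z ^ d i * (z - p) ^ (N - d i)" for i z
  have hol: "h i holomorphic_on ball p r" for i
    unfolding h_def by (intro holomorphic_intros T(2))
  show ?thesis
  proof (intro exI[of _ "\<lambda>m i. (deriv ^^ m) (h i) p"] allI impI)
    fix f assume f: "\<forall>m\<le>N. (\<Sum>i\<in>I. f i * (deriv ^^ m) (h i) p) = 0"
    define H where "H z = (\<Sum>i\<in>I. f i * h i z)" for z
    have holH: "H holomorphic_on ball p r" unfolding H_def by (intro holomorphic_intros hol)
    have "(deriv ^^ m) H p = 0" if "m \<le> N" for m
      unfolding H_def using f that T(1)
      by (subst higher_deriv_sum_cmult[OF I hol]) auto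
    then obtain g where g: "g holomorphic_on ball p r" "\<And>z. z \<in> ball p r \<Longrightarrow> H z = (z - p) ^ Suc N * g z"
      using holomorphic_factor_of_vanishing_derivs[OF holH T(1)] by metis
    have eq: "(\<Sum>i\<in>I. f i * z ^ e i * S z ^ d i) = (z - p) * g z" if z: "z \<in> ball p r - {p}" for z
    proof -
      have "H z = (\<Sum>i\<in>I. (z - p) ^ N * (f i * z ^ e i * S z ^ d i))"
        unfolding H_def
      proof (rule sum.cong[OF refl])
        fix i assume "i \<in> I"
        then have "(z - p) ^ N = (z - p) ^ d i * (z - p) ^ (N - d i)"
          using d by (simp flip: power_add)
        then show "f i * h i z = (z - p) ^ N * (f i * z ^ e i * S z ^ d i)"
          by (simp add: h_def T(4)[OF z] power_mult_distrib)
      qed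
      then have "(z - p) ^ N * (\<Sum>i\<in>I. f i * z ^ e i * S z ^ d i) = (z - p) ^ N * ((z - p) * g z)"
        using g(2)[of z] z by (simp add: sum_distrib_left mult.assoc)
      then show ?thesis using z by simp
    qed
    have "isCont g p" using g(1) T(1)
      by (metis centre_in_ball continuous_on_eq_continuous_at holomorphic_on_imp_continuous_on open_ball)
    then have "((\<lambda>z. (z - p) * g z) \<longlongrightarrow> (p - p) * g p) (at p)"
      unfolding isCont_def by (intro tendsto_intros)
    then have lim: "((\<lambda>z. (z - p) * g z) \<longlongrightarrow> 0) (at p)" by simp
    have "eventually (\<lambda>z. z \<in> ball p r - {p}) (at p)"
      using T(1) by (intro eventually_at_in_open) auto
    then have "eventually (\<lambda>z. (z - p) * g z = (\<Sum>i\<in>I. f i * z ^ e i * S z ^ d i)) (at p)"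
      by (rule eventually_mono) (simp add: eq)
    then show "((\<lambda>z. \<Sum>i\<in>I. f i * z ^ e i * S z ^ d i) \<longlongrightarrow> 0) (at p)"
      using lim by (rule Lim_transform_eventually[rotated])
  qed
qed

text \<open>Real boundary values make the function constant on each component, and each component
  contains a pole, where the value is \<open>0\<close>.\<close>

lemma zero_of_real_boundary:
  assumes A: "A holomorphic_on Om - C" and A0: "\<And>p. p \<in> C \<Longrightarrow> (A \<longlongrightarrow> 0) (at p)"
    and lim: "\<And>w. w \<in> frontier Om \<Longrightarrow> (A \<longlongrightarrow> \<beta> w) (at w within Om)"
    and re: "\<And>w. w \<in> frontier Om \<Longrightarrow> Im (\<beta> w) = 0"
    and z: "z \<in> Om - C"
  shows "A z = 0"
proof -
  define U where "U = connected_component_set Om z"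
  obtain p where p: "p \<in> C" "p \<in> U" unfolding U_def using comp_meets_C[of z] z by blast
  have U: "open U" "connected U" "bounded U" "U \<subseteq> Om" "z \<in> U"
    using open_Om bounded_Om z connected_component_subset[of Om z] unfolding U_def
    by (auto simp: open_connected_component intro: bounded_subset)
  define f where "f y = (if y \<in> C then 0 else A y)" for y
  have evC: "eventually (\<lambda>y. y \<notin> C) (at q)" for q
  proof -
    have "eventually (\<lambda>y. y \<in> - (C - {q}) - {q}) (at q)"
      using finite_C by (intro eventually_at_in_open open_Compl finite_imp_closed) auto
    then show ?thesis by (rule eventually_mono) auto
  qed
  have lim_f: "(f \<longlongrightarrow> l) (at q within X)" if "(A \<longlongrightarrow> l) (at q within X)" for q l X
  proof (rule Lim_transform_eventually[OF that])
    have "eventually (\<lambda>y. y \<notin> C) (at q within X)" 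
      using evC[of q] unfolding eventually_at_filter by (rule eventually_mono) simp
    then show "eventually (\<lambda>y. A y = f y) (at q within X)" by (rule eventually_mono) (simp add: f_def)
  qed
  have "f constant_on U"
  proof (rule constant_of_real_boundary[OF U(1-3)])
    show "f holomorphic_on U"
    proof (rule no_isolated_singularity'[OF _ _ U(1) finite_C])
      show "(f \<longlongrightarrow> f q) (at q within U)" if "q \<in> C" for q
        using lim_f[OF Lim_at_imp_Lim_at_within[OF A0[OF that]]] that by (simp add: f_def)
      have "A holomorphic_on U - C" using U(4) by (intro holomorphic_on_subset[OF A]) blast
      then show "f holomorphic_on U - C" by (rule holomorphic_transform) (auto simp: f_def)
    qed
    show "(f \<longlongrightarrow> \<beta> w) (at w within U)" if "w \<in> frontier U" for w
    proof -
      have w: "w \<in> frontier Om" using that comp_frontier unfolding U_def by blast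
      show ?thesis unfolding U_def by (intro lim_f tendsto_comp[OF w] lim w)
    qed
    show "Im (\<beta> w) = 0" if "w \<in> frontier U" for w
      using that comp_frontier re unfolding U_def by blast
  qed
  then have "f z = f p" using U(5) p(2) by (auto simp: constant_on_def)
  then show ?thesis using z p by (simp add: f_def)
qed

text \<open>The swapped sum \<open>B\<close> with conjugated coefficients has the conjugate boundary
  values of \<open>A\<close>, so \<open>A + B\<close> and \<open>\<i> * (A - B)\<close> are real on
  the frontier and hence vanish. The two conclusions serve the two kinds of sheets:
  \<open>S w\<close> over \<open>w\<close>, and \<open>cnj z\<close> over
  \<open>cnj (S z)\<close>.\<close>

lemma algebraic_relation:
  assumes k: "k = card C" and n: "n = k * (k + 1)"
  shows "\<exists>f. (\<exists>a\<le>n. \<exists>b\<le>k. f a b \<noteq> 0) \<and>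
    (\<forall>z\<in>Om - C. (\<Sum>a\<le>n. \<Sum>b\<le>k. f a b * z ^ a * S z ^ b) = 0 \<and>
       (\<Sum>a\<le>n. \<Sum>b\<le>k. f a b * cnj (S z) ^ a * cnj z ^ b) = 0)"
proof -
  define I where "I = {..n} \<times> {..k}"
  have I: "finite I" by (simp add: I_def)
  have "\<forall>p\<in>C. \<exists>\<phi>. \<forall>f. (\<forall>m\<le>k. (\<Sum>i\<in>I. f i * \<phi> m i) = 0) \<longrightarrow>
           ((\<lambda>z. \<Sum>i\<in>I. f i * z ^ fst i * S z ^ snd i) \<longlongrightarrow> 0) (at p)"
    by (intro ballI pole_cancellation I) (auto simp: I_def)
  then obtain \<phi> where \<phi>: "\<forall>p\<in>C. \<forall>f. (\<forall>m\<le>k. (\<Sum>i\<in>I. f i * \<phi> p m i) = 0) \<longrightarrow>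
           ((\<lambda>z. \<Sum>i\<in>I. f i * z ^ fst i * S z ^ snd i) \<longlongrightarrow> 0) (at p)"
    by (rule bchoice[THEN exE])
  have "\<forall>p\<in>C. \<exists>\<phi>. \<forall>f. (\<forall>m\<le>n. (\<Sum>i\<in>I. f i * \<phi> m i) = 0) \<longrightarrow>
           ((\<lambda>z. \<Sum>i\<in>I. f i * z ^ snd i * S z ^ fst i) \<longlongrightarrow> 0) (at p)"
    by (intro ballI pole_cancellation I) (auto simp: I_def)
  then obtain \<psi> where \<psi>: "\<forall>p\<in>C. \<forall>f. (\<forall>m\<le>n. (\<Sum>i\<in>I. f i * \<psi> p m i) = 0) \<longrightarrow>
           ((\<lambda>z. \<Sum>i\<in>I. f i * z ^ snd i * S z ^ fst i) \<longlongrightarrow> 0) (at p)"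
    by (rule bchoice[THEN exE])
  \<comment> \<open>There are \<open>k + 1\<close> conditions per pole for \<open>A\<close> and
    \<open>n + 1\<close> for \<open>B\<close>, against \<open>(n + 1) * (k + 1)\<close>
    coefficients. The surplus is \<open>n + 1 - k * (k + 1)\<close>; the chosen \<open>n\<close>
    makes it \<open>1\<close>.\<close>
  define J where "J = (C \<times> {..k}) <+> (C \<times> {..n})"
  \<comment> \<open>The conditions on \<open>B\<close> are linear in the conjugates of
    \<open>f\<close>; conjugating their coefficients makes them linear in \<open>f\<close>.\<close>
  define \<Phi> where "\<Phi> j = (case j of Inl (p, m) \<Rightarrow> \<phi> p m | Inr (p, m) \<Rightarrow> (\<lambda>i. cnj (\<psi> p m i)))" for j
  have "finite J" using finite_C by (simp add: J_def)
  moreover have "card J < card I"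
    using finite_C by (simp add: J_def I_def card_Plus card_cartesian_product k[symmetric] n algebra_simps)
  ultimately obtain f where f: "\<exists>i\<in>I. f i \<noteq> 0" "\<forall>j\<in>J. (\<Sum>i\<in>I. f i * \<Phi> j i) = 0"
    using homogeneous_system_solvable[OF _ I, of J \<Phi>] by blast
  define A where "A z = (\<Sum>i\<in>I. f i * z ^ fst i * S z ^ snd i)" for z
  define B where "B z = (\<Sum>i\<in>I. cnj (f i) * z ^ snd i * S z ^ fst i)" for z
  define \<beta> where "\<beta> z = (\<Sum>i\<in>I. f i * z ^ fst i * cnj z ^ snd i)" for z
  have hol: "A holomorphic_on Om - C" "B holomorphic_on Om - C"
    unfolding A_def B_def by (intro holomorphic_intros hol_S)+
  have A0: "(A \<longlongrightarrow> 0) (at p)" if p: "p \<in> C" for p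
  proof -
    have "\<forall>m\<le>k. (\<Sum>i\<in>I. f i * \<phi> p m i) = 0"
    proof (intro allI impI)
      fix m assume "m \<le> k"
      then have "Inl (p, m) \<in> J" using p unfolding J_def by (intro InlI) simp
      from f(2)[rule_format, OF this] show "(\<Sum>i\<in>I. f i * \<phi> p m i) = 0" by (simp add: \<Phi>_def)
    qed
    then show ?thesis unfolding A_def using \<phi> p by blast
  qed
  have B0: "(B \<longlongrightarrow> 0) (at p)" if p: "p \<in> C" for p
  proof -
    have "\<forall>m\<le>n. (\<Sum>i\<in>I. cnj (f i) * \<psi> p m i) = 0"
    proof (intro allI impI)
      fix m assume "m \<le> n"
      then have "Inr (p, m) \<in> J" using p unfolding J_def by (intro InrI) simp
      from f(2)[rule_format, OF this] have "cnj (\<Sum>i\<in>I. f i * cnj (\<psi> p m i)) = 0" by (simp add: \<Phi>_def)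
      then show "(\<Sum>i\<in>I. cnj (f i) * \<psi> p m i) = 0" by simp
    qed
    then show ?thesis unfolding B_def using \<psi>[rule_format, OF p, of "\<lambda>i. cnj (f i)"] by blast
  qed
  have limA: "(A \<longlongrightarrow> \<beta> w) (at w within Om)" if "w \<in> frontier Om" for w
    unfolding A_def \<beta>_def by (intro tendsto_intros bdry_S that)
  have limB: "(B \<longlongrightarrow> cnj (\<beta> w)) (at w within Om)" if "w \<in> frontier Om" for w
  proof -
    have "(B \<longlongrightarrow> (\<Sum>i\<in>I. cnj (f i) * w ^ snd i * cnj w ^ fst i)) (at w within Om)"
      unfolding B_def by (intro tendsto_intros bdry_S that)
    also have "(\<Sum>i\<in>I. cnj (f i) * w ^ snd i * cnj w ^ fst i) = cnj (\<beta> w)"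
      unfolding \<beta>_def cnj_sum by (rule sum.cong) (auto simp: mult_ac)
    finally show ?thesis .
  qed
  have AB: "A z = 0 \<and> B z = 0" if z: "z \<in> Om - C" for z
  proof -
    have "A z + B z = 0"
    proof (rule zero_of_real_boundary[where A="\<lambda>z. A z + B z", OF _ _ _ _ z])
      show "(\<lambda>z. A z + B z) holomorphic_on Om - C" using hol by (intro holomorphic_intros)
      show "((\<lambda>z. A z + B z) \<longlongrightarrow> 0) (at p)" if "p \<in> C" for p
        using tendsto_add[OF A0 B0] that by fastforce
      show "((\<lambda>z. A z + B z) \<longlongrightarrow> \<beta> w + cnj (\<beta> w)) (at w within Om)" if "w \<in> frontier Om" for w
        using limA[OF that] limB[OF that] by (rule tendsto_add)
    qed simp
    moreover have "\<i> * (A z - B z) = 0"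
    proof (rule zero_of_real_boundary[where A="\<lambda>z. \<i> * (A z - B z)", OF _ _ _ _ z])
      show "(\<lambda>z. \<i> * (A z - B z)) holomorphic_on Om - C" using hol by (intro holomorphic_intros)
      show "((\<lambda>z. \<i> * (A z - B z)) \<longlongrightarrow> 0) (at p)" if "p \<in> C" for p
        using tendsto_mult_right_zero[OF tendsto_diff[OF A0[OF that] B0[OF that], simplified], of \<i>] by simp
      show "((\<lambda>z. \<i> * (A z - B z)) \<longlongrightarrow> \<i> * (\<beta> w - cnj (\<beta> w))) (at w within Om)" if "w \<in> frontier Om" for w
        by (intro tendsto_intros limA limB that)
    qed simp
    ultimately show ?thesis by auto
  qed
  have sumI: "(\<Sum>i\<in>I. g (fst i) (snd i)) = (\<Sum>a\<le>n. \<Sum>b\<le>k. g a b)" for g :: "nat \<Rightarrow> nat \<Rightarrow> complex"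
    unfolding I_def by (simp add: sum.cartesian_product split_beta)
  show ?thesis
  proof (intro exI[of _ "\<lambda>a b. f (a, b)"] conjI ballI)
    show "\<exists>a\<le>n. \<exists>b\<le>k. f (a, b) \<noteq> 0" using f(1) by (auto simp: I_def)
    fix z assume z: "z \<in> Om - C"
    show "(\<Sum>a\<le>n. \<Sum>b\<le>k. f (a, b) * z ^ a * S z ^ b) = 0"
      using AB[OF z] sumI[of "\<lambda>a b. f (a, b) * z ^ a * S z ^ b"] by (simp add: A_def)
    have "cnj (B z) = 0" using AB[OF z] by simp
    moreover have "cnj (B z) = (\<Sum>i\<in>I. f (fst i, snd i) * cnj (S z) ^ fst i * cnj z ^ snd i)"
      unfolding B_def cnj_sum by (rule sum.cong) (auto simp: mult_ac)
    ultimately show "(\<Sum>a\<le>n. \<Sum>b\<le>k. f (a, b) * cnj (S z) ^ a * cnj z ^ b) = 0"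
      using sumI[of "\<lambda>a b. f (a, b) * cnj (S z) ^ a * cnj z ^ b"] by simp
  qed
qed

end

text \<open>Both sides agree in the coefficient at \<open>card T\<close>, so a nonzero difference
  would have smaller degree but \<open>card T\<close> roots. The scalar may be zero, and then
  \<open>p\<close> vanishes.\<close>

lemma poly_eq_smult_prod_roots:
  fixes p :: "'a::idom poly"
  assumes "degree p \<le> card T" "finite T" "\<And>t. t \<in> T \<Longrightarrow> poly p t = 0"
  shows "p = smult (coeff p (card T)) (\<Prod>t\<in>T. [:-t, 1:])"
proof (rule ccontr)
  define R where "R = (\<Prod>t\<in>T. [:-t, 1:])"
  have degR: "degree R = card T" unfolding R_def
    by (subst degree_prod_eq_sum_degree) auto
  have "lead_coeff R = 1" unfolding R_def lead_coeff_prod by simp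
  then have lR: "coeff R (card T) = 1" by (simp add: degR)
  define q where "q = p - smult (coeff p (card T)) R"
  assume "\<not> ?thesis"
  then have "q \<noteq> 0" by (simp add: q_def R_def)
  have "coeff q (card T) = 0" by (simp add: q_def lR)
  then have "degree q \<noteq> card T" using \<open>q \<noteq> 0\<close> by (metis leading_coeff_0_iff)
  moreover have "degree q \<le> card T"
    unfolding q_def using assms(1) degR by (intro degree_diff_le) (auto intro: order_trans[OF degree_smult_le])
  ultimately have "degree q < card T" by simp
  moreover have "poly q t = 0" if "t \<in> T" for t
  proof -
    have "poly R t = 0" using that assms(2) by (auto simp: R_def poly_prod)
    then show ?thesis using assms(3)[OF that] by (simp add: q_def)
  qed
  then have "card T \<le> card {t. poly q t = 0}"
    by (intro card_mono poly_roots_finite[OF \<open>q \<noteq> 0\<close>]) auto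
  moreover have "card {t. poly q t = 0} \<le> degree q" by (rule card_poly_roots_bound[OF \<open>q \<noteq> 0\<close>])
  ultimately show False by simp
qed

lemma prod_roots_dvd:
  fixes g :: "'a::idom poly"
  assumes "finite A" "\<And>a. a \<in> A \<Longrightarrow> poly g a = 0"
  shows "(\<Prod>a\<in>A. [:-a, 1:]) dvd g"
  using assms
proof (induction A rule: finite_induct)
  case (insert a A)
  then obtain h where h: "g = (\<Prod>a\<in>A. [:-a, 1:]) * h" by (auto elim: dvdE)
  have "poly (\<Prod>a\<in>A. [:-a, 1:]) a \<noteq> 0" using insert.hyps by (auto simp: poly_prod)
  moreover have "poly g a = 0" using insert.prems by auto
  ultimately have "poly h a = 0" using h by simp
  then obtain h' where "h = [:-a, 1:] * h'" by (auto simp: poly_eq_0_iff_dvd elim: dvdE)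
  moreover have "(\<Prod>a\<in>insert a A. [:-a, 1:]) = [:-a, 1:] * (\<Prod>a\<in>A. [:-a, 1:])"
    using insert.hyps by (rule prod.insert)
  ultimately have "g = (\<Prod>a\<in>insert a A. [:-a, 1:]) * h'" using h by (simp only: mult_ac)
  then show ?case by simp
qed auto

text \<open>The cofactor of the product has no root, as a root would lie in \<open>A\<close> and be
  double in \<open>g\<close>; over the complex numbers it is then constant.\<close>

lemma poly_with_simple_roots:
  fixes g :: "complex poly"
  assumes "finite A" "g \<noteq> 0" "\<And>a. a \<in> A \<Longrightarrow> poly g a = 0"
    and "\<And>a. poly g a = 0 \<Longrightarrow> a \<in> A" "\<And>a. a \<in> A \<Longrightarrow> \<not> [:-a, 1:]^2 dvd g"
  obtains c where "c \<noteq> 0" "g = smult c (\<Prod>a\<in>A. [:-a, 1:])"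
proof -
  obtain h where h: "g = (\<Prod>a\<in>A. [:-a, 1:]) * h" using prod_roots_dvd[OF assms(1,3)] by (auto elim: dvdE)
  have "degree h = 0"
  proof (rule ccontr)
    assume "degree h \<noteq> 0"
    then obtain a where a: "poly h a = 0" using alg_closed_imp_poly_has_root[of h] by auto
    then have "a \<in> A" using assms(4) h by simp
    have "[:-a, 1:] dvd h" using a by (simp add: poly_eq_0_iff_dvd)
    moreover have "[:-a, 1:] dvd (\<Prod>a\<in>A. [:-a, 1:])" using \<open>a \<in> A\<close> assms(1) by (intro dvd_prodI) auto
    ultimately have "[:-a, 1:] * [:-a, 1:] dvd g" unfolding h by (intro mult_dvd_mono)
    then show False using assms(5)[OF \<open>a \<in> A\<close>] by (simp add: power2_eq_square)
  qed
  then obtain c where c: "h = [:c:]" by (rule degree_eq_zeroE)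
  have "c \<noteq> 0" using c h assms(2) by auto
  then show ?thesis using that[of c] h c by simp
qed

text \<open>The reflected polynomial takes the leading coefficient of \<open>G\<close> as its value
  at \<open>0\<close>, but with degree above \<open>k\<close> the growth bound would make it tend to
  \<open>0\<close> there.\<close>

lemma degree_le_of_growth:
  fixes G :: "complex poly"
  assumes "\<And>w. norm w > R \<Longrightarrow> norm (poly G w) \<le> M * norm w ^ k"
  shows "degree G \<le> k"
proof (rule ccontr)
  assume "\<not> degree G \<le> k"
  then have n: "degree G > k" and "G \<noteq> 0" by auto
  define H where "H = reflect_poly G"
  have "isCont (\<lambda>v::complex. M * norm v ^ (degree G - k)) 0" by (intro continuous_intros)
  then have 0: "((\<lambda>v::complex. M * norm v ^ (degree G - k)) \<longlongrightarrow> 0) (at 0)"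
    using n by (simp add: isCont_def power_0_left)
  have "(poly H \<longlongrightarrow> 0) (at 0)"
  proof (rule Lim_null_comparison[OF _ 0])
    have "eventually (\<lambda>v::complex. v \<in> ball 0 (1 / (\<bar>R\<bar> + 1)) - {0}) (at 0)"
      by (intro eventually_at_in_open) auto
    then show "eventually (\<lambda>v. norm (poly H v) \<le> M * norm v ^ (degree G - k)) (at 0)"
    proof (rule eventually_mono)
      fix v :: complex assume v: "v \<in> ball 0 (1 / (\<bar>R\<bar> + 1)) - {0}"
      then have "norm v < 1 / (\<bar>R\<bar> + 1)" "v \<noteq> 0" by auto
      then have "norm (inverse v) > \<bar>R\<bar> + 1"
        unfolding norm_inverse by (simp add: field_simps)
      then have "norm (poly G (inverse v)) \<le> M * norm (inverse v) ^ k" using assms by simp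
      then have "norm v ^ degree G * norm (poly G (inverse v)) \<le> norm v ^ degree G * (M * norm (inverse v) ^ k)"
        by (intro mult_left_mono) auto
      also have "norm v ^ degree G = norm v ^ (degree G - k) * norm v ^ k"
        using n by (simp flip: power_add)
      also have "norm v ^ (degree G - k) * norm v ^ k * (M * norm (inverse v) ^ k) = M * norm v ^ (degree G - k)"
        using \<open>v \<noteq> 0\<close> by (simp add: norm_inverse power_inverse)
      finally show "norm (poly H v) \<le> M * norm v ^ (degree G - k)"
        using \<open>v \<noteq> 0\<close> n by (simp add: H_def poly_reflect_poly_nz norm_mult norm_power flip: power_add)
    qed
  qed
  moreover have "(poly H \<longlongrightarrow> poly H 0) (at 0)" by (simp add: isCont_def[symmetric])
  ultimately have "poly H 0 = 0" using LIM_unique by blast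
  then show False using \<open>G \<noteq> 0\<close> by (simp add: H_def)
qed

section \<open>Relations vanishing on all sheets, their leading coefficient and degree\<close>

context schwarz_domain
begin

text \<open>A polynomial in two variables is given by its coefficients \<open>f b\<close> of \<open>t ^ b\<close>, which are polynomials in \<open>w\<close>.\<close>

definition biv :: "(nat \<Rightarrow> complex poly) \<Rightarrow> complex \<Rightarrow> complex \<Rightarrow> complex" where
  "biv f w t = (\<Sum>b\<le>card C. poly (f b) w * t ^ b)"

definition fib :: "(nat \<Rightarrow> complex poly) \<Rightarrow> complex \<Rightarrow> complex poly" where
  "fib f w = (\<Sum>b\<le>card C. monom (poly (f b) w) b)"

lemma isCont_biv:
  assumes "isCont g w" shows "isCont (\<lambda>w. biv f w (g w)) w"
proof -
  have "isCont (\<lambda>w. poly (f b) w * g w ^ b) w" for b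
    by (rule isCont_mult[OF poly_isCont isCont_power[OF assms]])
  then show ?thesis unfolding biv_def by (intro isCont_sum ballI)
qed

lemma poly_fib: "poly (fib f w) t = biv f w t"
  by (simp add: fib_def biv_def poly_sum poly_monom)

lemma coeff_fib: "b \<le> card C \<Longrightarrow> coeff (fib f w) b = poly (f b) w"
  by (simp add: fib_def coeff_sum coeff_monom)

lemma degree_fib: "degree (fib f w) \<le> card C"
  unfolding fib_def by (intro degree_sum_le) (auto intro: order_trans[OF degree_monom_le])

text \<open>The finite exceptional set \<open>X\<close> is there because dividing a relation by a
  linear factor in \<open>w\<close> loses the information at its root.\<close>

definition vanishing :: "(nat \<Rightarrow> complex poly) \<Rightarrow> complex set \<Rightarrow> bool" where
  "vanishing f X \<longleftrightarrow> finite X \<and> (\<forall>w t. good w \<longrightarrow> w \<notin> X \<longrightarrow> t \<in> sheets w \<longrightarrow> biv f w t = 0)"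

text \<open>Over \<open>w\<close> the relation is a polynomial in \<open>t\<close> of degree at most
  \<open>card C\<close> with that many known roots. So its leading coefficient determines a
  relation; most facts about relations are read off from this product.\<close>

lemma biv_product:
  assumes "vanishing f X" "good w" "w \<notin> X" "T \<subseteq> sheets w" "finite T" "card T = card C"
  shows "biv f w t = poly (f (card C)) w * (\<Prod>s\<in>T. t - s)"
proof -
  have "fib f w = smult (coeff (fib f w) (card T)) (\<Prod>s\<in>T. [:-s, 1:])"
    using assms degree_fib[of f w] by (intro poly_eq_smult_prod_roots) (auto simp: poly_fib vanishing_def)
  then have "poly (fib f w) t = poly (smult (poly (f (card C)) w) (\<Prod>s\<in>T. [:-s, 1:])) t"
    using assms(6) by (simp add: coeff_fib)
  then show ?thesis by (simp add: poly_fib poly_prod)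
qed

lemma biv_zero_imp:
  assumes "\<And>t. biv f w t = 0" "b \<le> card C" shows "poly (f b) w = 0"
proof -
  have "poly (fib f w) = poly 0" using assms(1) by (auto simp: poly_fib)
  then have "fib f w = 0" by (simp add: poly_eq_poly_eq_iff)
  then show ?thesis using coeff_fib[OF assms(2), of f w] by simp
qed

text \<open>By the product formula a zero leading coefficient would annihilate the whole fibre over
  generic \<open>w\<close>, also over those that are no roots of \<open>f b\<close>.\<close>

lemma vanishing_lead_nonzero:
  assumes "vanishing f X" "b \<le> card C" "f b \<noteq> 0"
  shows "f (card C) \<noteq> 0"
proof
  assume 0: "f (card C) = 0"
  have "finite (X \<union> {w. poly (f b) w = 0})"
    using assms poly_roots_finite by (auto simp: vanishing_def)
  then obtain w where w: "good w" "w \<notin> X \<union> {w. poly (f b) w = 0}"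
    using good_dense[of UNIV "X \<union> {w. poly (f b) w = 0}"] by auto
  obtain T where "T \<subseteq> sheets w" "finite T" "card T = card C" using good_sheets[OF w(1)] by blast
  then have "biv f w t = 0" for t
    using biv_product[OF assms(1) w(1)] w(2) 0 by simp
  then show False using biv_zero_imp[OF _ assms(2)] w(2) by blast
qed

lemma good_sequence:
  assumes "finite X" "open W" "a \<in> W"
  obtains x where "x \<longlonglongrightarrow> a" "\<And>n. good (x n)" "\<And>n. x n \<notin> X" "\<And>n. x n \<in> W"
proof -
  have "\<forall>n. \<exists>y. good y \<and> y \<notin> X \<and> y \<in> W \<and> dist y a < inverse (real (Suc n))"
  proof
    fix n
    have "open (ball a (inverse (real (Suc n))) \<inter> W)" using assms by auto
    moreover have "a \<in> ball a (inverse (real (Suc n))) \<inter> W" using assms(3) by (simp del: of_nat_Suc)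
    then have "ball a (inverse (real (Suc n))) \<inter> W \<noteq> {}" by blast
    ultimately show "\<exists>y. good y \<and> y \<notin> X \<and> y \<in> W \<and> dist y a < inverse (real (Suc n))"
    proof -
      obtain y where "y \<in> ball a (inverse (real (Suc n))) \<inter> W" "good y" "y \<notin> X"
        using good_dense[OF \<open>open (ball a (inverse (real (Suc n))) \<inter> W)\<close> \<open>ball a (inverse (real (Suc n))) \<inter> W \<noteq> {}\<close> assms(1)]
        by blast
      then show ?thesis by (intro exI[of _ y]) (simp add: dist_commute del: of_nat_Suc)
    qed
  qed
  then obtain x where x: "\<forall>n. good (x n) \<and> x n \<notin> X \<and> x n \<in> W \<and> dist (x n) a < inverse (real (Suc n))"
    by (rule choice[THEN exE])
  have "(\<lambda>n. dist (x n) a) \<longlonglongrightarrow> 0"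
  proof (rule tendsto_sandwich[where f="\<lambda>_. 0" and h="\<lambda>n. inverse (real (Suc n))", rotated 3])
    show "(\<lambda>n. inverse (real (Suc n))) \<longlonglongrightarrow> 0" by (rule LIMSEQ_inverse_real_of_nat)
    show "\<forall>\<^sub>F n in sequentially. dist (x n) a \<le> inverse (real (Suc n))"
      using x by (intro always_eventually allI) (simp add: less_imp_le del: of_nat_Suc)
  qed auto
  then have "x \<longlonglongrightarrow> a" by (rule iffD2[OF tendsto_dist_iff])
  then show ?thesis using that x by blast
qed

lemma bound_Om: obtains K where "K \<ge> 1" "\<And>z. z \<in> closure Om \<Longrightarrow> norm z \<le> K"
proof -
  have "bounded (closure Om)" using bounded_Om by (rule bounded_closure)
  then obtain K where "\<forall>z\<in>closure Om. norm z \<le> K" by (auto simp: bounded_iff)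
  then show ?thesis using that[of "max K 1"] by fastforce
qed

text \<open>The size of the only sheet that may be unbounded; the others are conjugates of points of
  the bounded set \<open>Om\<close>.\<close>

definition front :: "complex \<Rightarrow> real" where
  "front w = (if w \<in> Om then norm (S w) else 0)"

text \<open>All factors except \<open>t - S w\<close> are at most \<open>1 + norm t + K\<close>. The
  summand \<open>1\<close> keeps both bases at least \<open>1\<close>, so the bound also holds if
  \<open>S w\<close> is not in \<open>T\<close>, and the exponent can be \<open>card C\<close>
  throughout.\<close>

lemma prod_sheets_bound:
  assumes K: "K \<ge> 1" "\<And>z. z \<in> closure Om \<Longrightarrow> norm z \<le> K"
    and T: "T \<subseteq> sheets w" "finite T" "card T = card C"
  shows "norm (\<Prod>s\<in>T. t - s) \<le> (1 + norm t + front w) * (1 + norm t + K) ^ card C"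
proof -
  have nK: "norm (t - s) \<le> 1 + norm t + K" if "s \<in> T" "w \<in> Om \<longrightarrow> s \<noteq> S w" for s
  proof -
    have "s \<in> cnj ` {z \<in> Om - C. S z = cnj w}"
      using that T(1) by (auto simp: sheets_def split: if_splits)
    then have "norm s \<le> K" using K(2) closure_subset by fastforce
    then show ?thesis using norm_triangle_ineq4[of t s] by simp
  qed
  have pos: "1 \<le> 1 + norm t + K" using K(1) norm_ge_zero[of t] by linarith
  have pw: "(\<Prod>s\<in>A. norm (t - s)) \<le> (1 + norm t + K) ^ card C"
    if "A \<subseteq> T" "\<And>s. s \<in> A \<Longrightarrow> w \<in> Om \<longrightarrow> s \<noteq> S w" for A
  proof -
    have "(\<Prod>s\<in>A. norm (t - s)) \<le> (\<Prod>s\<in>A. 1 + norm t + K)"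
      using nK that by (intro prod_mono) auto
    also have "\<dots> = (1 + norm t + K) ^ card A" by simp
    also have "\<dots> \<le> (1 + norm t + K) ^ card C"
      using pos T(2,3) that(1) card_mono[of T A] by (intro power_increasing) auto
    finally show ?thesis .
  qed
  have f0: "front w \<ge> 0" by (simp add: front_def)
  show ?thesis
  proof (cases "w \<in> Om \<and> S w \<in> T")
    case True
    have "norm (\<Prod>s\<in>T. t - s) = norm (t - S w) * (\<Prod>s\<in>T - {S w}. norm (t - s))"
      using True T(2) by (subst prod.remove[of T "S w"]) (auto simp: norm_mult prod_norm)
    also have "\<dots> \<le> (1 + norm t + front w) * (1 + norm t + K) ^ card C"
    proof (rule mult_mono)
      show "norm (t - S w) \<le> 1 + norm t + front w"
        using True norm_triangle_ineq4[of t "S w"] by (simp add: front_def)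
      show "(\<Prod>s\<in>T - {S w}. norm (t - s)) \<le> (1 + norm t + K) ^ card C" by (rule pw) auto
    qed (use f0 in \<open>auto intro!: prod_nonneg add_nonneg_nonneg\<close>)
    finally show ?thesis .
  next
    case False
    have "norm (\<Prod>s\<in>T. t - s) \<le> 1 * (1 + norm t + K) ^ card C"
      using pw[of T] False by (auto simp: prod_norm[symmetric])
    also have "\<dots> \<le> (1 + norm t + front w) * (1 + norm t + K) ^ card C"
      using f0 pos by (intro mult_right_mono) auto
    finally show ?thesis .
  qed
qed

text \<open>Away from the poles \<open>S\<close> has a limit within \<open>Om\<close> at every
  point: by continuity inside, by the Schwarz condition on the frontier, trivially outside the
  closure.\<close>

lemma front_bounded:
  assumes "a \<notin> C"
  shows "\<exists>M r. r > 0 \<and> (\<forall>w\<in>ball a r. w \<noteq> a \<longrightarrow> front w \<le> M)"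
proof -
  have "\<exists>l. (S \<longlongrightarrow> l) (at a within Om)"
  proof -
    consider "a \<notin> closure Om" | "a \<in> frontier Om" | "a \<in> Om - C"
      using closure_cases[of a] assms by blast
    then show ?thesis
    proof cases
      case 1
      then have "at a within Om = bot" using at_within_eq_bot_iff closure_def islimpt_in_closure
        by (metis Diff_subset closure_mono subsetD)
      then show ?thesis by simp
    next
      case 2 then show ?thesis using bdry_S by blast
    next
      case 3
      then have "isCont S a"
        using hol_S open_punctured by (metis continuous_on_eq_continuous_at holomorphic_on_imp_continuous_on)
      then show ?thesis by (auto simp: isCont_def intro: Lim_at_imp_Lim_at_within)
    qed
  qed
  then obtain l where "(S \<longlongrightarrow> l) (at a within Om)" by blast
  then have "((\<lambda>w. norm (S w)) \<longlongrightarrow> norm l) (at a within Om)" by (rule tendsto_norm)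
  then have "eventually (\<lambda>w. norm (S w) < norm l + 1) (at a within Om)"
    by (rule order_tendstoD) simp
  then obtain r where "r > 0" "\<forall>w\<in>Om. w \<noteq> a \<and> dist w a < r \<longrightarrow> norm (S w) < norm l + 1"
    by (auto simp: eventually_at)
  then show ?thesis
    by (intro exI[of _ "norm l + 1"] exI[of _ r]) (auto simp: front_def dist_commute less_imp_le add_nonneg_nonneg)
qed

lemma front_pole_bounded:
  assumes "p \<in> C"
  shows "\<exists>M r. r > 0 \<and> (\<forall>w\<in>ball p r. w \<noteq> p \<longrightarrow> norm (w - p) * front w \<le> M)"
proof -
  obtain \<rho> where "((\<lambda>z. (z - p) * S z) \<longlongrightarrow> \<rho>) (at p)" using pole_S[OF assms] by blast
  then have "((\<lambda>w. norm ((w - p) * S w)) \<longlongrightarrow> norm \<rho>) (at p)" by (rule tendsto_norm)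
  then have "eventually (\<lambda>w. norm ((w - p) * S w) < norm \<rho> + 1) (at p)"
    by (rule order_tendstoD) simp
  then obtain r where "r > 0" "\<forall>w. w \<noteq> p \<and> dist w p < r \<longrightarrow> norm ((w - p) * S w) < norm \<rho> + 1"
    by (auto simp: eventually_at)
  then show ?thesis
    by (intro exI[of _ "norm \<rho> + 1"] exI[of _ r]) (auto simp: front_def norm_mult dist_commute less_imp_le add_nonneg_nonneg)
qed

text \<open>By the product formula and the bound on the sheets, \<open>biv f w t\<close> is for each
  \<open>t\<close> at most a constant times \<open>norm (w - a)\<close> at good points; letting
  these tend to \<open>a\<close> kills all coefficients at \<open>a\<close>.\<close>

lemma vanishing_common_root:
  assumes v: "vanishing f X"
    and bd: "\<exists>M r. r > 0 \<and> (\<forall>w\<in>ball a r. w \<noteq> a \<longrightarrow> norm (poly (f (card C)) w) * (1 + front w) \<le> M * norm (w - a))"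
    and b: "b \<le> card C"
  shows "poly (f b) a = 0"
proof (rule biv_zero_imp[OF _ b])
  fix t :: complex
  obtain M r where r: "r > 0" and M: "\<And>w. w \<in> ball a r \<Longrightarrow> w \<noteq> a \<Longrightarrow>
      norm (poly (f (card C)) w) * (1 + front w) \<le> M * norm (w - a)" using bd by blast
  obtain K where K: "K \<ge> 1" "\<And>z. z \<in> closure Om \<Longrightarrow> norm z \<le> K" using bound_Om by blast
  obtain x where x: "x \<longlonglongrightarrow> a" "\<And>n. good (x n)" "\<And>n. x n \<notin> X \<union> {a}" "\<And>n. x n \<in> ball a r"
    using good_sequence[of "X \<union> {a}" "ball a r" a] r v by (auto simp: vanishing_def)
  define D where "D = (1 + norm t) * (1 + norm t + K) ^ card C"
  have bnd: "norm (biv f (x n) t) \<le> M * norm (x n - a) * D" for n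
  proof -
    obtain T where T: "T \<subseteq> sheets (x n)" "finite T" "card T = card C" using good_sheets[OF x(2)] by blast
    have f0: "front (x n) \<ge> 0" by (simp add: front_def)
    have "norm (biv f (x n) t) = norm (poly (f (card C)) (x n)) * norm (\<Prod>s\<in>T. t - s)"
      using biv_product[OF v x(2) _ T] x(3) by (simp add: norm_mult)
    also have "\<dots> \<le> norm (poly (f (card C)) (x n)) * ((1 + norm t + front (x n)) * (1 + norm t + K) ^ card C)"
      by (intro mult_left_mono prod_sheets_bound[OF K T]) auto
    also have "\<dots> \<le> norm (poly (f (card C)) (x n)) * (((1 + front (x n)) * (1 + norm t)) * (1 + norm t + K) ^ card C)"
      using f0 K(1) by (intro mult_left_mono mult_right_mono) (auto simp: algebra_simps intro!: add_nonneg_nonneg mult_nonneg_nonneg)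
    also have "\<dots> = norm (poly (f (card C)) (x n)) * (1 + front (x n)) * D"
      by (simp add: D_def algebra_simps)
    also have "\<dots> \<le> M * norm (x n - a) * D"
      using M[OF x(4)[of n]] x(3)[of n] K(1) by (intro mult_right_mono) (auto simp: D_def intro!: mult_nonneg_nonneg zero_le_power add_nonneg_nonneg)
    finally show ?thesis .
  qed
  have "(\<lambda>n. M * norm (x n - a) * D) \<longlonglongrightarrow> M * norm (a - a) * D"
    by (rule tendsto_mult[OF tendsto_mult[OF tendsto_const tendsto_norm[OF tendsto_diff[OF x(1) tendsto_const]]] tendsto_const])
  then have "(\<lambda>n. biv f (x n) t) \<longlonglongrightarrow> 0"
    by (intro Lim_null_comparison[OF always_eventually[OF allI[OF bnd]]]) simp
  moreover have "(\<lambda>n. biv f (x n) t) \<longlonglongrightarrow> biv f a t"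
    by (rule isCont_tendsto_compose[OF isCont_biv x(1)]) (rule continuous_const)
  ultimately show "biv f a t = 0" using LIMSEQ_unique by blast
qed

text \<open>Near \<open>p\<close> the sheet \<open>S w\<close> is \<open>T w / (w - p)\<close>.
  After multiplication by \<open>(w - p) ^ k\<close> only the top term survives in the limit, and
  \<open>T p\<close> is not zero.\<close>

lemma vanishing_root_at_pole:
  assumes v: "vanishing f X" and p: "p \<in> C"
  shows "poly (f (card C)) p = 0"
proof -
  obtain T r where T: "r > 0" "T holomorphic_on ball p r" "ball p r - {p} \<subseteq> Om - C"
    "\<And>z. z \<in> ball p r - {p} \<Longrightarrow> T z = (z - p) * S z" "T p \<noteq> 0" using pole_removable[OF p] by metis
  obtain x where x: "x \<longlonglongrightarrow> p" "\<And>n. good (x n)" "\<And>n. x n \<notin> X \<union> {p}" "\<And>n. x n \<in> ball p r"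
    using good_sequence[of "X \<union> {p}" "ball p r" p] T(1) v by (auto simp: vanishing_def)
  define k where "k = card C"
  have T0: "(\<Sum>b\<le>k. poly (f b) (x n) * (x n - p) ^ (k - b) * T (x n) ^ b) = 0" for n
  proof -
    have xn: "x n \<in> ball p r - {p}" using x by auto
    then have "S (x n) \<in> sheets (x n)" using T(3) by (auto simp: sheets_def)
    then have "biv f (x n) (S (x n)) = 0" using v x by (auto simp: vanishing_def)
    then have "0 = (x n - p) ^ k * biv f (x n) (S (x n))" by simp
    also have "\<dots> = (\<Sum>b\<le>k. poly (f b) (x n) * (x n - p) ^ (k - b) * T (x n) ^ b)"
      unfolding biv_def k_def[symmetric] sum_distrib_left
    proof (rule sum.cong[OF refl])
      fix b assume "b \<in> {..k}"
      then have "(x n - p) ^ k = (x n - p) ^ (k - b) * (x n - p) ^ b" by (simp flip: power_add)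
      then show "(x n - p) ^ k * (poly (f b) (x n) * S (x n) ^ b) = poly (f b) (x n) * (x n - p) ^ (k - b) * T (x n) ^ b"
        using T(4)[OF xn] by (simp add: power_mult_distrib)
    qed
    finally show ?thesis by simp
  qed
  have "isCont T p" using T(1,2)
    by (metis centre_in_ball continuous_on_eq_continuous_at holomorphic_on_imp_continuous_on open_ball)
  then have "(\<lambda>n. T (x n)) \<longlonglongrightarrow> T p" using x(1) by (rule isCont_tendsto_compose)
  then have "(\<lambda>n. poly (f b) (x n) * (x n - p) ^ (k - b) * T (x n) ^ b)
      \<longlonglongrightarrow> poly (f b) p * (p - p) ^ (k - b) * T p ^ b" for b
    by (rule tendsto_mult[OF tendsto_mult[OF isCont_tendsto_compose[OF poly_isCont x(1)]
          tendsto_power[OF tendsto_diff[OF x(1) tendsto_const]]] tendsto_power])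
  then have "(\<lambda>n. \<Sum>b\<le>k. poly (f b) (x n) * (x n - p) ^ (k - b) * T (x n) ^ b)
      \<longlonglongrightarrow> (\<Sum>b\<le>k. poly (f b) p * (p - p) ^ (k - b) * T p ^ b)"
    by (rule tendsto_sum)
  then have "(\<Sum>b\<le>k. poly (f b) p * (p - p) ^ (k - b) * T p ^ b) = 0"
    using LIMSEQ_unique[OF _ tendsto_const] unfolding T0 by metis
  \<comment> \<open>For \<open>b < k\<close> the power of \<open>0\<close> vanishes, for
    \<open>b = k\<close> it is \<open>0 ^ 0 = 1\<close>.\<close>
  moreover have "(\<Sum>b\<le>k. poly (f b) p * (p - p) ^ (k - b) * T p ^ b) = (\<Sum>b\<in>{k}. poly (f b) p * (p - p) ^ (k - b) * T p ^ b)"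
    by (intro sum.mono_neutral_right) auto
  ultimately show ?thesis using T(5) by (simp add: k_def)
qed

lemma vanishing_exists: "\<exists>f b. vanishing f {} \<and> b \<le> card C \<and> f b \<noteq> 0"
proof -
  define k where "k = card C"
  define n where "n = k * (k + 1)"
  obtain c where c: "\<exists>a\<le>n. \<exists>b\<le>k. c a b \<noteq> 0"
    "\<forall>z\<in>Om - C. (\<Sum>a\<le>n. \<Sum>b\<le>k. c a b * z ^ a * S z ^ b) = 0 \<and>
       (\<Sum>a\<le>n. \<Sum>b\<le>k. c a b * cnj (S z) ^ a * cnj z ^ b) = 0"
    using algebraic_relation[OF k_def n_def] by blast
  define f where "f b = (\<Sum>a\<le>n. monom (c a b) a)" for b
  have biv: "biv f w t = (\<Sum>a\<le>n. \<Sum>b\<le>k. c a b * w ^ a * t ^ b)" for w t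
    unfolding biv_def f_def k_def[symmetric]
    by (subst sum.swap) (simp add: poly_sum poly_monom sum_distrib_right)
  have "vanishing f {}" unfolding vanishing_def
  proof (intro conjI allI impI)
    fix w t assume w: "good w" and t: "t \<in> sheets w"
    from t consider z where "t = cnj z" "z \<in> Om - C" "S z = cnj w" | "w \<in> Om" "t = S w"
      by (auto simp: sheets_def split: if_splits)
    then show "biv f w t = 0"
    proof cases
      case 1
      then have "w = cnj (S z)" by simp
      then show ?thesis using c(2) 1 biv by metis
    next
      case 2
      then have "w \<in> Om - C" using w by (simp add: good_def)
      then show ?thesis using c(2) 2 biv by metis
    qed
  qed simp
  moreover obtain a b where ab: "a \<le> n" "b \<le> k" "c a b \<noteq> 0" using c(1) by blast
  then have "coeff (f b) a \<noteq> 0" by (simp add: f_def coeff_sum coeff_monom)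
  then have "f b \<noteq> 0" by auto
  ultimately show ?thesis using ab(2) k_def by blast
qed


definition node_poly :: "complex poly" where
  "node_poly = (\<Prod>p\<in>C. [:-p, 1:])"

lemma poly_node_poly: "poly node_poly w = (\<Prod>p\<in>C. w - p)"
  by (simp add: node_poly_def poly_prod)

lemma poly_node_poly_eq_0_iff: "poly node_poly w = 0 \<longleftrightarrow> w \<in> C"
  using finite_C by (auto simp: poly_node_poly)

lemma degree_node_poly: "degree node_poly = card C"
  unfolding node_poly_def by (subst degree_prod_eq_sum_degree) auto

lemma lead_coeff_node_poly: "coeff node_poly (card C) = 1"
proof -
  have "lead_coeff node_poly = 1" unfolding node_poly_def lead_coeff_prod by simp
  then show ?thesis by (simp add: degree_node_poly)
qed

text \<open>Among the relations satisfied by all sheets, the one whose leading coefficient has least degree has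
  no common zero of its coefficients. As the sheets are bounded away from the poles, and a single one
  has a simple pole there, the leading coefficient is the node polynomial up to a constant.\<close>
lemma vanishing_minimal:
  obtains f X where "vanishing f X" "f (card C) = node_poly"
    "\<And>a. \<exists>b\<le>card C. poly (f b) a \<noteq> 0"
proof -
  define k where "k = card C"
  define Q where "Q f \<longleftrightarrow> (\<exists>X. vanishing f X) \<and> f k \<noteq> 0" for f
  have "\<exists>f. Q f" using vanishing_exists vanishing_lead_nonzero unfolding Q_def k_def by blast
  then obtain f where f: "Q f" "\<And>g. Q g \<Longrightarrow> degree (f k) \<le> degree (g k)"
    using ex_has_least_nat[of Q _ "\<lambda>f. degree (f k)"] by blast
  then obtain X where X: "vanishing f X" and fk: "f k \<noteq> 0" by (auto simp: Q_def)
  \<comment> \<open>A common root \<open>a\<close> could be divided out at the price of adding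
    \<open>a\<close> to the exceptional set, and the leading degree would drop.\<close>
  have nc: "\<exists>b\<le>k. poly (f b) a \<noteq> 0" for a
  proof (rule ccontr)
    assume "\<not> ?thesis"
    then have "\<forall>b. b \<le> k \<longrightarrow> [:-a, 1:] dvd f b" by (auto simp: poly_eq_0_iff_dvd)
    then have "\<forall>b. \<exists>g. b \<le> k \<longrightarrow> f b = [:-a, 1:] * g" unfolding dvd_def by blast
    then obtain g where g: "\<forall>b. b \<le> k \<longrightarrow> f b = [:-a, 1:] * g b" by (rule choice[THEN exE])
    have "vanishing g (X \<union> {a})" unfolding vanishing_def
    proof (intro conjI allI impI)
      fix w t assume w: "good w" "w \<notin> X \<union> {a}" "t \<in> sheets w"
      have "biv f w t = (w - a) * biv g w t"
        unfolding biv_def sum_distrib_left k_def[symmetric]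
      proof (rule sum.cong[OF refl])
        fix b assume "b \<in> {..k}"
        then have "poly (f b) w = poly ([:-a, 1:] * g b) w" using g by simp
        then have "poly (f b) w = (w - a) * poly (g b) w" by (simp add: algebra_simps)
        then show "poly (f b) w * t ^ b = (w - a) * (poly (g b) w * t ^ b)" by simp
      qed
      moreover have "biv f w t = 0" using X w by (auto simp: vanishing_def)
      ultimately show "biv g w t = 0" using w(2) by auto
    qed (use X in \<open>auto simp: vanishing_def\<close>)
    moreover have "g k \<noteq> 0" using g fk by auto
    ultimately have "degree (f k) \<le> degree (g k)" using f(2)[of g] by (auto simp: Q_def)
    moreover have "degree (f k) = Suc (degree (g k))"
      using g \<open>g k \<noteq> 0\<close> by (simp add: degree_mult_eq del: mult_pCons_left)
    ultimately show False by simp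
  qed
  have no_bound: False if "\<exists>M r. r > 0 \<and> (\<forall>w\<in>ball a r. w \<noteq> a \<longrightarrow> norm (poly (f k) w) * (1 + front w) \<le> M * norm (w - a))" for a
    using vanishing_common_root[OF X that[unfolded k_def]] nc[of a] k_def by blast
  have loc: "\<exists>M r. r > 0 \<and> (\<forall>w\<in>ball a r. norm (poly q w) \<le> M)" for q :: "complex poly" and a
  proof -
    have "((\<lambda>w. norm (poly q w)) \<longlongrightarrow> norm (poly q a)) (nhds a)"
      by (intro tendsto_intros filterlim_ident)
    then have "eventually (\<lambda>w. norm (poly q w) < norm (poly q a) + 1) (nhds a)"
      by (rule order_tendstoD) simp
    then obtain d where "d > 0" "\<forall>w. dist w a < d \<longrightarrow> norm (poly q w) < norm (poly q a) + 1"
      by (auto simp: eventually_nhds_metric)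
    then show ?thesis
      by (intro exI[of _ "norm (poly q a) + 1"] exI[of _ d]) (auto simp: dist_commute less_imp_le)
  qed
  \<comment> \<open>Off \<open>C\<close> the front sheet is bounded, so a linear factor of the
    leading coefficient already gives the estimate that forces a common root.\<close>
  have roots: "a \<in> C" if a: "poly (f k) a = 0" for a
  proof (rule ccontr)
    assume "a \<notin> C"
    then obtain M r where M: "r > 0" "\<And>w. w \<in> ball a r \<Longrightarrow> w \<noteq> a \<Longrightarrow> front w \<le> M"
      using front_bounded by blast
    obtain q where q: "f k = [:-a, 1:] * q" using a by (auto simp: poly_eq_0_iff_dvd elim: dvdE)
    obtain M' r' where M': "r' > 0" "\<And>w. w \<in> ball a r' \<Longrightarrow> norm (poly q w) \<le> M'" using loc by blast
    show False
    proof (rule no_bound, intro exI conjI ballI impI)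
      show "min r r' > 0" using M M' by simp
      fix w assume w: "w \<in> ball a (min r r')" "w \<noteq> a"
      have "norm (poly (f k) w) * (1 + front w) = (norm (poly q w) * (1 + front w)) * norm (w - a)"
      proof -
        have "poly (f k) w = (w - a) * poly q w" by (simp add: q algebra_simps)
        then show ?thesis by (simp add: norm_mult)
      qed
      also have "\<dots> \<le> (M' * (1 + M)) * norm (w - a)"
        using M(2)[of w] M'(2)[of w] w order_trans[OF norm_ge_zero M'(2)[of w]]
        by (intro mult_right_mono mult_mono) (auto simp: front_def intro: order_trans)
      finally show "norm (poly (f k) w) * (1 + front w) \<le> (M' * (1 + M)) * norm (w - a)" .
    qed
  qed
  \<comment> \<open>One factor \<open>w - p\<close> absorbs the simple pole of the front sheet; a
    second one would again give the forbidden estimate.\<close>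
  have simple: "\<not> [:-p, 1:]^2 dvd f k" if p: "p \<in> C" for p
  proof
    assume "[:-p, 1:]^2 dvd f k"
    then obtain q where q: "f k = [:-p, 1:]^2 * q" by (auto elim: dvdE)
    obtain M r where M: "r > 0" "\<And>w. w \<in> ball p r \<Longrightarrow> w \<noteq> p \<Longrightarrow> norm (w - p) * front w \<le> M"
      using front_pole_bounded[OF p] by blast
    obtain M' r' where M': "r' > 0" "\<And>w. w \<in> ball p r' \<Longrightarrow> norm (poly q w) \<le> M'" using loc by blast
    show False
    proof (rule no_bound, intro exI conjI ballI impI)
      \<comment> \<open>The radius is at most \<open>1\<close>, so that \<open>norm (w - p)\<close>
        is bounded by the \<open>1\<close> in \<open>M' * (1 + M)\<close>.\<close>
      show "min 1 (min r r') > 0" using M M' by simp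
      fix w assume w: "w \<in> ball p (min 1 (min r r'))" "w \<noteq> p"
      have "norm (poly (f k) w) * (1 + front w) = (norm (poly q w) * (norm (w - p) + norm (w - p) * front w)) * norm (w - p)"
      proof -
        have "poly (f k) w = (w - p) * ((w - p) * poly q w)" by (simp add: q power2_eq_square algebra_simps)
        then have "norm (poly (f k) w) = norm (w - p) * (norm (w - p) * norm (poly q w))" by (simp add: norm_mult)
        then show ?thesis by (simp only: algebra_simps)
      qed
      also have "\<dots> \<le> (M' * (1 + M)) * norm (w - p)"
        using M(2)[of w] M'(2)[of w] w order_trans[OF norm_ge_zero M'(2)[of w]]
        by (intro mult_right_mono mult_mono add_mono) (auto simp: front_def dist_norm norm_minus_commute intro: order_trans)
      finally show "norm (poly (f k) w) * (1 + front w) \<le> (M' * (1 + M)) * norm (w - p)" .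
    qed
  qed
  obtain c where c: "c \<noteq> 0" "f k = smult c node_poly"
    unfolding node_poly_def
    using poly_with_simple_roots[OF finite_C fk _ roots simple] vanishing_root_at_pole[OF X] k_def by metis
  define g where "g b = smult (inverse c) (f b)" for b
  have gb: "biv g w t = inverse c * biv f w t" for w t
    by (simp add: biv_def g_def sum_distrib_left mult.assoc)
  show ?thesis
  proof (rule that)
    show "vanishing g X" using X by (simp add: vanishing_def gb)
    show "g (card C) = node_poly" using c by (simp add: g_def k_def)
    show "\<exists>b\<le>card C. poly (g b) a \<noteq> 0" for a using nc[of a] c(1) by (auto simp: g_def k_def)
  qed
qed

lemma good_near:
  assumes "finite X" "open W" "w \<in> W" "\<And>x. good x \<Longrightarrow> x \<notin> X \<Longrightarrow> x \<in> W \<Longrightarrow> F x \<le> (G x :: real)"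
    "isCont F w" "isCont G w"
  shows "F w \<le> G w"
proof -
  obtain x where x: "x \<longlonglongrightarrow> w" "\<And>n. good (x n)" "\<And>n. x n \<notin> X" "\<And>n. x n \<in> W"
    using good_sequence[OF assms(1-3)] by blast
  have "(\<lambda>n. F (x n)) \<longlonglongrightarrow> F w" "(\<lambda>n. G (x n)) \<longlonglongrightarrow> G w"
    using assms(5,6) x(1) by (auto intro: isCont_tendsto_compose)
  then show ?thesis by (rule LIMSEQ_le) (use assms(4) x in blast)
qed

text \<open>Far from \<open>Om\<close> there is no front sheet, so all sheets are bounded and
  \<open>biv f w t\<close> grows at most like \<open>node_poly\<close>. This bounds the degree in
  \<open>w\<close> for each fixed \<open>t\<close>, and a coefficient polynomial in \<open>t\<close>
  that vanishes for all \<open>t\<close> is zero.\<close>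

lemma vanishing_degree:
  assumes v: "vanishing f X" and f: "f (card C) = node_poly" and b: "b \<le> card C"
  shows "degree (f b) \<le> card C"
proof -
  define k where "k = card C"
  obtain K where K: "K \<ge> 1" "\<And>z. z \<in> closure Om \<Longrightarrow> norm z \<le> K" using bound_Om by blast
  define G where "G t = (\<Sum>b\<le>k. smult (t ^ b) (f b))" for t
  have G: "poly (G t) w = biv f w t" for t w
    by (simp add: G_def biv_def k_def poly_sum mult.commute)
  have "degree (G t) \<le> k" for t
  proof (rule degree_le_of_growth)
    fix w :: complex assume w: "norm w > K"
    define D where "D = (1 + norm t) * (1 + norm t + K) ^ k"
    have D: "D \<ge> 0" using K(1) by (auto simp: D_def intro!: mult_nonneg_nonneg zero_le_power add_nonneg_nonneg)
    show "norm (poly (G t) w) \<le> (2 ^ k * D) * norm w ^ k"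
    proof (rule good_near[where W="- cball 0 K" and X=X])
      fix x assume x: "good x" "x \<notin> X" "x \<in> - cball 0 K"
      have "x \<notin> Om" using K(2)[of x] x(3) closure_subset by auto
      obtain T where T: "T \<subseteq> sheets x" "finite T" "card T = card C" using good_sheets[OF x(1)] by blast
      have "norm (poly (G t) x) = norm (poly node_poly x) * norm (\<Prod>s\<in>T. t - s)"
        using biv_product[OF v x(1,2) T] by (simp add: G norm_mult f)
      also have "norm (\<Prod>s\<in>T. t - s) \<le> D"
        using prod_sheets_bound[OF K T] \<open>x \<notin> Om\<close> by (simp add: D_def k_def front_def)
      also have "norm (poly node_poly x) \<le> (2 * norm x) ^ k"
      proof -
        have "norm (poly node_poly x) = (\<Prod>p\<in>C. norm (x - p))" by (simp add: poly_node_poly prod_norm)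
        also have "\<dots> \<le> (\<Prod>p\<in>C. 2 * norm x)"
        proof (rule prod_mono, intro conjI)
          fix p assume "p \<in> C"
          then have "norm p \<le> K" using C_sub K(2) closure_subset by blast
          then show "norm (x - p) \<le> 2 * norm x" using x(3) norm_triangle_ineq4[of x p] by simp
        qed simp
        finally show ?thesis by (simp add: k_def)
      qed
      finally show "norm (poly (G t) x) \<le> (2 ^ k * D) * norm x ^ k"
        using D by (simp add: power_mult_distrib mult_ac mult_left_mono mult_right_mono)
    qed (use v w in \<open>auto simp: vanishing_def intro!: continuous_intros\<close>)
  qed
  then have z: "(\<Sum>b\<le>k. coeff (f b) a * t ^ b) = 0" if "a > k" for a t
  proof -
    assume *: "\<And>t. degree (G t) \<le> k"
    have "coeff (G t) a = 0" using *[of t] that by (intro coeff_eq_0) simp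
    then show ?thesis by (simp add: G_def coeff_sum mult.commute)
  qed
  have "coeff (f b) a = 0" if "a > k" for a
  proof -
    have "poly (\<Sum>b\<le>k. monom (coeff (f b) a) b) = poly 0"
      using z[OF that] by (auto simp: poly_sum poly_monom)
    then have "(\<Sum>b\<le>k. monom (coeff (f b) a) b) = 0" by (simp add: poly_eq_poly_eq_iff)
    then have "coeff (\<Sum>b\<le>k. monom (coeff (f b) a) b) b = 0" by simp
    then show ?thesis using b by (simp add: coeff_sum coeff_monom k_def)
  qed
  then show ?thesis unfolding k_def by (intro degree_le) auto
qed

end

section \<open>The boundary as a real algebraic curve\<close>

text \<open>\<open>g\<close> is a nonzero element of least degree in the ideal generated by
  \<open>F\<close> and \<open>G\<close>. The coefficients only form a domain, later the polynomials
  in \<open>w\<close>, so division is replaced by pseudo-division; this is where \<open>c\<close>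
  and \<open>d\<close> come from.\<close>

lemma bezout_pseudo_gcd:
  fixes F G :: "'a::idom poly"
  assumes "F \<noteq> 0"
  shows "\<exists>a b g c d h1 h2. g \<noteq> 0 \<and> g = a * F + b * G \<and> c \<noteq> 0 \<and> d \<noteq> 0 \<and>
    smult c F = g * h1 \<and> smult d G = g * h2"
proof -
  define I where "I g \<longleftrightarrow> g \<noteq> 0 \<and> (\<exists>a b. g = a * F + b * G)" for g
  have "F = 1 * F + 0 * G" by simp
  then have "I F" unfolding I_def using assms by blast
  then obtain g where g: "I g" "\<And>h. I h \<Longrightarrow> degree g \<le> degree h"
    using ex_has_least_nat[of I F degree] by blast
  then obtain a b where ab: "g = a * F + b * G" and g0: "g \<noteq> 0" by (auto simp: I_def)
  have div: "\<exists>c h. c \<noteq> 0 \<and> smult c H = g * h" if H: "\<exists>u v. H = u * F + v * G" for H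
  proof -
    obtain q r where qr: "pseudo_divmod H g = (q, r)" by force
    define c where "c = coeff g (degree g) ^ (Suc (degree H) - degree g)"
    have eq: "smult c H = g * q + r" and r: "r = 0 \<or> degree r < degree g"
      using pseudo_divmod[OF g0 qr] by (auto simp: c_def)
    obtain u v where uv: "H = u * F + v * G" using H by blast
    have "r = smult c H - g * q" using eq by simp
    also have "\<dots> = (smult c u - a * q) * F + (smult c v - b * q) * G"
      unfolding uv ab by (simp add: algebra_simps smult_add_right)
    finally have "r \<noteq> 0 \<Longrightarrow> I r" unfolding I_def by blast
    then have "r = 0" using g(2) r by fastforce
    moreover have "c \<noteq> 0" using g0 by (simp add: c_def)
    ultimately show ?thesis using eq by auto
  qed
  have "\<exists>u v. F = u * F + v * G" by (intro exI[of _ 1] exI[of _ 0]) simp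
  then obtain c h1 where "c \<noteq> 0" "smult c F = g * h1" using div[of F] by blast
  moreover have "\<exists>u v. G = u * F + v * G" by (intro exI[of _ 0] exI[of _ 1]) simp
  then obtain d h2 where "d \<noteq> 0" "smult d G = g * h2" using div[of G] by blast
  ultimately show ?thesis using ab g0 by blast
qed

lemma poly_eq_sum_coeff:
  "degree p \<le> n \<Longrightarrow> poly p x = (\<Sum>i\<le>n. coeff p i * x ^ i)" for p :: "'a::comm_semiring_1 poly"
  unfolding poly_altdef by (rule sum.mono_neutral_left) (auto simp: coeff_eq_0)

lemma pderiv_sum: "pderiv (\<Sum>i\<in>A. f i) = (\<Sum>i\<in>A. pderiv (f i))"
  by (induction A rule: infinite_finite_induct) (auto simp: pderiv_add)

lemma pderiv_at_root: "poly (pderiv ([:-s, 1:] * h)) s = poly h (s::complex)"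
  by (simp add: pderiv_mult pderiv_pCons del: mult_pCons_left)

section \<open>Hermitian symmetry, zeros on the diagonal and double roots\<close>

context schwarz_domain
begin

lemma vanishing_front:
  assumes v: "vanishing f X" and z: "z \<in> Om - C"
  shows "biv f z (S z) = 0"
proof -
  obtain x where x: "x \<longlonglongrightarrow> z" "\<And>n. good (x n)" "\<And>n. x n \<notin> X" "\<And>n. x n \<in> Om - C"
    using good_sequence[of X "Om - C" z] open_punctured z v by (auto simp: vanishing_def)
  have "isCont S z"
    using hol_S open_punctured z by (metis continuous_on_eq_continuous_at holomorphic_on_imp_continuous_on)
  then have "(\<lambda>n. biv f (x n) (S (x n))) \<longlonglongrightarrow> biv f z (S z)"
    by (rule isCont_tendsto_compose[OF isCont_biv x(1)])
  moreover have "biv f (x n) (S (x n)) = 0" for n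
  proof -
    have "S (x n) \<in> sheets (x n)" using x(4) by (auto simp: sheets_def)
    then show ?thesis using v x by (auto simp: vanishing_def)
  qed
  ultimately show ?thesis using LIMSEQ_unique[OF _ tendsto_const] by auto
qed

lemma open_cnj_S_image: "open W \<Longrightarrow> W \<subseteq> Om - C \<Longrightarrow> open ((\<lambda>z. cnj (S z)) ` W)"
  using open_cnj[OF blowup_open_image[OF blowup_S, of W]] by (simp add: image_image)

text \<open>Relations are known only over good points. Since \<open>cnj (S z)\<close> is an open
  map, the dense good points can be pulled back to points near \<open>z\<close>.\<close>

lemma good_preimage_sequence:
  assumes z: "z \<in> Om - C" and X: "finite X"
  obtains x where "x \<longlonglongrightarrow> z" "\<And>n. x n \<in> Om - C" "\<And>n. good (cnj (S (x n)))" "\<And>n. cnj (S (x n)) \<notin> X"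
proof -
  have "\<forall>n. \<exists>y. y \<in> Om - C \<and> good (cnj (S y)) \<and> cnj (S y) \<notin> X \<and> dist y z < inverse (real (Suc n))"
  proof
    fix n
    define W where "W = ball z (inverse (real (Suc n))) \<inter> (Om - C)"
    have "open W" "W \<subseteq> Om - C" "z \<in> W" unfolding W_def using open_punctured z by (auto simp del: of_nat_Suc)
    then have "open ((\<lambda>z. cnj (S z)) ` W)" "(\<lambda>z. cnj (S z)) ` W \<noteq> {}" using open_cnj_S_image by auto
    then obtain y where "y \<in> W" "good (cnj (S y))" "cnj (S y) \<notin> X"
      using good_dense[OF _ _ X] by blast
    then show "\<exists>y. y \<in> Om - C \<and> good (cnj (S y)) \<and> cnj (S y) \<notin> X \<and> dist y z < inverse (real (Suc n))"
      by (intro exI[of _ y]) (simp add: W_def dist_commute del: of_nat_Suc)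
  qed
  then obtain x where x: "\<forall>n. x n \<in> Om - C \<and> good (cnj (S (x n))) \<and> cnj (S (x n)) \<notin> X \<and> dist (x n) z < inverse (real (Suc n))"
    by (rule choice[THEN exE])
  have "(\<lambda>n. dist (x n) z) \<longlonglongrightarrow> 0"
  proof (rule tendsto_sandwich[where f="\<lambda>_. 0" and h="\<lambda>n. inverse (real (Suc n))", rotated 3])
    show "(\<lambda>n. inverse (real (Suc n))) \<longlonglongrightarrow> 0" by (rule LIMSEQ_inverse_real_of_nat)
    show "\<forall>\<^sub>F n in sequentially. dist (x n) z \<le> inverse (real (Suc n))"
      using x by (intro always_eventually allI) (simp add: less_imp_le del: of_nat_Suc)
  qed auto
  then have "x \<longlonglongrightarrow> z" by (rule iffD2[OF tendsto_dist_iff])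
  then show ?thesis using that x by blast
qed

lemma vanishing_back:
  assumes v: "vanishing f X" and z: "z \<in> Om - C"
  shows "biv f (cnj (S z)) (cnj z) = 0"
proof -
  obtain x where x: "x \<longlonglongrightarrow> z" "\<And>n. x n \<in> Om - C" "\<And>n. good (cnj (S (x n)))" "\<And>n. cnj (S (x n)) \<notin> X"
    using good_preimage_sequence[OF z] v unfolding vanishing_def by metis
  have Sx: "(\<lambda>n. S (x n)) \<longlonglongrightarrow> S z" by (rule tendsto_hol[OF hol_S x(1) z])
  have lim: "(\<lambda>n. poly (f b) (cnj (S (x n))) * cnj (x n) ^ b) \<longlonglongrightarrow> poly (f b) (cnj (S z)) * cnj z ^ b" for b
    by (rule tendsto_mult[OF isCont_tendsto_compose[OF poly_isCont tendsto_cnj[OF Sx]] tendsto_power[OF tendsto_cnj[OF x(1)]]])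
  have "(\<lambda>n. biv f (cnj (S (x n))) (cnj (x n))) \<longlonglongrightarrow> biv f (cnj (S z)) (cnj z)"
    unfolding biv_def by (rule tendsto_sum[OF lim])
  moreover have "biv f (cnj (S (x n))) (cnj (x n)) = 0" for n
  proof -
    have "cnj (x n) \<in> sheets (cnj (S (x n)))" using x(2)[of n] by (auto simp: sheets_def)
    then show ?thesis using v x by (auto simp: vanishing_def)
  qed
  ultimately show ?thesis using LIMSEQ_unique[OF _ tendsto_const] by auto
qed

text \<open>The conjugate transpose of the coefficient matrix; a relation fixed by it takes real
  values on the diagonal \<open>t = cnj w\<close>.\<close>

definition adj :: "(nat \<Rightarrow> complex poly) \<Rightarrow> nat \<Rightarrow> complex poly" where
  "adj f b = (\<Sum>a\<le>card C. monom (cnj (coeff (f a) b)) a)"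

lemma coeff_adj: "a \<le> card C \<Longrightarrow> coeff (adj f b) a = cnj (coeff (f a) b)"
  by (simp add: adj_def coeff_sum coeff_monom)

lemma degree_adj: "degree (adj f b) \<le> card C"
  unfolding adj_def by (intro degree_sum_le) (auto intro: order_trans[OF degree_monom_le])

lemma biv_adj:
  assumes "\<And>b. b \<le> card C \<Longrightarrow> degree (f b) \<le> card C"
  shows "biv (adj f) w t = cnj (biv f (cnj t) (cnj w))"
proof -
  have p: "poly (f a) x = (\<Sum>b\<le>card C. coeff (f a) b * x ^ b)" if "a \<le> card C" for a x
    using assms[OF that] by (rule poly_eq_sum_coeff)
  have "biv (adj f) w t = (\<Sum>b\<le>card C. \<Sum>a\<le>card C. cnj (coeff (f a) b) * w ^ a * t ^ b)"
    unfolding biv_def adj_def by (simp add: poly_sum poly_monom sum_distrib_right)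
  also have "\<dots> = (\<Sum>a\<le>card C. \<Sum>b\<le>card C. cnj (coeff (f a) b) * w ^ a * t ^ b)"
    by (rule sum.swap)
  also have "\<dots> = (\<Sum>a\<le>card C. cnj (poly (f a) (cnj t) * cnj w ^ a))"
  proof (rule sum.cong[OF refl])
    fix a assume "a \<in> {..card C}"
    then have "cnj (poly (f a) (cnj t) * cnj w ^ a) = (\<Sum>b\<le>card C. cnj (coeff (f a) b) * t ^ b) * w ^ a"
      by (simp add: p cnj_sum)
    then show "(\<Sum>b\<le>card C. cnj (coeff (f a) b) * w ^ a * t ^ b) = cnj (poly (f a) (cnj t) * cnj w ^ a)"
      unfolding sum_distrib_right by (simp only: mult_ac)
  qed
  also have "\<dots> = cnj (biv f (cnj t) (cnj w))" by (simp add: biv_def cnj_sum)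
  finally show ?thesis .
qed

text \<open>Conjugation exchanges the two kinds of sheets, so \<open>adj f\<close> is again a
  relation. Its leading coefficient has degree at most \<open>card C\<close>, vanishes at all
  centers and has top coefficient \<open>1\<close>, hence is \<open>node_poly\<close> as well, and
  relations with equal leading coefficients agree.\<close>

lemma hermitian:
  assumes v: "vanishing f X" and f: "f (card C) = node_poly" and b: "b \<le> card C"
  shows "f b = adj f b"
proof -
  define k where "k = card C"
  have deg: "\<And>b. b \<le> card C \<Longrightarrow> degree (f b) \<le> card C" by (rule vanishing_degree[OF v f])
  have va: "vanishing (adj f) {}" unfolding vanishing_def
  proof (intro conjI allI impI)
    fix w t assume w: "good w" "t \<in> sheets w"
    from w(2) consider z where "t = cnj z" "z \<in> Om - C" "S z = cnj w" | "w \<in> Om" "t = S w"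
      by (auto simp: sheets_def split: if_splits)
    then have "biv f (cnj t) (cnj w) = 0"
    proof cases
      case 1 then show ?thesis using vanishing_front[OF v, of z] by simp
    next
      case 2 then show ?thesis using vanishing_back[OF v, of w] w(1) by (simp add: good_def)
    qed
    then show "biv (adj f) w t = 0" by (simp add: biv_adj[OF deg])
  qed simp
  have "adj f k = smult (coeff (adj f k) (card C)) (\<Prod>p\<in>C. [:-p, 1:])"
    using vanishing_root_at_pole[OF va] finite_C degree_adj by (intro poly_eq_smult_prod_roots) (auto simp: k_def)
  also have "coeff (adj f k) (card C) = 1"
    by (simp add: coeff_adj k_def f lead_coeff_node_poly)
  finally have fk: "adj f k = node_poly" by (simp add: node_poly_def)
  show ?thesis
  proof (rule ccontr)
    assume "f b \<noteq> adj f b"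
    then have "finite {w. poly (f b - adj f b) w = 0}" by (intro poly_roots_finite) simp
    then have "finite (X \<union> {w. poly (f b - adj f b) w = 0})" using v by (simp add: vanishing_def)
    then obtain w where w: "good w" "w \<notin> X \<union> {w. poly (f b - adj f b) w = 0}"
      using good_dense[of UNIV "X \<union> {w. poly (f b - adj f b) w = 0}"] by auto
    obtain T where T: "T \<subseteq> sheets w" "finite T" "card T = card C" using good_sheets[OF w(1)] by blast
    have "biv f w t = biv (adj f) w t" for t
      using biv_product[OF v w(1) _ T] biv_product[OF va w(1) _ T] w(2) f fk by (simp add: k_def)
    then have "poly (fib f w) = poly (fib (adj f) w)" by (auto simp: poly_fib)
    then have "fib f w = fib (adj f) w" by (simp add: poly_eq_poly_eq_iff)
    then have "coeff (fib f w) b = coeff (fib (adj f) w) b" by simp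
    then show False using w(2) b by (simp add: coeff_fib)
  qed
qed

lemma frontier_vanishing:
  assumes v: "vanishing f X" and w: "w \<in> frontier Om"
  shows "biv f w (cnj w) = 0"
proof -
  have wO: "w \<notin> Om" using w by (rule frontier_notin)
  then have "w islimpt Om" using w by (auto simp: frontier_def closure_def)
  then have nt: "at w within Om \<noteq> bot" by (simp add: trivial_limit_within)
  have lim: "((\<lambda>z. poly (f b) z * S z ^ b) \<longlongrightarrow> poly (f b) w * cnj w ^ b) (at w within Om)" for b
    by (rule tendsto_mult[OF _ tendsto_power[OF bdry_S[OF w]]])
       (rule isCont_tendsto_compose[OF poly_isCont tendsto_ident_at])
  have "((\<lambda>z. biv f z (S z)) \<longlongrightarrow> biv f w (cnj w)) (at w within Om)"
    unfolding biv_def by (rule tendsto_sum[OF lim])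
  moreover have "eventually (\<lambda>z. biv f z (S z) = 0) (at w within Om)"
  proof -
    have "w \<notin> C" using wO C_sub by blast
    then have "eventually (\<lambda>z. z \<in> - C) (at w within Om)"
      unfolding eventually_at_filter
      using eventually_nhds_in_open[OF open_Compl[OF finite_imp_closed[OF finite_C]], of w]
      by (auto elim: eventually_mono)
    moreover have "eventually (\<lambda>z. z \<in> Om) (at w within Om)"
      by (simp add: eventually_at_filter)
    ultimately show ?thesis by eventually_elim (use vanishing_front[OF v] in auto)
  qed
  then have "((\<lambda>z. biv f z (S z)) \<longlongrightarrow> 0) (at w within Om)" by (rule tendsto_eventually)
  ultimately show ?thesis using tendsto_unique[OF nt] by blast
qed

lemma prod_lower_bound:
  assumes "finite T" "\<And>s. s \<in> T \<Longrightarrow> d \<le> norm (t - s)" "(d::real) \<ge> 0"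
  shows "d ^ card T \<le> norm (\<Prod>s\<in>T. t - (s::complex))"
proof -
  have "(\<Prod>s\<in>T. d) \<le> (\<Prod>s\<in>T. norm (t - s))" using assms by (intro prod_mono) auto
  then show ?thesis by (simp add: prod_norm)
qed

text \<open>If \<open>cnj x\<close> keeps the distance \<open>d\<close> from all sheets over good
  \<open>x\<close>, the product formula gives a lower bound that survives the limit to
  \<open>w\<close>, where \<open>node_poly\<close> is nonzero.\<close>

lemma biv_diag_nonzero:
  assumes v: "vanishing f X" and f: "f (card C) = node_poly" and w: "w \<notin> C"
    and d: "d > 0" and W: "open W" "w \<in> W"
    and sep: "\<And>x s. x \<in> W \<Longrightarrow> good x \<Longrightarrow> s \<in> sheets x \<Longrightarrow> d \<le> norm (cnj x - s)"
  shows "biv f w (cnj w) \<noteq> 0"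
proof -
  have "norm (poly node_poly w) * d ^ card C \<le> norm (biv f w (cnj w))"
  proof (rule good_near[OF _ W, where X=X])
    fix x assume x: "good x" "x \<notin> X" "x \<in> W"
    obtain T where T: "T \<subseteq> sheets x" "finite T" "card T = card C" using good_sheets[OF x(1)] by blast
    have "d ^ card C \<le> norm (\<Prod>s\<in>T. cnj x - s)"
      using prod_lower_bound[OF T(2), of d "cnj x"] sep[OF x(3,1)] T(1,3) d by (simp add: subset_iff)
    then show "norm (poly node_poly x) * d ^ card C \<le> norm (biv f x (cnj x))"
      using biv_product[OF v x(1,2) T] by (simp add: f norm_mult mult_left_mono)
  next
    show "isCont (\<lambda>x. norm (biv f x (cnj x))) w"
      by (rule isCont_norm[OF isCont_biv]) (intro continuous_intros)
    show "isCont (\<lambda>x. norm (poly node_poly x) * d ^ card C) w"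
      by (rule isCont_mult[OF isCont_norm[OF poly_isCont] continuous_const])
  qed (use v in \<open>simp add: vanishing_def\<close>)
  moreover have "norm (poly node_poly w) * d ^ card C > 0"
    using w d poly_node_poly_eq_0_iff by simp
  ultimately show ?thesis by auto
qed

text \<open>Outside the closure the sheets are conjugates of points \<open>z\<close> of
  \<open>Om\<close>, and \<open>norm (cnj x - cnj z)\<close> is the distance from \<open>x\<close>
  to \<open>z\<close>.\<close>

lemma outside_nonzero:
  assumes v: "vanishing f X" and f: "f (card C) = node_poly" and w: "w \<notin> closure Om"
  shows "biv f w (cnj w) \<noteq> 0"
proof -
  have "open (- closure Om)" by auto
  then obtain d where d: "d > 0" "ball w d \<subseteq> - closure Om" using w open_contains_ball[of "- closure Om"] by blast
  show ?thesis
  proof (rule biv_diag_nonzero[OF v f, where d="d/2" and W="ball w (d/2)"])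
    fix x s assume x: "x \<in> ball w (d/2)" and s: "s \<in> sheets x"
    have "x \<in> ball w d" using x d(1) by auto
    then have "x \<notin> Om" using d(2) closure_subset by blast
    then obtain z where z: "s = cnj z" "z \<in> Om" using s by (auto simp: sheets_def)
    have "z \<notin> ball w d" using z(2) d(2) closure_subset by blast
    then have "d \<le> dist w z" by simp
    also have "\<dots> \<le> dist w x + dist x z" by (rule dist_triangle)
    finally have "d / 2 \<le> dist x z" using x by simp
    moreover have "norm (cnj x - s) = dist x z" by (simp add: z(1) dist_norm flip: complex_cnj_diff)
    ultimately show "d / 2 \<le> norm (cnj x - s)" by simp
  qed (use d w C_sub closure_subset in auto)
qed

text \<open>For \<open>x\<close> and \<open>y\<close> near \<open>w\<close> the values
  \<open>S y\<close> stay away from \<open>cnj x\<close>. So the front sheet is far from the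
  diagonal, and a preimage \<open>z\<close> of \<open>cnj x\<close> cannot lie near
  \<open>w\<close>, which separates \<open>cnj z\<close> from \<open>cnj x\<close>.\<close>

lemma inside_nonzero:
  assumes v: "vanishing f X" and f: "f (card C) = node_poly" and w: "w \<in> Om - C" "S w \<noteq> cnj w"
  shows "biv f w (cnj w) \<noteq> 0"
proof -
  define e where "e = norm (S w - cnj w) / 4"
  have e: "e > 0" using w by (simp add: e_def)
  have "isCont S w"
    using hol_S open_punctured w(1) by (metis continuous_on_eq_continuous_at holomorphic_on_imp_continuous_on)
  then obtain r1 where r1: "r1 > 0" "\<And>y. dist y w < r1 \<Longrightarrow> dist (S y) (S w) < e"
    using e by (auto simp: continuous_at_eps_delta)
  define r where "r = min r1 e"
  have r: "r > 0" using r1 e by (simp add: r_def)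
  have far: "e \<le> norm (S y - cnj x)" if "y \<in> ball w r" "x \<in> ball w r" for x y
  proof -
    have "norm (S w - cnj w) \<le> norm (S w - S y) + norm (S y - cnj x) + norm (cnj x - cnj w)"
      using norm_triangle_ineq[of "S w - S y" "S y - cnj w"] norm_triangle_ineq[of "S y - cnj x" "cnj x - cnj w"] by simp
    moreover have "norm (S w - S y) < e"
      using r1(2)[of y] that(1) by (simp add: r_def dist_norm norm_minus_commute)
    moreover have "norm (cnj x - cnj w) < e"
      using that(2) by (simp add: r_def dist_norm norm_minus_commute flip: complex_cnj_diff)
    moreover have "norm (S w - cnj w) = 4 * e" by (simp add: e_def)
    ultimately show ?thesis using e by linarith
  qed
  show ?thesis
  proof (rule biv_diag_nonzero[OF v f, where d="min e (r/2)" and W="ball w (r/2)"])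
    fix x s assume x: "x \<in> ball w (r/2)" and s: "s \<in> sheets x"
    have xr: "x \<in> ball w r" using x r by auto
    from s consider z where "s = cnj z" "z \<in> Om - C" "S z = cnj x" | "s = S x"
      by (auto simp: sheets_def split: if_splits)
    then show "min e (r/2) \<le> norm (cnj x - s)"
    proof cases
      case 1
      have "z \<notin> ball w r" using far[of z x] xr 1(3) e by auto
      then have "r \<le> dist w z" by simp
      also have "\<dots> \<le> dist w x + dist x z" by (rule dist_triangle)
      finally have "r / 2 \<le> dist x z" using x by simp
      moreover have "norm (cnj x - s) = dist x z" by (simp add: 1 dist_norm flip: complex_cnj_diff)
      ultimately show ?thesis by simp
    next
      case 2
      then show ?thesis using far[OF xr xr] by (simp add: norm_minus_commute)
    qed
  qed (use r e w in auto)
qed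

text \<open>For \<open>z n\<close> tending to \<open>w\<close> and
  \<open>x n = cnj (S (z n))\<close>, the sheets \<open>cnj (z n)\<close> and \<open>S (x n)\<close>
  over \<open>x n\<close> are distinct, as \<open>x n\<close> is not involutive, but both tend to
  \<open>cnj w\<close>. In the limit \<open>biv f w t\<close> is of the order of the square of
  \<open>norm (t - cnj w)\<close>.\<close>

lemma diag_double_root:
  assumes v: "vanishing f X" and f: "f (card C) = node_poly" and w: "w \<in> Om - C" "S w = cnj w"
  shows "poly (fib f w) (cnj w) = 0" "poly (pderiv (fib f w)) (cnj w) = 0"
proof -
  obtain z where z: "z \<longlonglongrightarrow> w" "\<And>n. z n \<in> Om - C" "\<And>n. good (cnj (S (z n)))" "\<And>n. cnj (S (z n)) \<notin> X"
    using good_preimage_sequence[OF w(1)] v unfolding vanishing_def by metis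
  define x where "x n = cnj (S (z n))" for n
  have "(\<lambda>n. S (z n)) \<longlonglongrightarrow> S w" by (rule tendsto_hol[OF hol_S z(1) w(1)])
  then have "x \<longlonglongrightarrow> cnj (S w)" unfolding x_def by (rule tendsto_cnj)
  then have x: "x \<longlonglongrightarrow> w" by (simp add: w)
  have Sx: "(\<lambda>n. S (x n)) \<longlonglongrightarrow> cnj w" using tendsto_hol[OF hol_S x w(1)] w(2) by simp
  have xin: "eventually (\<lambda>n. x n \<in> Om - C) sequentially"
    using x open_punctured w(1) by (rule topological_tendstoD)
  obtain K where K: "K \<ge> 1" "\<And>z. z \<in> closure Om \<Longrightarrow> norm z \<le> K" using bound_Om by blast
  have bound: "norm (biv f w t) \<le> norm (poly node_poly w) * norm (t - cnj w) * norm (t - cnj w) * (1 + norm t + K) ^ card C" for t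
  proof (rule tendsto_le[OF sequentially_bot])
    have "isCont (\<lambda>w. norm (biv f w t)) w" by (rule isCont_norm[OF isCont_biv]) (rule continuous_const)
    then show "(\<lambda>n. norm (biv f (x n) t)) \<longlonglongrightarrow> norm (biv f w t)" using x by (rule isCont_tendsto_compose)
    show "(\<lambda>n. norm (poly node_poly (x n)) * norm (t - S (x n)) * norm (t - cnj (z n)) * (1 + norm t + K) ^ card C)
      \<longlonglongrightarrow> norm (poly node_poly w) * norm (t - cnj w) * norm (t - cnj w) * (1 + norm t + K) ^ card C"
      by (rule tendsto_mult[OF tendsto_mult[OF tendsto_mult[OF tendsto_norm[OF isCont_tendsto_compose[OF poly_isCont x]]
            tendsto_norm[OF tendsto_diff[OF tendsto_const Sx]]] tendsto_norm[OF tendsto_diff[OF tendsto_const tendsto_cnj[OF z(1)]]]] tendsto_const])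
    show "eventually (\<lambda>n. norm (biv f (x n) t) \<le> norm (poly node_poly (x n)) * norm (t - S (x n)) * norm (t - cnj (z n)) * (1 + norm t + K) ^ card C) sequentially"
      using xin
    proof (rule eventually_mono)
      fix n assume xn: "x n \<in> Om - C"
      have gx: "good (x n)" "x n \<notin> X" using z by (auto simp: x_def)
      obtain T where T: "T \<subseteq> sheets (x n)" "finite T" "card T = card C" using good_sheets[OF gx(1)] by blast
      have prod: "biv f (x n) t = poly node_poly (x n) * (\<Prod>s\<in>T. t - s)" for t
        using biv_product[OF v gx T] by (simp add: f)
      have P: "poly node_poly (x n) \<noteq> 0" using xn poly_node_poly_eq_0_iff by auto
      \<comment> \<open>\<open>node_poly\<close> is nonzero at \<open>x n\<close>, so the roots of
        the fibre are exactly the elements of \<open>T\<close>.\<close>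
      have inT: "s \<in> T" if "s \<in> sheets (x n)" for s
      proof -
        have "biv f (x n) s = 0" using v gx that by (auto simp: vanishing_def)
        then show ?thesis using prod[of s] P T(2) by auto
      qed
      have "S (z n) = cnj (x n)" by (simp add: x_def)
      then have zs: "cnj (z n) \<in> sheets (x n)" "S (x n) \<in> sheets (x n)"
        using z(2)[of n] xn by (auto simp: sheets_def)
      have ne: "S (x n) \<noteq> cnj (z n)"
      proof
        assume "S (x n) = cnj (z n)"
        then have "x n \<in> involutive" using xn z(2)[of n] \<open>S (z n) = cnj (x n)\<close> by (simp add: involutive_def)
        then show False using gx by (simp add: good_def)
      qed
      define A where "A = T - {S (x n)} - {cnj (z n)}"
      have "(\<Prod>s\<in>T. t - s) = (t - S (x n)) * (\<Prod>s\<in>T - {S (x n)}. t - s)"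
        using inT[OF zs(2)] T(2) by (rule prod.remove[rotated])
      also have "(\<Prod>s\<in>T - {S (x n)}. t - s) = (t - cnj (z n)) * (\<Prod>s\<in>A. t - s)"
        unfolding A_def using inT[OF zs(1)] ne T(2) by (intro prod.remove) auto
      finally have eq: "norm (biv f (x n) t) = norm (poly node_poly (x n)) * norm (t - S (x n)) * norm (t - cnj (z n)) * norm (\<Prod>s\<in>A. t - s)"
        by (simp add: prod norm_mult)
      have "norm (\<Prod>s\<in>A. t - s) = (\<Prod>s\<in>A. norm (t - s))" by (simp add: prod_norm)
      also have "\<dots> \<le> (\<Prod>s\<in>A. 1 + norm t + K)"
      proof (rule prod_mono, intro conjI)
        fix s assume "s \<in> A"
        then have "s \<in> cnj ` {z \<in> Om - C. S z = cnj (x n)}"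
          using T(1) by (auto simp: A_def sheets_def split: if_splits)
        then have "norm s \<le> K" using K(2) closure_subset by fastforce
        then show "norm (t - s) \<le> 1 + norm t + K" using norm_triangle_ineq4[of t s] by simp
      qed simp
      also have "\<dots> = (1 + norm t + K) ^ card A" by simp
      also have "\<dots> \<le> (1 + norm t + K) ^ card C"
      proof (rule power_increasing)
        show "card A \<le> card C" using T(2,3) card_mono[of T A] by (auto simp: A_def)
        show "1 \<le> 1 + norm t + K" using K(1) norm_ge_zero[of t] by linarith
      qed
      finally show "norm (biv f (x n) t) \<le> norm (poly node_poly (x n)) * norm (t - S (x n)) * norm (t - cnj (z n)) * (1 + norm t + K) ^ card C"
        unfolding eq by (intro mult_left_mono) auto
    qed
  qed
  show root: "poly (fib f w) (cnj w) = 0" using bound[of "cnj w"] by (simp add: poly_fib)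
  then obtain h where h: "fib f w = [:- cnj w, 1:] * h" by (auto simp: poly_eq_0_iff_dvd elim: dvdE)
  define D where "D t = norm (poly node_poly w) * norm (t - cnj w) * (1 + norm t + K) ^ card C" for t
  have "norm (poly h t) \<le> D t" if "t \<noteq> cnj w" for t
  proof -
    have "norm (t - cnj w) * norm (poly h t) = norm (biv f w t)"
      unfolding poly_fib[symmetric] h by (simp add: norm_mult[symmetric] algebra_simps)
    also have "\<dots> \<le> norm (t - cnj w) * D t" using bound[of t] by (simp add: D_def mult_ac)
    finally show ?thesis using that by simp
  qed
  then have "eventually (\<lambda>t. norm (poly h t) \<le> D t) (at (cnj w))" by (simp add: eventually_at_filter)
  moreover have "(D \<longlongrightarrow> D (cnj w)) (at (cnj w))"
  proof -
    have "isCont D (cnj w)" unfolding D_def by (intro continuous_intros)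
    then show ?thesis by (simp add: isCont_def)
  qed
  then have "(D \<longlongrightarrow> 0) (at (cnj w))" by (simp add: D_def)
  ultimately have "(poly h \<longlongrightarrow> 0) (at (cnj w))" by (rule Lim_null_comparison)
  moreover have "(poly h \<longlongrightarrow> poly h (cnj w)) (at (cnj w))" using poly_isCont by (simp add: isCont_def[symmetric])
  ultimately have "poly h (cnj w) = 0" using LIM_unique by blast
  then show "poly (pderiv (fib f w)) (cnj w) = 0" unfolding h pderiv_at_root .
qed

text \<open>If the pseudo-gcd of \<open>F\<close> and its \<open>t\<close>-derivative had positive
  degree in \<open>t\<close>, one of its roots over a generic \<open>w\<close> would be a double
  root, against the distinct sheets. So it is a polynomial \<open>r\<close> in \<open>w\<close>
  alone, and double roots occur only over its zeros.\<close>

lemma finite_double_roots: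
  assumes v: "vanishing f X" and f: "f (card C) = node_poly"
  shows "finite {w. \<exists>t. poly (fib f w) t = 0 \<and> poly (pderiv (fib f w)) t = 0}"
proof -
  define F where "F = (\<Sum>b\<le>card C. monom (f b) b)"
  \<comment> \<open>The outer variable is \<open>t\<close>, the coefficients are polynomials in
    \<open>w\<close>: first the constant polynomial \<open>[:t:]\<close> is inserted, then
    \<open>w\<close>.\<close>
  define ev where "ev p w t = poly (poly p [:t:]) w" for p :: "complex poly poly" and w t
  have evF: "ev F w t = poly (fib f w) t" for w t
    by (simp add: ev_def F_def poly_fib biv_def poly_sum poly_monom poly_power)
  have evF': "ev (pderiv F) w t = poly (pderiv (fib f w)) t" for w t
    by (simp add: ev_def F_def fib_def pderiv_sum pderiv_monom poly_sum poly_monom poly_power)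
  have "coeff F (card C) = node_poly" by (simp add: F_def coeff_sum coeff_monom f)
  then have "F \<noteq> 0" using lead_coeff_node_poly by auto
  then obtain a b g c d h1 h2 where g: "g \<noteq> 0" "g = a * F + b * pderiv F" "c \<noteq> 0" "d \<noteq> 0"
    "smult c F = g * h1" "smult d (pderiv F) = g * h2"
    using bezout_pseudo_gcd[of F "pderiv F"] by blast
  have evg: "ev g w t = poly (map_poly (\<lambda>q. poly q w) g) t" for w t
  proof -
    have "ev g w t = (\<Sum>i\<le>degree g. poly (coeff g i) w * t ^ i)"
      unfolding ev_def poly_altdef[of g] by (simp add: poly_sum poly_power)
    also have "\<dots> = (\<Sum>i\<le>degree g. coeff (map_poly (\<lambda>q. poly q w) g) i * t ^ i)"
      by (simp add: coeff_map_poly)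
    also have "\<dots> = poly (map_poly (\<lambda>q. poly q w) g) t"
      by (rule poly_eq_sum_coeff[symmetric]) (rule map_poly_degree_leq)
    finally show ?thesis .
  qed
  have "degree g = 0"
  proof (rule ccontr)
    assume dg: "degree g \<noteq> 0"
    \<comment> \<open>The pseudo-gcd divides only up to the factors \<open>c\<close> and
      \<open>d\<close>, and its degree may drop at roots of its leading coefficient; all these
      \<open>w\<close> are excluded.\<close>
    define Y where "Y = X \<union> C \<union> {w. poly (lead_coeff g) w = 0} \<union> {w. poly c w = 0} \<union> {w. poly d w = 0}"
    have "lead_coeff g \<noteq> 0" using g(1) by simp
    then have "finite Y" unfolding Y_def
      using v finite_C g(3,4) by (intro finite_UnI poly_roots_finite) (simp_all add: vanishing_def)
    then obtain w where w: "good w" "w \<notin> Y" using good_dense[of UNIV Y] by auto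
    define gw where "gw = map_poly (\<lambda>q. poly q w) g"
    have "coeff gw (degree g) \<noteq> 0" using w(2) by (simp add: gw_def coeff_map_poly Y_def)
    then have "degree gw \<noteq> 0" using dg le_degree by force
    then obtain t where t: "poly gw t = 0" using alg_closed_imp_poly_has_root[of gw] by auto
    then have g0: "ev g w t = 0" by (simp add: evg gw_def)
    have "ev (smult c F) w t = 0" unfolding g(5) using g0 by (simp add: ev_def)
    then have r1: "poly (fib f w) t = 0" using w(2) by (simp add: evF[symmetric] ev_def Y_def)
    have "ev (smult d (pderiv F)) w t = 0" unfolding g(6) using g0 by (simp add: ev_def)
    then have r2: "poly (pderiv (fib f w)) t = 0" using w(2) by (simp add: evF'[symmetric] ev_def Y_def)
    obtain T where T: "T \<subseteq> sheets w" "finite T" "card T = card C" using good_sheets[OF w(1)] by blast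
    have "poly (fib f w) = poly (smult (poly node_poly w) (\<Prod>s\<in>T. [:-s, 1:]))"
      using biv_product[OF v w(1) _ T] w(2) f by (auto simp: poly_fib poly_prod Y_def)
    then have fw: "fib f w = smult (poly node_poly w) (\<Prod>s\<in>T. [:-s, 1:])" by (simp add: poly_eq_poly_eq_iff)
    have P: "poly node_poly w \<noteq> 0" using w(2) poly_node_poly_eq_0_iff by (simp add: Y_def)
    have "t \<in> T" using r1 P T(2) unfolding fw by (auto simp: poly_prod)
    define R where "R = (\<Prod>s\<in>T - {t}. [:-s, 1:])"
    have "(\<Prod>s\<in>T. [:-s, 1:]) = [:-t, 1:] * R" unfolding R_def using T(2) \<open>t \<in> T\<close> by (rule prod.remove)
    then have "fib f w = [:-t, 1:] * smult (poly node_poly w) R" unfolding fw by (simp only: mult_smult_right)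
    then have "poly (smult (poly node_poly w) R) t = 0" using r2 pderiv_at_root by metis
    then show False using P T(2) by (auto simp: R_def poly_prod)
  qed
  then obtain r where r: "g = [:r:]" by (rule degree_eq_zeroE)
  have "r \<noteq> 0" using r g(1) by auto
  have "poly r w = 0" if "poly (fib f w) t = 0" "poly (pderiv (fib f w)) t = 0" for w t
  proof -
    have "ev g w t = 0" unfolding g(2) using that by (simp add: ev_def flip: evF evF')
    then show ?thesis by (simp add: r ev_def)
  qed
  then have "{w. \<exists>t. poly (fib f w) t = 0 \<and> poly (pderiv (fib f w)) t = 0} \<subseteq> {w. poly r w = 0}" by blast
  then show ?thesis using poly_roots_finite[OF \<open>r \<noteq> 0\<close>] finite_subset by blast
qed

theorem boundary_algebraic:
  obtains Q :: "nat \<Rightarrow> nat \<Rightarrow> complex" where "Q (card C) (card C) = 1" "\<And>a b. a \<le> card C \<Longrightarrow> b \<le> card C \<Longrightarrow> Q a b = cnj (Q b a)"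
    "frontier Om \<subseteq> {w. (\<Sum>a\<le>card C. \<Sum>b\<le>card C. Q a b * w ^ a * cnj w ^ b) = 0}"
    "finite ({w. (\<Sum>a\<le>card C. \<Sum>b\<le>card C. Q a b * w ^ a * cnj w ^ b) = 0} - frontier Om)"
proof -
  obtain f X where v: "vanishing f X" and f: "f (card C) = node_poly" using vanishing_minimal by metis
  define Q where "Q a b = coeff (f b) a" for a b
  have Z: "(\<Sum>a\<le>card C. \<Sum>b\<le>card C. Q a b * w ^ a * cnj w ^ b) = biv f w (cnj w)" for w
  proof -
    have "biv f w (cnj w) = (\<Sum>b\<le>card C. \<Sum>a\<le>card C. Q a b * w ^ a * cnj w ^ b)"
      unfolding biv_def Q_def
    proof (rule sum.cong[OF refl])
      fix b assume "b \<in> {..card C}"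
      then have "poly (f b) w = (\<Sum>a\<le>card C. coeff (f b) a * w ^ a)"
        using vanishing_degree[OF v f] by (intro poly_eq_sum_coeff) simp
      then show "poly (f b) w * cnj w ^ b = (\<Sum>a\<le>card C. coeff (f b) a * w ^ a * cnj w ^ b)"
        by (simp only: sum_distrib_right)
    qed
    then show ?thesis by (subst sum.swap) simp
  qed
  show ?thesis
  proof (rule that[of Q])
    show "Q (card C) (card C) = 1" by (simp add: Q_def f lead_coeff_node_poly)
    show "Q a b = cnj (Q b a)" if "a \<le> card C" "b \<le> card C" for a b
      using hermitian[OF v f that(2)] coeff_adj[OF that(1), of f b] by (simp add: Q_def)
    show "frontier Om \<subseteq> {w. (\<Sum>a\<le>card C. \<Sum>b\<le>card C. Q a b * w ^ a * cnj w ^ b) = 0}"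
      unfolding Z using frontier_vanishing[OF v] by blast
    have "{w. biv f w (cnj w) = 0} - frontier Om \<subseteq> C \<union> {w. \<exists>t. poly (fib f w) t = 0 \<and> poly (pderiv (fib f w)) t = 0}"
    proof
      fix w assume w: "w \<in> {w. biv f w (cnj w) = 0} - frontier Om"
      then have "w \<in> closure Om" using outside_nonzero[OF v f] by blast
      then have "w \<in> C \<or> w \<in> Om - C" using closure_cases w by blast
      then show "w \<in> C \<union> {w. \<exists>t. poly (fib f w) t = 0 \<and> poly (pderiv (fib f w)) t = 0}"
        using inside_nonzero[OF v f, of w] diag_double_root[OF v f, of w] w by blast
    qed
    then show "finite ({w. (\<Sum>a\<le>card C. \<Sum>b\<le>card C. Q a b * w ^ a * cnj w ^ b) = 0} - frontier Om)"
      unfolding Z using finite_double_roots[OF v f] finite_C finite_subset by blast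
  qed
qed

end

section \<open>Integration over disks\<close>

definition to_vec :: "complex \<Rightarrow> real^2" where
  "to_vec z = (\<chi> i. if i = 1 then Re z else Im z)"

definition of_vec :: "real^2 \<Rightarrow> complex" where
  "of_vec x = Complex (x $ 1) (x $ 2)"

lemma to_vec_nth [simp]: "to_vec z $ 1 = Re z" "to_vec z $ 2 = Im z"
  by (simp_all add: to_vec_def)

lemma of_vec_sel [simp]: "Re (of_vec x) = x $ 1" "Im (of_vec x) = x $ 2"
  by (simp_all add: of_vec_def)

lemma of_vec_to_vec [simp]: "of_vec (to_vec z) = z"
  by (simp add: complex_eq_iff)

lemma to_vec_of_vec [simp]: "to_vec (of_vec x) = x"
  by (simp add: vec_eq_iff forall_2)

lemma norm_to_vec [simp]: "norm (to_vec z) = norm z"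
  by (simp add: norm_eq_sqrt_inner inner_vec_def sum_2 inner_complex_def)

lemma linear_to_vec: "linear to_vec"
  by (rule linearI) (auto simp: vec_eq_iff forall_2)

lemma linear_of_vec: "linear of_vec"
  by (rule linearI) (auto simp: complex_eq_iff)

lemma dist_to_vec [simp]: "dist (to_vec z) (to_vec w) = dist z w"
  by (simp add: dist_norm flip: linear_diff[OF linear_to_vec])

lemma continuous_on_to_vec [continuous_intros]: "continuous_on A to_vec"
  by (intro linear_continuous_on linear_linear[THEN iffD2] linear_to_vec)

lemma continuous_on_of_vec [continuous_intros]: "continuous_on A of_vec"
  by (intro linear_continuous_on linear_linear[THEN iffD2] linear_of_vec)

lemma to_vec_measurable [measurable]: "to_vec \<in> borel_measurable borel"
  by (intro borel_measurable_continuous_onI continuous_intros)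

lemma of_vec_measurable [measurable]: "of_vec \<in> borel_measurable borel"
  by (intro borel_measurable_continuous_onI continuous_intros)

lemma distr_of_vec: "distr lborel borel of_vec = (lborel :: complex measure)"
proof (rule sym, rule lborel_eqI)
  fix l u :: complex assume lu: "\<And>b. b \<in> Basis \<Longrightarrow> l \<bullet> b \<le> u \<bullet> b"
  have le: "Re l \<le> Re u" "Im l \<le> Im u" using lu[of 1] lu[of \<i>] by auto
  have "of_vec -` box l u = box (to_vec l) (to_vec u)"
    by (auto simp: box_def Basis_complex_def mem_box_cart forall_2 inner_axis Basis_vec_def axis_eq_axis)
  then have "emeasure (distr lborel borel of_vec) (box l u) = emeasure lborel (box (to_vec l) (to_vec u))"
    by (subst emeasure_distr) auto
  also have "\<dots> = (\<Prod>b\<in>Basis. (to_vec u - to_vec l) \<bullet> b)"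
    by (rule emeasure_lborel_box) (use le in \<open>auto simp: Basis_vec_def inner_axis forall_2 to_vec_def\<close>)
  also have "(\<Prod>b\<in>Basis. (to_vec u - to_vec l) \<bullet> b) = (Re u - Re l) * (Im u - Im l)"
  proof -
    have B: "(Basis :: (real^2) set) = {axis 1 1, axis 2 1}" by (auto simp: Basis_vec_def UNIV_2)
    show ?thesis unfolding B by (subst prod.insert) (auto simp: inner_axis axis_eq_axis)
  qed
  also have "\<dots> = (\<Prod>b\<in>Basis. (u - l) \<bullet> b)" by (simp add: Basis_complex_def)
  finally show "emeasure (distr lborel borel of_vec) (box l u) = (\<Prod>b\<in>Basis. (u - l) \<bullet> b)" .
qed simp

text \<open>Carried to \<open>real^2\<close>, the rotation is an orthogonal transformation, which
  preserves the measure of boxes, and boxes determine Lebesgue measure.\<close>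

lemma distr_rotation:
  fixes u :: complex assumes u: "norm u = 1"
  shows "distr lborel borel (\<lambda>z. u * z) = (lborel :: complex measure)"
proof (rule sym, rule lborel_eqI)
  fix l w :: complex assume lw: "\<And>b. b \<in> Basis \<Longrightarrow> l \<bullet> b \<le> w \<bullet> b"
  have le: "Re l \<le> Re w" "Im l \<le> Im w" using lw[of 1] lw[of \<i>] by auto
  have uu: "u * cnj u = 1" using u by (simp add: complex_norm_square[symmetric])
  define g where "g = (\<lambda>x. to_vec (cnj u * of_vec x))"
  have lin: "linear g" unfolding g_def
    by (rule linearI) (auto simp: linear_add[OF linear_of_vec] linear_scale[OF linear_of_vec]
        linear_add[OF linear_to_vec] linear_scale[OF linear_to_vec] distrib_left)
  have norm_of: "norm (of_vec x) = norm x" for x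
    by (metis norm_to_vec to_vec_of_vec)
  have orth: "orthogonal_transformation g"
    unfolding orthogonal_transformation using lin u by (auto simp: g_def norm_mult norm_of)
  define B where "B = box (to_vec l) (to_vec w)"
  have B: "of_vec -` box l w = B"
    by (auto simp: B_def box_def Basis_complex_def mem_box_cart forall_2 inner_axis Basis_vec_def axis_eq_axis)
  have pre: "of_vec -` ((\<lambda>z. u * z) -` box l w) = g ` B"
  proof (intro equalityI subsetI)
    fix x assume "x \<in> of_vec -` ((\<lambda>z. u * z) -` box l w)"
    then have "to_vec (u * of_vec x) \<in> B" by (simp flip: B)
    moreover have "g (to_vec (u * of_vec x)) = to_vec ((u * cnj u) * of_vec x)"
      unfolding g_def by (simp add: mult_ac)
    then have "g (to_vec (u * of_vec x)) = x" by (simp add: uu)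
    ultimately show "x \<in> g ` B" by (metis image_eqI)
  next
    fix x assume "x \<in> g ` B"
    then obtain y where y: "y \<in> B" "x = g y" by auto
    have "u * of_vec x = (u * cnj u) * of_vec y" unfolding y(2) g_def by (simp add: mult_ac)
    then show "x \<in> of_vec -` ((\<lambda>z. u * z) -` box l w)" using y(1) by (simp add: uu flip: B)
  qed
  have op: "(\<lambda>z. u * z) -` box l w \<in> sets borel"
    by (intro borel_open open_vimage continuous_intros) (simp add: open_box)
  then have meas: "g ` B \<in> sets borel" unfolding pre[symmetric]
    using measurable_sets[OF of_vec_measurable, of "(\<lambda>z. u * z) -` box l w"] by simp
  have "emeasure (distr lborel borel (\<lambda>z. u * z)) (box l w) = emeasure (lborel :: complex measure) ((\<lambda>z. u * z) -` box l w)"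
    by (subst emeasure_distr) auto
  also have "\<dots> = emeasure (distr lborel borel of_vec) ((\<lambda>z. u * z) -` box l w)" by (simp add: distr_of_vec)
  also have "\<dots> = emeasure lborel (g ` B)"
    using op pre by (subst emeasure_distr) auto
  also have "\<dots> = ennreal (measure lborel (g ` B))"
  proof -
    have "g ` B \<in> lmeasurable" using orth by (intro measurable_orthogonal_image) (auto simp: B_def)
    then have "emeasure lebesgue (g ` B) \<noteq> \<infinity>" by (auto simp: fmeasurable_def)
    then have "emeasure lborel (g ` B) \<noteq> \<infinity>" using meas by simp
    then show ?thesis by (simp add: emeasure_eq_ennreal_measure)
  qed
  also have "measure lborel (g ` B) = measure lebesgue (g ` B)" using meas by simp
  also have "\<dots> = measure lebesgue B" using orth by (intro measure_orthogonal_image) (auto simp: B_def)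
  also have "\<dots> = measure lborel B" by (simp add: B_def)
  also have "ennreal (measure lborel B) = emeasure lborel (of_vec -` box l w)"
  proof -
    have "emeasure lborel B \<noteq> \<infinity>" unfolding B_def using emeasure_lborel_box_finite less_imp_neq by metis
    then show ?thesis unfolding B infinity_ennreal_def by (rule emeasure_eq_ennreal_measure[symmetric])
  qed
  also have "\<dots> = emeasure (distr lborel borel of_vec) (box l w)" by (subst emeasure_distr) auto
  also have "\<dots> = emeasure lborel (box l w)" by (simp add: distr_of_vec)
  also have "\<dots> = (\<Prod>b\<in>Basis. (w - l) \<bullet> b)" by (rule emeasure_lborel_box[OF lw])
  finally show "emeasure (distr lborel borel (\<lambda>z. u * z)) (box l w) = (\<Prod>b\<in>Basis. (w - l) \<bullet> b)" .
qed simp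

lemma nn_integral_rotation:
  fixes f :: "complex \<Rightarrow> ennreal"
  assumes [measurable]: "f \<in> borel_measurable borel" and u: "norm u = 1"
  shows "(\<integral>\<^sup>+ z. f (u * z) \<partial>lborel) = (\<integral>\<^sup>+ z. f z \<partial>lborel)"
proof -
  have "(\<integral>\<^sup>+ z. f z \<partial>lborel) = (\<integral>\<^sup>+ z. f z \<partial>distr lborel borel (\<lambda>z. u * z))"
    using distr_rotation[OF u] by simp
  also have "\<dots> = (\<integral>\<^sup>+ z. f (u * z) \<partial>lborel)" by (subst nn_integral_distr) auto
  finally show ?thesis by simp
qed

text \<open>A substitute for polar coordinates: averaging rotation invariance over all angles and
  exchanging the integrals reduces integrals over disks to circle means.\<close>

lemma rotation_average:
  fixes f :: "complex \<Rightarrow> ennreal"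
  assumes f[measurable]: "f \<in> borel_measurable borel"
  shows "(\<integral>\<^sup>+ z. f z \<partial>lborel) =
    (\<integral>\<^sup>+ z. (\<integral>\<^sup>+ t. indicator {0..1::real} t * f (cis (2 * pi * t) * z) \<partial>lborel) \<partial>lborel)"
proof -
  have [measurable]: "(\<lambda>p. cis (2 * pi * fst p) * snd p) \<in> borel_measurable (borel :: (real \<times> complex) measure)"
    by (intro borel_measurable_continuous_onI continuous_intros)
  have m: "(\<lambda>(z, t). indicator {0..1::real} t * f (cis (2 * pi * t) * z)) \<in> borel_measurable (lborel \<Otimes>\<^sub>M lborel)"
  proof -
    have "(\<lambda>p. cis (2 * pi * snd p) * fst p) \<in> borel_measurable (borel :: (complex \<times> real) measure)"
      by (intro borel_measurable_continuous_onI continuous_intros)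
    then have [measurable]: "(\<lambda>p. cis (2 * pi * snd p) * fst p) \<in> borel_measurable (lborel \<Otimes>\<^sub>M lborel)"
      by (simp add: lborel_prod)
    show ?thesis unfolding split_beta by measurable
  qed
  have "(\<integral>\<^sup>+ z. (\<integral>\<^sup>+ t. indicator {0..1::real} t * f (cis (2 * pi * t) * z) \<partial>lborel) \<partial>lborel)
      = (\<integral>\<^sup>+ t. (\<integral>\<^sup>+ z. indicator {0..1::real} t * f (cis (2 * pi * t) * z) \<partial>lborel) \<partial>lborel)"
    using lborel_pair.Fubini'[OF m] by simp
  also have "\<dots> = (\<integral>\<^sup>+ t. indicator {0..1::real} t * (\<integral>\<^sup>+ z. f z \<partial>lborel) \<partial>lborel)"
    by (intro nn_integral_cong) (simp add: nn_integral_cmult nn_integral_rotation)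
  also have "\<dots> = (\<integral>\<^sup>+ z. f z \<partial>lborel)" by (simp add: nn_integral_multc)
  finally show ?thesis by simp
qed

lemma set_integrable_ball:
  fixes f :: "complex \<Rightarrow> real"
  assumes "continuous_on (cball x r) f" shows "set_integrable lborel (ball x r) f"
proof (rule set_integrable_subset)
  show "set_integrable lborel (cball x r) f"
    unfolding set_integrable_def by (rule borel_integrable_compact[OF compact_cball assms])
qed auto

text \<open>The rotation average is stated for nonnegative functions, so a bound \<open>K\<close> of
  \<open>f\<close> is added to the integrand and subtracted at the end.\<close>

lemma ball_integral_le_of_circle:
  fixes f :: "complex \<Rightarrow> real"
  assumes f: "continuous_on (cball x r) f" and r: "r > 0"
    and c: "\<And>z. norm z < r \<Longrightarrow> integral {0..1} (\<lambda>t. f (x + cis (2 * pi * t) * z)) \<le> c"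
  shows "(LINT y:ball x r|lborel. f y) \<le> c * measure lborel (ball x r)"
proof -
  obtain K where K: "\<And>y. y \<in> cball x r \<Longrightarrow> norm (f y) \<le> K"
  proof -
    have "bounded (f ` cball x r)" by (intro compact_imp_bounded compact_continuous_image f) simp
    then obtain K where "\<forall>y\<in>cball x r. norm (f y) \<le> K" by (auto simp: bounded_iff)
    then show ?thesis using that by blast
  qed
  have K0: "K \<ge> 0" using K[of x] r norm_ge_zero[of "f x"] by (auto intro: order_trans)
  define F where "F z = indicator (ball 0 r) z * (K + f (x + z))" for z
  have F0: "F z \<ge> 0" for z
    using K[of "x + z"] by (auto simp: F_def dist_norm indicator_def abs_le_iff)
  have contF: "continuous_on (ball 0 r) (\<lambda>z. K + f (x + z))"
    by (intro continuous_intros continuous_on_compose2[OF f]) (auto simp: dist_norm)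
  have Fm[measurable]: "F \<in> borel_measurable borel"
    using borel_measurable_continuous_on_indicator[OF _ contF] by (simp add: F_def[abs_def])
  have cont_t: "continuous_on {0..1} (\<lambda>t. f (x + cis (2 * pi * t) * z))" if "norm z < r" for z
    using that by (intro continuous_on_compose2[OF f] continuous_intros) (auto simp: dist_norm norm_mult)
  have inner: "(\<integral>\<^sup>+ t. indicator {0..1::real} t * ennreal (F (cis (2 * pi * t) * z)) \<partial>lborel)
      \<le> indicator (ball 0 r) z * ennreal (K + c)" for z
  proof (cases "norm z < r")
    case True
    have "((\<lambda>t. F (cis (2 * pi * t) * z)) has_integral (K + integral {0..1} (\<lambda>t. f (x + cis (2 * pi * t) * z)))) {0..1}"
    proof -
      have "((\<lambda>t. f (x + cis (2 * pi * t) * z)) has_integral integral {0..1} (\<lambda>t. f (x + cis (2 * pi * t) * z))) {0..1}"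
        by (intro integrable_integral integrable_continuous_real cont_t True)
      from has_integral_add[OF has_integral_const_real[of K 0 1] this] show ?thesis
        using True by (auto simp: F_def norm_mult)
    qed
    then have "(\<integral>\<^sup>+ t. indicator {0..1::real} t * F (cis (2 * pi * t) * z) \<partial>lborel) = ennreal (K + integral {0..1} (\<lambda>t. f (x + cis (2 * pi * t) * z)))"
      using F0 by (intro nn_integral_has_integral_lebesgue) auto
    also have "(\<integral>\<^sup>+ t. indicator {0..1::real} t * F (cis (2 * pi * t) * z) \<partial>lborel) = (\<integral>\<^sup>+ t. indicator {0..1::real} t * ennreal (F (cis (2 * pi * t) * z)) \<partial>lborel)"
      by (intro nn_integral_cong) (auto simp: indicator_def)
    finally show ?thesis using c[OF True] True by (simp add: ennreal_leI)
  next
    case False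
    then have "F (cis (2 * pi * t) * z) = 0" for t by (simp add: F_def norm_mult)
    then show ?thesis by simp
  qed
  \<comment> \<open>The degenerate circle \<open>z = 0\<close> gives
    \<open>f x \<le> c\<close>.\<close>
  have Kc: "K + c \<ge> 0"
  proof -
    have "- K \<le> f x" using K[of x] r by (auto simp: abs_le_iff)
    then show ?thesis using c[of 0] r by simp
  qed
  have fin: "emeasure lborel (ball 0 r :: complex set) = ennreal (measure lborel (ball 0 r :: complex set))"
    by (rule emeasure_eq_ennreal_measure) (use emeasure_lborel_ball_finite in \<open>auto simp: less_top[symmetric]\<close>)
  have "(\<integral>\<^sup>+ z. F z \<partial>lborel) \<le> (\<integral>\<^sup>+ z. indicator (ball (0::complex) r) z * ennreal (K + c) \<partial>lborel)"
  proof -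
    have "(\<integral>\<^sup>+ z. F z \<partial>lborel) =
        (\<integral>\<^sup>+ z. (\<integral>\<^sup>+ t. indicator {0..1::real} t * ennreal (F (cis (2 * pi * t) * z)) \<partial>lborel) \<partial>lborel)"
      by (rule rotation_average) measurable
    also have "\<dots> \<le> (\<integral>\<^sup>+ z. indicator (ball (0::complex) r) z * ennreal (K + c) \<partial>lborel)"
      by (intro nn_integral_mono) (simp only: inner)
    finally show ?thesis .
  qed
  also have "\<dots> = (\<integral>\<^sup>+ z. indicator (ball (0::complex) r) z \<partial>lborel) * ennreal (K + c)"
    by (rule nn_integral_multc) (auto intro!: borel_measurable_indicator)
  also have "(\<integral>\<^sup>+ z. indicator (ball (0::complex) r) z \<partial>lborel) = emeasure lborel (ball 0 r :: complex set)"
    by (rule nn_integral_indicator) simp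
  also have "\<dots> = ennreal (measure lborel (ball 0 r :: complex set))" by (rule fin)
  also have "ennreal (measure lborel (ball 0 r :: complex set)) * ennreal (K + c)
      = ennreal (measure lborel (ball 0 r :: complex set) * (K + c))"
    using Kc by (simp add: ennreal_mult)
  finally have le: "(\<integral>\<^sup>+ z. F z \<partial>lborel) \<le> ennreal (measure lborel (ball 0 r :: complex set) * (K + c))" .
  then have int: "integrable lborel F"
    using F0 by (intro integrableI_nonneg) (auto simp: top.extremum_strict le_less_trans)
  have "ennreal (integral\<^sup>L lborel F) = (\<integral>\<^sup>+ z. F z \<partial>lborel)"
    using F0 int by (intro nn_integral_eq_integral[symmetric]) auto
  with le have "ennreal (integral\<^sup>L lborel F) \<le> ennreal (measure lborel (ball 0 r :: complex set) * (K + c))"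
    by simp
  moreover have "measure lborel (ball 0 r :: complex set) * (K + c) \<ge> 0"
    using Kc measure_nonneg by (intro mult_nonneg_nonneg)
  ultimately have "integral\<^sup>L lborel F \<le> measure lborel (ball 0 r :: complex set) * (K + c)"
    by (simp only: ennreal_le_iff)
  moreover have "integral\<^sup>L lborel F = (LINT y:ball x r|lborel. (K + f y))"
  proof -
    define G where "G y = indicator (ball x r) y *\<^sub>R (K + f y)" for y
    have [measurable]: "G \<in> borel_measurable borel"
      unfolding G_def[abs_def]
      by (intro borel_measurable_continuous_on_indicator continuous_intros continuous_on_subset[OF f]) auto
    have "integral\<^sup>L lborel G = integral\<^sup>L (distr lborel borel ((+) x)) G" by (simp add: lborel_distr_plus)
    also have "\<dots> = integral\<^sup>L lborel (\<lambda>z. G (x + z))" by (subst integral_distr) auto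
    also have "(\<lambda>z. G (x + z)) = F" by (auto simp: G_def F_def fun_eq_iff indicator_def dist_norm)
    finally show ?thesis by (simp add: set_lebesgue_integral_def G_def)
  qed
  moreover have "(LINT y:ball x r|lborel. (K + f y)) = K * measure lborel (ball x r) + (LINT y:ball x r|lborel. f y)"
  proof -
    have "set_integrable lborel (ball x r) f" by (rule set_integrable_ball[OF f])
    moreover have "set_integrable lborel (ball x r) (\<lambda>_. K)" by (rule set_integrable_ball) auto
    ultimately have "(LINT y:ball x r|lborel. (K + f y)) = (LINT y:ball x r|lborel. K) + (LINT y:ball x r|lborel. f y)"
      by (intro set_integral_add)
    then show ?thesis by (simp add: set_lebesgue_integral_def mult.commute)
  qed
  moreover have "measure lborel (ball 0 r :: complex set) = measure lborel (ball x r)"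
    using r by (simp add: content_ball)
  ultimately show ?thesis by (simp add: algebra_simps)
qed

section \<open>Functions with the super-mean-value property\<close>

text \<open>Cauchy's formula on the circle of radius \<open>norm z\<close>; the rotation by
  \<open>u\<close> moves the starting point of the standard parametrisation to
  \<open>x + z\<close>.\<close>

lemma circle_mean_holomorphic:
  assumes f: "f holomorphic_on ball x R" and z: "norm z < R"
  shows "((\<lambda>t. f (x + cis (2 * pi * t) * z)) has_integral f x) {0..1}"
proof (cases "z = 0")
  case True
  then show ?thesis using has_integral_const_real[of "f x" 0 1] by simp
next
  case False
  define \<rho> where "\<rho> = norm z"
  have \<rho>: "\<rho> > 0" using False by (simp add: \<rho>_def)
  define u where "u = z / of_real \<rho>"
  have u: "norm u = 1" "u * of_real \<rho> = z" using \<rho> by (auto simp: u_def \<rho>_def norm_divide)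
  define g where "g w = f (x + (w - x) * u)" for w
  have "g holomorphic_on cball x \<rho>"
    unfolding g_def
  proof (rule holomorphic_on_compose_gen[where f="\<lambda>w. x + (w - x) * u" and g=f and t="ball x R", unfolded o_def])
    show "(\<lambda>w. x + (w - x) * u) ` cball x \<rho> \<subseteq> ball x R"
      using u z by (auto simp: dist_norm norm_mult \<rho>_def norm_minus_commute)
  qed (auto intro!: holomorphic_intros f)
  then have "((\<lambda>w. g w / (w - x)) has_contour_integral (2 * of_real pi * \<i> * g x)) (circlepath x \<rho>)"
    using \<rho> by (intro Cauchy_integral_circlepath_simple) auto
  then have "((\<lambda>t. g (circlepath x \<rho> t) / (circlepath x \<rho> t - x) * vector_derivative (circlepath x \<rho>) (at t))
      has_integral (2 * of_real pi * \<i> * g x)) {0..1}"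
    by (simp add: has_contour_integral)
  then have "((\<lambda>t. 2 * of_real pi * \<i> * f (x + cis (2 * pi * t) * z)) has_integral (2 * of_real pi * \<i> * g x)) {0..1}"
  proof (rule has_integral_eq[rotated])
    fix t :: real
    have c: "circlepath x \<rho> t = x + of_real \<rho> * cis (2 * pi * t)"
      by (simp add: circlepath cis_conv_exp mult_ac)
    have e: "exp (2 * of_real pi * \<i> * of_real t) = cis (2 * pi * t)"
      by (simp add: cis_conv_exp mult_ac)
    have "g (circlepath x \<rho> t) = f (x + cis (2 * pi * t) * z)"
      unfolding g_def c u(2)[symmetric] by (simp add: mult_ac)
    then show "g (circlepath x \<rho> t) / (circlepath x \<rho> t - x) * vector_derivative (circlepath x \<rho>) (at t)
        = 2 * of_real pi * \<i> * f (x + cis (2 * pi * t) * z)"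
      using \<rho> by (simp add: vector_derivative_circlepath e c)
  qed
  from has_integral_mult_right[OF this, of "inverse (2 * of_real pi * \<i>)"] show ?thesis
    by (simp add: g_def field_simps)
qed

lemma circle_mean_harmonic:
  assumes f: "f holomorphic_on ball x R" and z: "norm z < R"
  shows "integral {0..1} (\<lambda>t. Re (f (x + cis (2 * pi * t) * z))) = Re (f x)"
  using has_integral_linear[OF circle_mean_holomorphic[OF assms] bounded_linear_Re] by (simp add: o_def integral_unique)

lemma continuous_on_circle:
  fixes f :: "complex \<Rightarrow> 'a::topological_space"
  assumes "continuous_on (cball x r) f" "norm z \<le> r"
  shows "continuous_on {0..1} (\<lambda>t. f (x + cis (2 * pi * t) * z))"
  using assms(2) by (intro continuous_on_compose2[OF assms(1)] continuous_intros) (auto simp: dist_norm norm_mult)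

lemma ball_integral_le_of_touching:
  fixes f :: "complex \<Rightarrow> real"
  assumes f: "continuous_on (cball x r) f" and r: "0 < r" "r < R" and g: "g holomorphic_on ball x R"
    and le: "\<And>y. y \<in> ball x R \<Longrightarrow> f y \<le> Re (g y)" 
  shows "(LINT y:ball x r|lborel. f y) \<le> Re (g x) * measure lborel (ball x r)"
proof (rule ball_integral_le_of_circle[OF f r(1)])
  fix z :: complex assume z: "norm z < r"
  have "cball x r \<subseteq> ball x R" using r by auto
  then have cg: "continuous_on (cball x r) (\<lambda>y. Re (g y))"
    using g by (intro continuous_intros holomorphic_on_imp_continuous_on) (auto intro: holomorphic_on_subset)
  have "integral {0..1} (\<lambda>t. f (x + cis (2 * pi * t) * z)) \<le> integral {0..1} (\<lambda>t. Re (g (x + cis (2 * pi * t) * z)))"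
    using z r by (intro integral_le integrable_continuous_real continuous_on_circle[OF f] continuous_on_circle[OF cg] le)
      (auto simp: dist_norm norm_mult)
  also have "\<dots> = Re (g x)" using z r by (intro circle_mean_harmonic[OF g]) auto
  finally show "integral {0..1} (\<lambda>t. f (x + cis (2 * pi * t) * z)) \<le> Re (g x)" .
qed

lemma ball_mean_harmonic:
  assumes r: "0 < r" "r < R" and g: "g holomorphic_on ball x R"
  shows "(LINT y:ball x r|lborel. Re (g y)) = Re (g x) * measure lborel (ball x r)"
proof -
  have "cball x r \<subseteq> ball x R" using r by auto
  then have c: "continuous_on (cball x r) (\<lambda>y. Re (g y))"
    using g by (intro continuous_intros holomorphic_on_imp_continuous_on) (auto intro: holomorphic_on_subset)
  have "(LINT y:ball x r|lborel. Re (g y)) \<le> Re (g x) * measure lborel (ball x r)"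
    by (rule ball_integral_le_of_touching[OF c r g]) simp
  moreover have "(LINT y:ball x r|lborel. - Re (g y)) \<le> Re (- g x) * measure lborel (ball x r)"
    by (rule ball_integral_le_of_touching[where g="\<lambda>y. - g y", OF _ r]) (use c g in \<open>auto intro!: continuous_intros holomorphic_intros\<close>)
  moreover have "(LINT y:ball x r|lborel. - Re (g y)) = - (LINT y:ball x r|lborel. Re (g y))"
    by (simp add: set_lebesgue_integral_def)
  ultimately show ?thesis by simp
qed

text \<open>Integrability is part of the condition because the integral of a nonintegrable function
  is \<open>0\<close> by default.\<close>

definition locally_supermean :: "(complex \<Rightarrow> real) \<Rightarrow> complex \<Rightarrow> bool" where
  "locally_supermean f x \<longleftrightarrow> (\<exists>\<delta>>0. \<forall>r. 0 < r \<longrightarrow> r < \<delta> \<longrightarrow>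
     set_integrable lborel (ball x r) f \<and> (LINT y:ball x r|lborel. f y) \<le> f x * measure lborel (ball x r))"

definition supermean :: "(complex \<Rightarrow> real) \<Rightarrow> bool" where
  "supermean f \<longleftrightarrow> continuous_on UNIV f \<and>
     (\<forall>x r. 0 < r \<longrightarrow> (LINT y:ball x r|lborel. f y) \<le> f x * measure lborel (ball x r))"

lemma supermean_imp_locally: "supermean f \<Longrightarrow> locally_supermean f x"
  unfolding supermean_def locally_supermean_def
  by (intro exI[of _ 1]) (auto intro!: set_integrable_ball intro: continuous_on_subset)

text \<open>The basic test in place of Laplacians: a function below a harmonic one that it touches
  at \<open>x\<close> has ball means at most the common value there. It also works at points where
  \<open>f\<close> is not smooth.\<close>

lemma locally_supermean_touching:
  assumes f: "continuous_on (ball x R) f" and R: "R > 0" and g: "g holomorphic_on ball x R"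
    and le: "\<And>y. y \<in> ball x R \<Longrightarrow> f y \<le> Re (g y)" and eq: "f x = Re (g x)"
  shows "locally_supermean f x"
  unfolding locally_supermean_def
proof (intro exI[of _ R] conjI allI impI R)
  fix r assume r: "0 < r" "r < R"
  have "cball x r \<subseteq> ball x R" using r by auto
  then have f': "continuous_on (cball x r) f" using f continuous_on_subset by blast
  then show "set_integrable lborel (ball x r) f" by (rule set_integrable_ball)
  show "(LINT y:ball x r|lborel. f y) \<le> f x * measure lborel (ball x r)"
    using ball_integral_le_of_touching[OF f' r g le] eq by simp
qed

lemma locally_supermean_add:
  assumes "locally_supermean f x" "locally_supermean g x"
  shows "locally_supermean (\<lambda>y. f y + g y) x"
proof -
  obtain d where d: "d > 0" "\<And>r. 0 < r \<Longrightarrow> r < d \<Longrightarrow> set_integrable lborel (ball x r) f \<and> (LINT y:ball x r|lborel. f y) \<le> f x * measure lborel (ball x r)"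
    using assms(1) by (auto simp: locally_supermean_def)
  obtain e where e: "e > 0" "\<And>r. 0 < r \<Longrightarrow> r < e \<Longrightarrow> set_integrable lborel (ball x r) g \<and> (LINT y:ball x r|lborel. g y) \<le> g x * measure lborel (ball x r)"
    using assms(2) by (auto simp: locally_supermean_def)
  show ?thesis unfolding locally_supermean_def
  proof (intro exI[of _ "min d e"] conjI allI impI)
    fix r assume r: "0 < r" "r < min d e"
    then have i: "set_integrable lborel (ball x r) f" "set_integrable lborel (ball x r) g"
      using d(2)[of r] e(2)[of r] by auto
    then show "set_integrable lborel (ball x r) (\<lambda>y. f y + g y)" by (rule set_integral_add)
    show "(LINT y:ball x r|lborel. f y + g y) \<le> (f x + g x) * measure lborel (ball x r)"
      using set_integral_add(2)[OF i] d(2)[of r] e(2)[of r] r by (simp add: distrib_right)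
  qed (use d e in auto)
qed

lemma locally_supermean_sum:
  assumes "finite A" "\<And>i. i \<in> A \<Longrightarrow> locally_supermean (f i) x"
  shows "locally_supermean (\<lambda>y. \<Sum>i\<in>A. f i y) x"
  using assms
proof (induction A rule: finite_induct)
  case empty
  show ?case by (simp add: locally_supermean_def set_integrable_def set_lebesgue_integral_def) (rule exI[of _ 1], simp)
qed (simp add: locally_supermean_add)

lemma locally_supermean_Re:
  assumes "g holomorphic_on ball x R" "R > 0"
  shows "locally_supermean (\<lambda>y. Re (g y)) x"
  by (rule locally_supermean_touching[OF _ assms(2,1)])
     (use assms in \<open>auto intro!: continuous_intros holomorphic_on_imp_continuous_on\<close>)

lemma zero_on_ball_of_integral:
  fixes f :: "complex \<Rightarrow> real"
  assumes f: "continuous_on (ball x r) f" and f0: "\<And>y. y \<in> ball x r \<Longrightarrow> f y \<ge> 0"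
    and i: "set_integrable lborel (ball x r) f" and 0: "(LINT y:ball x r|lborel. f y) \<le> 0" and y: "y \<in> ball x r"
  shows "f y = 0"
proof (rule ccontr)
  assume "f y \<noteq> 0"
  have "integral\<^sup>L lborel (\<lambda>y. indicator (ball x r) y *\<^sub>R f y) \<ge> 0"
    by (rule integral_nonneg_AE) (use f0 in \<open>auto simp: indicator_def\<close>)
  then have "integral\<^sup>L lborel (\<lambda>y. indicator (ball x r) y *\<^sub>R f y) = 0"
    using 0 by (simp add: set_lebesgue_integral_def)
  then have "AE y in lborel. indicator (ball x r) y *\<^sub>R f y = 0"
    using i by (subst (asm) integral_nonneg_eq_0_iff_AE) (use f0 in \<open>auto simp: indicator_def set_integrable_def\<close>)
  then obtain N where N: "{y. \<not> indicator (ball x r) y *\<^sub>R f y = 0} \<subseteq> N" "N \<in> null_sets lborel"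
    by (auto simp: eventually_ae_filter)
  have "open (ball x r \<inter> f -` (- {0}))"
    by (rule continuous_open_preimage[OF f]) auto
  moreover have "y \<in> ball x r \<inter> f -` (- {0})" using y \<open>f y \<noteq> 0\<close> by auto
  ultimately obtain e where e: "e > 0" "ball y e \<subseteq> ball x r \<inter> f -` (- {0})"
    using open_contains_ball by blast
  have "ball y e \<subseteq> N"
  proof
    fix u assume "u \<in> ball y e"
    then have "u \<in> ball x r" "f u \<noteq> 0" using e(2) by auto
    then have "\<not> indicator (ball x r) u *\<^sub>R f u = 0" by simp
    then show "u \<in> N" using N(1) by blast
  qed
  then have "emeasure lborel (ball y e) \<le> emeasure lborel N"
    using N(2) by (intro emeasure_mono) auto
  then have "emeasure lborel (ball y e) = 0" using N(2) by (simp add: null_setsD1)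
  then have "measure lborel (ball y e) = 0" by (simp add: measure_def)
  then show False using content_ball_pos[OF e(1), of y] by simp
qed

text \<open>The points where the minimum is attained form a relatively closed set by continuity and
  a relatively open one by the super-mean property. So a negative minimum would be taken on the
  whole ball and, by continuity, on the sphere.\<close>

lemma minimum_principle:
  fixes f :: "complex \<Rightarrow> real"
  assumes f: "continuous_on (cball x R) f" and R: "R > 0"
    and sm: "\<And>y. y \<in> ball x R \<Longrightarrow> locally_supermean f y"
    and bd: "\<And>y. y \<in> sphere x R \<Longrightarrow> f y \<ge> 0" and y: "y \<in> cball x R"
  shows "f y \<ge> 0"
proof (rule ccontr)
  assume neg: "\<not> f y \<ge> 0"
  obtain m where m: "m \<in> cball x R" "\<And>y. y \<in> cball x R \<Longrightarrow> f m \<le> f y"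
    using continuous_attains_inf[OF compact_cball _ f] R by auto
  have fm: "f m < 0" using m(2)[OF y] neg by simp
  define Z where "Z = {y \<in> ball x R. f y = f m}"
  have mZ: "m \<in> Z" using m(1) fm bd[of m] by (force simp: Z_def)
  have cf: "continuous_on (ball x R) f" using f by (rule continuous_on_subset) auto
  have "openin (top_of_set (ball x R)) Z"
    unfolding openin_contains_ball
  proof (intro conjI ballI)
    fix z assume z: "z \<in> Z"
    then have zB: "z \<in> ball x R" and fz: "f z = f m" by (auto simp: Z_def)
    obtain d where d: "d > 0" "\<And>r. 0 < r \<Longrightarrow> r < d \<Longrightarrow> set_integrable lborel (ball z r) f \<and> (LINT y:ball z r|lborel. f y) \<le> f z * measure lborel (ball z r)"
      using sm[OF zB] by (auto simp: locally_supermean_def)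
    define r where "r = min (d / 2) (R - dist x z)"
    have r: "r > 0" "r < d" "r \<le> R - dist x z" using d(1) zB by (auto simp: r_def)
    have sub: "ball z r \<subseteq> ball x R"
    proof
      fix u assume "u \<in> ball z r"
      then have "dist x u < R" using dist_triangle[of x u z] r(3) by simp
      then show "u \<in> ball x R" by simp
    qed
    have iF: "set_integrable lborel (ball z r) f" and lF: "(LINT y:ball z r|lborel. f y) \<le> f z * measure lborel (ball z r)"
      using d(2)[OF r(1,2)] by auto
    have ic: "set_integrable lborel (ball z r) (\<lambda>_. f m)"
      by (rule set_integrable_ball) auto
    have "f u - f m = 0" if "u \<in> ball z r" for u
    proof (rule zero_on_ball_of_integral[where x=z and r=r and f="\<lambda>u. f u - f m"])
      show "continuous_on (ball z r) (\<lambda>u. f u - f m)"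
        by (intro continuous_intros continuous_on_subset[OF cf sub])
      show "f u - f m \<ge> 0" if "u \<in> ball z r" for u using m(2)[of u] that sub by fastforce
      show "set_integrable lborel (ball z r) (\<lambda>u. f u - f m)" using iF ic by (rule set_integral_diff)
      have "(LINT u:ball z r|lborel. f u - f m) = (LINT u:ball z r|lborel. f u) - (LINT u:ball z r|lborel. f m)"
        using iF ic by (rule set_integral_diff)
      also have "(LINT u:ball z r|lborel. f m) = f m * measure lborel (ball z r)"
        by (simp add: set_lebesgue_integral_def mult.commute)
      finally show "(LINT u:ball z r|lborel. f u - f m) \<le> 0" using lF fz by simp
    qed (rule that)
    then have "ball z r \<subseteq> Z" using sub by (auto simp: Z_def)
    then show "\<exists>e>0. ball z e \<inter> ball x R \<subseteq> Z" using r(1) by blast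
  qed (auto simp: Z_def)
  moreover have "closedin (top_of_set (ball x R)) Z"
    unfolding Z_def using continuous_closedin_preimage_constant[OF cf] by simp
  ultimately have "Z = {} \<or> Z = ball x R"
    using connected_ball[of x R] unfolding connected_clopen by blast
  then have "Z = ball x R" using mZ by blast
  then have all: "f u = f m" if "u \<in> ball x R" for u
  proof -
    have "u \<in> Z" using that \<open>Z = ball x R\<close> by blast
    then show ?thesis by (simp add: Z_def)
  qed
  define s where "s = x + of_real R"
  have s: "s \<in> sphere x R" using R by (simp add: s_def dist_norm)
  have "f s = f m"
  proof (rule continuous_constant_on_closure[where S="ball x R" and f=f])
    show "continuous_on (closure (ball x R)) f" using f R by simp
    show "s \<in> closure (ball x R)" using s R by simp
  qed (rule all)
  then show False using bd[OF s] fm by simp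
qed

section \<open>Harmonic polynomials on circles; from local to global super-mean inequalities\<close>

lemma Re_of_real_mult: "Re (of_real r * z) = r * Re z"
  by simp

text \<open>On the circle \<open>z * cnj z\<close> is the constant \<open>R\<^sup>2\<close>, so
  mixed products reduce to powers of \<open>z\<close> and powers of \<open>cnj z\<close>, and
  conjugating the latter does not change the real part. The induction peels one coefficient off each
  factor.\<close>

lemma harmonic_product_on_circle:
  "\<exists>h :: complex poly. \<forall>z. norm z = R \<longrightarrow> Re (poly p z * cnj (poly q z)) = Re (poly h z)"
proof (induction p arbitrary: q)
  case 0
  show ?case by (rule exI[of _ 0]) simp
next
  case (pCons a p)
  obtain b q' where q: "q = pCons b q'" by (cases q) auto
  obtain h' where h': "\<And>z. norm z = R \<Longrightarrow> Re (poly p z * cnj (poly q' z)) = Re (poly h' z)"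
    using pCons.IH[of q'] by blast
  define h where "h = smult (cnj a) q + smult (cnj b) (pCons 0 p) + smult (of_real (R\<^sup>2)) h'"
  have "Re (poly (pCons a p) z * cnj (poly q z)) = Re (poly h z)" if z: "norm z = R" for z
  proof -
    have zz: "z * cnj z = of_real (R\<^sup>2)" using z by (simp add: complex_norm_square[symmetric])
    have "poly (pCons a p) z * cnj (poly q z) = a * cnj (poly q z) + cnj b * (z * poly p z) + (z * cnj z) * (poly p z * cnj (poly q' z))"
      by (simp add: q algebra_simps)
    then have 1: "Re (poly (pCons a p) z * cnj (poly q z)) = Re (a * cnj (poly q z)) + Re (cnj b * (z * poly p z)) + R\<^sup>2 * Re (poly p z * cnj (poly q' z))"
      unfolding zz by (simp only: plus_complex.sel Re_of_real_mult)
    have "poly h z = cnj a * poly q z + cnj b * (z * poly p z) + of_real (R\<^sup>2) * poly h' z"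
      by (simp add: h_def)
    then have 2: "Re (poly h z) = Re (cnj a * poly q z) + Re (cnj b * (z * poly p z)) + R\<^sup>2 * Re (poly h' z)"
      by (simp only: plus_complex.sel Re_of_real_mult)
    have "Re (a * cnj (poly q z)) = Re (cnj a * poly q z)" by simp
    then show ?thesis using 1 2 h'[OF z] by simp
  qed
  then show ?case by blast
qed

text \<open>Real parts of polynomials form an algebra on the circle, so Stone-Weierstrass applies.
  As they are harmonic inside, this solves the Dirichlet problem up to \<open>e\<close>.\<close>

lemma harmonic_approximation:
  fixes f :: "complex \<Rightarrow> real"
  assumes f: "continuous_on (sphere x R) f" and e: "e > 0"
  shows "\<exists>p :: complex poly. \<forall>y \<in> sphere x R. \<bar>f y - Re (poly p (y - x))\<bar> < e"
proof -
  define P where "P f \<longleftrightarrow> (\<exists>p :: complex poly. \<forall>y\<in>sphere x R. f y = Re (poly p (y - x)))" for f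
  have "\<exists>g. P g \<and> (\<forall>y\<in>sphere x R. \<bar>f y - g y\<bar> < e)"
  proof (rule Stone_Weierstrass_HOL[OF compact_sphere _ _ _ _ _ f e])
    show "P (\<lambda>x. c)" for c
      unfolding P_def by (rule exI[of _ "[:of_real c:]"]) simp
    show "continuous_on (sphere x R) f" if Pf: "P f" for f
    proof -
      obtain p :: "complex poly" where p: "\<forall>y\<in>sphere x R. f y = Re (poly p (y - x))" using Pf unfolding P_def by blast
      have "continuous_on (sphere x R) (\<lambda>y. Re (poly p (y - x)))" by (intro continuous_intros)
      then show ?thesis by (rule continuous_on_eq) (use p in simp)
    qed
    show "P (\<lambda>x. f x + g x)" if Pfg: "P f \<and> P g" for f g
    proof -
      obtain p q :: "complex poly" where "\<forall>y\<in>sphere x R. f y = Re (poly p (y - x))" "\<forall>y\<in>sphere x R. g y = Re (poly q (y - x))"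
        using Pfg unfolding P_def by blast
      then show ?thesis unfolding P_def by (intro exI[of _ "p + q"]) auto
    qed
    show "P (\<lambda>x. f x * g x)" if Pfg: "P f \<and> P g" for f g
    proof -
      obtain p q :: "complex poly" where pq: "\<forall>y\<in>sphere x R. f y = Re (poly p (y - x))" "\<forall>y\<in>sphere x R. g y = Re (poly q (y - x))"
        using Pfg unfolding P_def by blast
      obtain h where h: "\<And>z. norm z = R \<Longrightarrow> Re (poly p z * cnj (poly q z)) = Re (poly h z)"
        using harmonic_product_on_circle by blast
      \<comment> \<open>\<open>Re u * Re v\<close> is half of
        \<open>Re (u * v + u * cnj v)\<close>.\<close>
      have "f y * g y = Re (poly (smult (1/2) (p * q + h)) (y - x))" if y: "y \<in> sphere x R" for y
      proof -
        have "norm (y - x) = R" using y by (simp add: dist_norm norm_minus_commute)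
        from h[OF this] show ?thesis using pq y by simp
      qed
      then show ?thesis unfolding P_def by blast
    qed
    show "\<exists>f. P f \<and> f a \<noteq> f b" if ab: "a \<in> sphere x R \<and> b \<in> sphere x R \<and> a \<noteq> b" for a b
    proof (cases "Re a = Re b")
      case False
      have "P (\<lambda>y. Re (y - x))" unfolding P_def by (rule exI[of _ "[:0, 1:]"]) simp
      then show ?thesis using False by (intro exI[of _ "\<lambda>y. Re (y - x)"]) simp
    next
      case True
      then have "Im a \<noteq> Im b" using ab by (simp add: complex_eq_iff)
      moreover have "P (\<lambda>y. Im (y - x))" unfolding P_def by (rule exI[of _ "[:0, -\<i>:]"]) simp
      ultimately show ?thesis by (intro exI[of _ "\<lambda>y. Im (y - x)"]) simp
    qed
  qed
  then obtain g and p :: "complex poly" where "\<forall>y\<in>sphere x R. \<bar>f y - g y\<bar> < e" "\<forall>y\<in>sphere x R. g y = Re (poly p (y - x))"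
    unfolding P_def by blast
  then show ?thesis by (intro exI[of _ p]) simp
qed

lemma locally_supermean_poly: "locally_supermean (\<lambda>y. Re (poly p (y - x))) z" for p :: "complex poly"
  by (rule locally_supermean_Re[where R=1]) (auto intro!: holomorphic_intros)

text \<open>On the circle of radius \<open>norm z\<close> around \<open>x\<close> a harmonic
  polynomial lies between \<open>f - e\<close> and \<open>f\<close>. By the minimum principle, which
  uses only the local property, its value at \<open>x\<close> is at most \<open>f x\<close>, and
  this value is its circle mean.\<close>

lemma supermean_of_local:
  assumes f: "continuous_on UNIV f" and sm: "\<And>x. locally_supermean f x"
  shows "supermean f"
  unfolding supermean_def
proof (intro conjI f allI impI)
  fix x :: complex and r :: real assume r: "0 < r"
  have cf: "continuous_on A f" for A using f continuous_on_subset by blast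
  show "(LINT y:ball x r|lborel. f y) \<le> f x * measure lborel (ball x r)"
  proof (rule ball_integral_le_of_circle[OF cf r])
    fix z :: complex assume "norm z < r"
    define I where "I = integral {0..1} (\<lambda>t. f (x + cis (2 * pi * t) * z))"
    show "I \<le> f x"
    proof (cases "z = 0")
      case True then show ?thesis by (simp add: I_def)
    next
      case False
      show ?thesis
      proof (rule field_le_epsilon)
        fix e :: real assume e: "e > 0"
        define R where "R = norm z"
        have R: "R > 0" using False by (simp add: R_def)
        \<comment> \<open>Approximating \<open>f - e/2\<close> up to \<open>e/2\<close> makes the
          approximation one-sided.\<close>
        have "\<exists>p :: complex poly. \<forall>y\<in>sphere x R. \<bar>(f y - e/2) - Re (poly p (y - x))\<bar> < e/2"
          using e by (intro harmonic_approximation continuous_intros cf) simp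
        then obtain p :: "complex poly" where p: "\<forall>y\<in>sphere x R. \<bar>(f y - e/2) - Re (poly p (y - x))\<bar> < e/2"
          by blast
        have "f x - Re (poly p (x - x)) \<ge> 0"
        proof (rule minimum_principle[where f="\<lambda>y. f y - Re (poly p (y - x))" and R=R and x=x])
          show "continuous_on (cball x R) (\<lambda>y. f y - Re (poly p (y - x)))" by (intro continuous_intros cf)
          show "locally_supermean (\<lambda>y. f y - Re (poly p (y - x))) y" for y
            using locally_supermean_add[OF sm locally_supermean_poly[of "- p"]] by simp
          show "f y - Re (poly p (y - x)) \<ge> 0" if "y \<in> sphere x R" for y
            using p that by (force simp: abs_if split: if_splits)
        qed (use R in auto)
        moreover have "Re (poly p (x - x)) = integral {0..1} (\<lambda>t. Re (poly p (x + cis (2 * pi * t) * z - x)))"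
          by (rule circle_mean_harmonic[symmetric, where R="norm z + 1"]) (auto intro!: holomorphic_intros)
        moreover have "I - e \<le> integral {0..1} (\<lambda>t. Re (poly p (x + cis (2 * pi * t) * z - x)))"
        proof -
          have ci: "(\<lambda>t. f (x + cis (2 * pi * t) * z)) integrable_on {0..1}"
            by (intro integrable_continuous_real continuous_on_compose2[OF f] continuous_intros) auto
          have "I - e = integral {0..1} (\<lambda>t. f (x + cis (2 * pi * t) * z) - e)"
            unfolding I_def using ci by (subst integral_diff) auto
          also have "\<dots> \<le> integral {0..1} (\<lambda>t. Re (poly p (x + cis (2 * pi * t) * z - x)))"
          proof (rule integral_le)
            show "(\<lambda>t. f (x + cis (2 * pi * t) * z) - e) integrable_on {0..1}" using ci by (intro integrable_diff) auto
            show "(\<lambda>t. Re (poly p (x + cis (2 * pi * t) * z - x))) integrable_on {0..1}"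
              by (intro integrable_continuous_real continuous_intros)
            fix t :: real
            have "x + cis (2 * pi * t) * z \<in> sphere x R" by (simp add: dist_norm norm_mult R_def)
            with p have "\<bar>(f (x + cis (2 * pi * t) * z) - e/2) - Re (poly p (x + cis (2 * pi * t) * z - x))\<bar> < e/2" by blast
            then show "f (x + cis (2 * pi * t) * z) - e \<le> Re (poly p (x + cis (2 * pi * t) * z - x))" by linarith
          qed
          finally show ?thesis .
        qed
        ultimately show "I \<le> f x + e" by simp
      qed
    qed
  qed
qed

section \<open>The logarithmic potential of a disk\<close>

lemma emeasure_disk: "r \<ge> 0 \<Longrightarrow> emeasure lborel (ball (c::complex) r) = ennreal (pi * r\<^sup>2)"
  by (simp add: emeasure_ball unit_ball_vol_2)

lemma emeasure_closed_disk: "r \<ge> 0 \<Longrightarrow> emeasure lborel (cball (c::complex) r) = ennreal (pi * r\<^sup>2)"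
  by (simp add: emeasure_cball unit_ball_vol_2)

lemma measure_disk: "r \<ge> 0 \<Longrightarrow> measure lborel (ball (c::complex) r) = pi * r\<^sup>2"
  by (simp add: measure_def emeasure_disk)

lemma circle_mean_ln_aux:
  assumes "norm z < norm X"
  shows "((\<lambda>t. ln (norm (1 - cis (2 * pi * t) * z / X))) has_integral 0) {0..1}"
proof -
  have X: "X \<noteq> 0" using assms by auto
  have pos: "Re (1 - w / X) > 0" if "norm w < norm X" for w
  proof -
    have "norm (w / X) < 1" using that X by (simp add: norm_divide)
    then show ?thesis using abs_Re_le_cmod[of "w / X"] by simp
  qed
  have "(\<lambda>w. Ln (1 - w / X)) holomorphic_on ball 0 (norm X)"
    using pos by (intro holomorphic_intros) (auto simp: complex_nonpos_Reals_iff X dest!: pos)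
  from circle_mean_holomorphic[OF this assms]
  have "((\<lambda>t. Ln (1 - cis (2 * pi * t) * z / X)) has_integral 0) {0..1}" by simp
  from has_integral_linear[OF this bounded_linear_Re]
  have "((\<lambda>t. Re (Ln (1 - cis (2 * pi * t) * z / X))) has_integral 0) {0..1}" by (simp add: o_def)
  then show ?thesis
  proof (rule has_integral_eq[rotated])
    fix t :: real
    have "norm (cis (2 * pi * t) * z) < norm X" using assms by (simp add: norm_mult)
    then have "1 - cis (2 * pi * t) * z / X \<noteq> 0" using pos by fastforce
    then show "Re (Ln (1 - cis (2 * pi * t) * z / X)) = ln (norm (1 - cis (2 * pi * t) * z / X))" by simp
  qed
qed

text \<open>For \<open>norm z < norm X\<close> the logarithm of \<open>norm (1 - w / X)\<close> is
  harmonic with value \<open>0\<close> at the origin. Otherwise the roles are exchanged by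
  \<open>norm (X - u * z) = norm (u * cnj X - cnj z)\<close> for \<open>norm u = 1\<close>.\<close>

lemma circle_mean_ln:
  assumes "norm z \<noteq> norm X"
  shows "((\<lambda>t. ln (norm (X - cis (2 * pi * t) * z))) has_integral ln (max (norm X) (norm z))) {0..1}"
proof (cases "norm z < norm X")
  case True
  then have X: "X \<noteq> 0" by auto
  have "((\<lambda>t. ln (norm X) + ln (norm (1 - cis (2 * pi * t) * z / X))) has_integral (ln (norm X) + 0)) {0..1}"
    using has_integral_add[OF has_integral_const_real[of "ln (norm X)" 0 1] circle_mean_ln_aux[OF True]] by simp
  moreover have "ln (norm (X - cis (2 * pi * t) * z)) = ln (norm X) + ln (norm (1 - cis (2 * pi * t) * z / X))" for t
  proof -
    have "cis (2 * pi * t) * z \<noteq> X" using True by (metis norm_mult norm_cis mult_1 less_irrefl)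
    then have "norm (1 - cis (2 * pi * t) * z / X) > 0" using X by (auto simp: field_simps)
    moreover have "X - cis (2 * pi * t) * z = X * (1 - cis (2 * pi * t) * z / X)" using X by (simp add: field_simps)
    ultimately show ?thesis using X by (simp only: norm_mult) (simp add: ln_mult)
  qed
  ultimately show ?thesis using True by simp
next
  case False
  then have lt: "norm (cnj X) < norm (cnj z)" using assms by simp
  then have z: "z \<noteq> 0" by auto
  have "((\<lambda>t. ln (norm z) + ln (norm (1 - cis (2 * pi * t) * cnj X / cnj z))) has_integral (ln (norm z) + 0)) {0..1}"
    using has_integral_add[OF has_integral_const_real[of "ln (norm z)" 0 1] circle_mean_ln_aux[OF lt]] by simp
  moreover have "ln (norm (X - cis (2 * pi * t) * z)) = ln (norm z) + ln (norm (1 - cis (2 * pi * t) * cnj X / cnj z))" for t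
  proof -
    have ne: "cis (2 * pi * t) * cnj X \<noteq> cnj z" using lt by (metis norm_mult norm_cis mult_1 less_irrefl)
    then have pos: "norm (1 - cis (2 * pi * t) * cnj X / cnj z) > 0" using z by (auto simp: field_simps)
    have cc: "cis (2 * pi * t) * cnj (cis (2 * pi * t)) = 1" by (simp add: complex_norm_square[symmetric])
    have "norm (X - cis (2 * pi * t) * z) = norm (cnj X - cnj (cis (2 * pi * t)) * cnj z)"
      by (metis complex_cnj_diff complex_cnj_mult complex_mod_cnj)
    also have "\<dots> = norm (cis (2 * pi * t) * (cnj X - cnj (cis (2 * pi * t)) * cnj z))" by (simp add: norm_mult)
    also have "cis (2 * pi * t) * (cnj X - cnj (cis (2 * pi * t)) * cnj z) = cis (2 * pi * t) * cnj X - cnj z"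
      using cc by (simp add: right_diff_distrib flip: mult.assoc)
    also have "\<dots> = - cnj z * (1 - cis (2 * pi * t) * cnj X / cnj z)" using z by (simp add: field_simps)
    finally have "norm (X - cis (2 * pi * t) * z) = norm z * norm (1 - cis (2 * pi * t) * cnj X / cnj z)"
      by (simp only: norm_mult norm_minus_cancel complex_mod_cnj)
    then show ?thesis using z pos by (simp add: ln_mult)
  qed
  ultimately show ?thesis using False by (simp add: max_def)
qed

text \<open>\<open>2 / pi\<close> times the logarithmic potential of a disk of radius
  \<open>r\<close> at distance \<open>\<rho>\<close> from its center: that of a point mass outside,
  and inside a quadratic with the same Laplacian as \<open>(norm x)^2\<close>, so that it cancels
  the square in the obstacle up to a harmonic term.\<close>

definition disk_pot :: "real \<Rightarrow> real \<Rightarrow> real" where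
  "disk_pot r \<rho> = (if \<rho> < r then \<rho>\<^sup>2 - r\<^sup>2 + 2 * r\<^sup>2 * ln r else 2 * r\<^sup>2 * ln \<rho>)"

lemma has_integral_inverse_Icc:
  "0 < a \<Longrightarrow> a \<le> b \<Longrightarrow> ((\<lambda>s. 1 / s) has_integral (ln b - ln a)) {a..b}" for a b :: real
  by (intro fundamental_theorem_of_calculus)
     (auto intro!: derivative_eq_intros simp flip: has_real_derivative_iff_has_vector_derivative)

text \<open>\<open>pi * (min r s)\<^sup>2\<close> is the area of the part of the disk with
  \<open>norm z \<le> s\<close>; this is what the layer cake formula leaves after the inner
  integration.\<close>

lemma has_integral_layer:
  assumes r: "r > 0" and a: "a \<ge> 0" and M: "a \<le> M" "r \<le> M"
  shows "((\<lambda>s. pi * (min r s)\<^sup>2 / s) has_integral (pi * r\<^sup>2 * ln M - pi / 2 * disk_pot r a)) {a..M}"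
proof (cases "a < r")
  case False
  then have "a > 0" using r by simp
  have "((\<lambda>s. pi * r\<^sup>2 * (1 / s)) has_integral (pi * r\<^sup>2 * (ln M - ln a))) {a..M}"
    by (intro has_integral_mult_right has_integral_inverse_Icc \<open>a > 0\<close> M)
  then show ?thesis using False
    by (subst has_integral_cong[where g="\<lambda>s. pi * r\<^sup>2 * (1 / s)"]) (auto simp: disk_pot_def algebra_simps)
next
  case True
  have "((\<lambda>s. pi * s) has_integral (pi * r\<^sup>2 / 2 - pi * a\<^sup>2 / 2)) {a..r}"
    using True by (intro fundamental_theorem_of_calculus)
     (auto intro!: derivative_eq_intros simp flip: has_real_derivative_iff_has_vector_derivative)
  then have 1: "((\<lambda>s. pi * (min r s)\<^sup>2 / s) has_integral (pi * r\<^sup>2 / 2 - pi * a\<^sup>2 / 2)) {a..r}"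
    by (subst has_integral_cong[where g="\<lambda>s. pi * s"]) (auto simp: power2_eq_square)
  have "((\<lambda>s. pi * r\<^sup>2 * (1 / s)) has_integral (pi * r\<^sup>2 * (ln M - ln r))) {r..M}"
    by (intro has_integral_mult_right has_integral_inverse_Icc r M)
  then have 2: "((\<lambda>s. pi * (min r s)\<^sup>2 / s) has_integral (pi * r\<^sup>2 * (ln M - ln r))) {r..M}"
    by (subst has_integral_cong[where g="\<lambda>s. pi * r\<^sup>2 * (1 / s)"]) auto
  have "((\<lambda>s. pi * (min r s)\<^sup>2 / s) has_integral (pi * r\<^sup>2 / 2 - pi * a\<^sup>2 / 2 + pi * r\<^sup>2 * (ln M - ln r))) {a..M}"
    by (rule has_integral_combine[OF _ _ 1 2]) (use True M in auto)
  moreover have "pi * r\<^sup>2 / 2 - pi * a\<^sup>2 / 2 + pi * r\<^sup>2 * (ln M - ln r) = pi * r\<^sup>2 * ln M - pi / 2 * disk_pot r a"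
    using True by (simp add: disk_pot_def algebra_simps)
  ultimately show ?thesis by simp
qed

text \<open>Layer cake: \<open>ln M - ln (max a (norm z))\<close> is the integral of \<open>1 / s\<close> over \<open>s\<close> between
  \<open>max a (norm z)\<close> and \<open>M\<close>.\<close>
lemma nn_integral_ln_max:
  assumes r: "r > 0" and a: "a \<ge> 0" and M: "a \<le> M" "r \<le> M"
  shows "(\<integral>\<^sup>+ z. indicator (ball (0::complex) r) z * ennreal (ln M - ln (max a (norm z))) \<partial>lborel)
    = ennreal (pi * r\<^sup>2 * ln M - pi / 2 * disk_pot r a)"
proof -
  define h where "h z s = (if norm z < r \<and> a \<le> s \<and> norm z \<le> s \<and> s \<le> M then ennreal (1 / s) else 0)" for z :: complex and s :: real
  have hm: "(\<lambda>(z, s). h z s) \<in> borel_measurable (lborel \<Otimes>\<^sub>M lborel)"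
    unfolding h_def split_beta by measurable
  have "(\<integral>\<^sup>+ z. indicator (ball (0::complex) r) z * ennreal (ln M - ln (max a (norm z))) \<partial>lborel)
      = (\<integral>\<^sup>+ z. (\<integral>\<^sup>+ s. h z s \<partial>lborel) \<partial>lborel)"
  proof (rule nn_integral_cong_AE)
    \<comment> \<open>At the origin with \<open>a = 0\<close> the logarithm has only its default
      value, so this null set is discarded.\<close>
    have "AE z in lborel. z \<noteq> (0::complex)" by (rule AE_lborel_singleton)
    then show "AE z in lborel. indicator (ball (0::complex) r) z * ennreal (ln M - ln (max a (norm z))) = (\<integral>\<^sup>+ s. h z s \<partial>lborel)"
    proof eventually_elim
      case (elim z)
      show ?case
      proof (cases "norm z < r")
        case True
        define m where "m = max a (norm z)"
        have "norm z > 0" using elim by simp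
        then have m: "0 < m" "m \<le> M" using True M by (auto simp: m_def less_max_iff_disj)
        have "(\<integral>\<^sup>+ s. h z s \<partial>lborel) = (\<integral>\<^sup>+ s. ennreal (1 / s) * indicator {m..M} s \<partial>lborel)"
          using True by (intro nn_integral_cong) (auto simp: h_def m_def indicator_def)
        also have "\<dots> = ennreal (ln M - ln m)"
          using m by (intro nn_integral_has_integral_lebesgue' has_integral_inverse_Icc) auto
        finally show ?thesis using True by (simp add: m_def)
      next
        case False then show ?thesis by (simp add: h_def)
      qed
    qed
  qed
  also have "\<dots> = (\<integral>\<^sup>+ s. (\<integral>\<^sup>+ z. h z s \<partial>lborel) \<partial>lborel)"
    using lborel_pair.Fubini'[OF hm] by simp
  also have "\<dots> = (\<integral>\<^sup>+ s. ennreal (pi * (min r s)\<^sup>2 / s) * indicator {a..M} s \<partial>lborel)"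
  proof (rule nn_integral_cong)
    fix s :: real
    show "(\<integral>\<^sup>+ z. h z s \<partial>lborel) = ennreal (pi * (min r s)\<^sup>2 / s) * indicator {a..M} s"
    proof (cases "a \<le> s \<and> s \<le> M")
      case True
      then have s: "s \<ge> 0" using a by simp
      have "(\<integral>\<^sup>+ z. h z s \<partial>lborel) = (\<integral>\<^sup>+ z. ennreal (1 / s) * indicator (ball 0 r \<inter> cball (0::complex) s) z \<partial>lborel)"
        using True by (intro nn_integral_cong) (auto simp: h_def indicator_def)
      also have "\<dots> = ennreal (1 / s) * emeasure lborel (ball 0 r \<inter> cball (0::complex) s)"
        by (rule nn_integral_cmult_indicator) auto
      also have "emeasure lborel (ball 0 r \<inter> cball (0::complex) s) = ennreal (pi * (min r s)\<^sup>2)"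
      proof (cases "r \<le> s")
        case True
        then have "ball 0 r \<inter> cball (0::complex) s = ball 0 r" by auto
        then show ?thesis using r True by (simp add: emeasure_disk)
      next
        case False
        then have "ball 0 r \<inter> cball (0::complex) s = cball 0 s" by auto
        then show ?thesis using s False by (simp add: emeasure_closed_disk)
      qed
      also have "ennreal (1 / s) * ennreal (pi * (min r s)\<^sup>2) = ennreal (pi * (min r s)\<^sup>2 / s)"
        using s by (subst ennreal_mult[symmetric]) auto
      finally show ?thesis using True by simp
    next
      case False then show ?thesis by (auto simp: h_def)
    qed
  qed
  also have "\<dots> = ennreal (pi * r\<^sup>2 * ln M - pi / 2 * disk_pot r a)"
    by (rule nn_integral_has_integral_lebesgue'[OF _ has_integral_layer[OF assms]]) (use a in auto)
  finally show ?thesis .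
qed

lemma AE_norm_neq: "AE z in lborel. norm (z::complex) \<noteq> a"
proof (cases "a \<ge> 0")
  case True
  have "emeasure lborel (sphere (0::complex) a) = 0"
  proof -
    have "emeasure lborel (cball (0::complex) a) = emeasure lborel (ball (0::complex) a) + emeasure lborel (sphere (0::complex) a)"
      by (subst plus_emeasure) (auto intro!: arg_cong[where f="emeasure lborel"])
    then have "ennreal (pi * a\<^sup>2) + 0 = ennreal (pi * a\<^sup>2) + emeasure lborel (sphere (0::complex) a)"
      using True by (simp add: emeasure_disk emeasure_closed_disk)
    then have "ennreal (pi * a\<^sup>2) = top \<or> 0 = emeasure lborel (sphere (0::complex) a)"
      unfolding ennreal_add_left_cancel infinity_ennreal_def .
    then show ?thesis by simp
  qed
  then have "sphere (0::complex) a \<in> null_sets lborel" by (auto simp: null_sets_def)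
  then have "AE z in lborel. z \<notin> sphere (0::complex) a" by (rule AE_not_in)
  then show ?thesis by (rule AE_mp) simp
next
  case False
  then have "norm z \<noteq> a" for z :: complex using norm_ge_zero[of z] by (auto simp del: norm_ge_zero)
  then show ?thesis by simp
qed

lemma disk_potential_origin:
  assumes r: "r > 0"
  shows "integrable lborel (\<lambda>y. indicator (ball 0 r) y * ln (norm (X - y)))"
    and "integral\<^sup>L lborel (\<lambda>y::complex. indicator (ball 0 r) y * ln (norm (X - y))) = pi / 2 * disk_pot r (norm X)"
proof -
  \<comment> \<open>\<open>M\<close> bounds \<open>norm (X - y)\<close> on the disk, which makes
    \<open>g\<close> nonnegative; the summand \<open>1\<close> gives \<open>ln M \<ge> 0\<close> and
    so covers the default \<open>ln 0 = 0\<close> at \<open>y = X\<close>.\<close>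
  define M where "M = norm X + r + 1"
  have M: "M \<ge> 1" "norm X \<le> M" "r \<le> M" using r by (auto simp: M_def)
  define g where "g y = indicator (ball 0 r) y * (ln M - ln (norm (X - y)))" for y
  have lnle: "ln (norm (X - y)) \<le> ln M" if "norm y < r" for y
  proof (cases "X = y")
    case True then show ?thesis using M by simp
  next
    case False
    have "norm (X - y) \<le> M" using norm_triangle_ineq4[of X y] that by (simp add: M_def)
    then show ?thesis using False M by (subst ln_le_cancel_iff) auto
  qed
  have g0: "g y \<ge> 0" for y using lnle[of y] by (auto simp: g_def indicator_def)
  have [measurable]: "(\<lambda>y. norm (X - y)) \<in> borel_measurable borel" "ball (0::complex) r \<in> sets borel"
    by (auto intro!: borel_measurable_continuous_onI continuous_intros)
  have gm[measurable]: "g \<in> borel_measurable borel" unfolding g_def[abs_def]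
    by (intro borel_measurable_times borel_measurable_indicator borel_measurable_diff borel_measurable_ln) measurable
  define J where "J = pi * r\<^sup>2 * ln M - pi / 2 * disk_pot r (norm X)"
  have "(\<integral>\<^sup>+ z. g z \<partial>lborel) = (\<integral>\<^sup>+ z. (\<integral>\<^sup>+ t. indicator {0..1::real} t * ennreal (g (cis (2 * pi * t) * z)) \<partial>lborel) \<partial>lborel)"
    by (rule rotation_average) measurable
  also have "\<dots> = (\<integral>\<^sup>+ z. indicator (ball (0::complex) r) z * ennreal (ln M - ln (max (norm X) (norm z))) \<partial>lborel)"
  proof (rule nn_integral_cong_AE)
    show "AE z in lborel. (\<integral>\<^sup>+ t. indicator {0..1::real} t * ennreal (g (cis (2 * pi * t) * z)) \<partial>lborel)
        = indicator (ball (0::complex) r) z * ennreal (ln M - ln (max (norm X) (norm z)))"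
      using AE_norm_neq[of "norm X"]
    proof eventually_elim
      case (elim z)
      show ?case
      proof (cases "norm z < r")
        case True
        have "((\<lambda>t. g (cis (2 * pi * t) * z)) has_integral (ln M - ln (max (norm X) (norm z)))) {0..1}"
          using has_integral_diff[OF has_integral_const_real[of "ln M" 0 1] circle_mean_ln[OF elim]] True
          by (simp add: g_def norm_mult)
        then have "(\<integral>\<^sup>+ t. ennreal (g (cis (2 * pi * t) * z)) * indicator {0..1::real} t \<partial>lborel) = ennreal (ln M - ln (max (norm X) (norm z)))"
          using g0 by (intro nn_integral_has_integral_lebesgue') auto
        then show ?thesis using True by (simp add: mult.commute)
      next
        case False then show ?thesis by (simp add: g_def norm_mult)
      qed
    qed
  qed
  also have "\<dots> = ennreal J" unfolding J_def by (rule nn_integral_ln_max) (use r M in auto)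
  finally have nn: "(\<integral>\<^sup>+ z. g z \<partial>lborel) = ennreal J" .
  have J0: "J \<ge> 0"
    unfolding J_def
  proof (rule has_integral_nonneg[OF has_integral_layer[OF r norm_ge_zero M(2,3)]])
    fix s assume "s \<in> {norm X..M}"
    then have "0 \<le> s" using norm_ge_zero[of X] by (simp del: norm_ge_zero)
    then show "0 \<le> pi * (min r s)\<^sup>2 / s" by simp
  qed
  have ig: "integrable lborel g" "integral\<^sup>L lborel g = J"
    using has_bochner_integral_nn_integral[OF _ _ J0 nn] g0 by (auto simp: has_bochner_integral_iff)
  have ic: "integrable lborel (\<lambda>y. indicator (ball (0::complex) r) y * ln M)"
    using set_integrable_ball[of 0 r "\<lambda>_. ln M"] by (simp add: set_integrable_def)
  have eq: "(\<lambda>y. indicator (ball 0 r) y * ln (norm (X - y))) = (\<lambda>y. indicator (ball 0 r) y * ln M - g y)"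
    by (auto simp: g_def fun_eq_iff algebra_simps)
  show "integrable lborel (\<lambda>y. indicator (ball 0 r) y * ln (norm (X - y)))"
    unfolding eq using ic ig(1) by (rule Bochner_Integration.integrable_diff)
  have "integral\<^sup>L lborel (\<lambda>y. indicator (ball 0 r) y * ln (norm (X - y))) = pi * r\<^sup>2 * ln M - J"
    unfolding eq using ic ig r by (subst Bochner_Integration.integral_diff) (auto simp: measure_disk)
  then show "integral\<^sup>L lborel (\<lambda>y. indicator (ball 0 r) y * ln (norm (X - y))) = pi / 2 * disk_pot r (norm X)"
    by (simp add: J_def)
qed

lemma disk_potential:
  assumes r: "r > 0"
  shows "integrable lborel (\<lambda>y. indicator (ball c r) y * ln (dist x y))"
    and "integral\<^sup>L lborel (\<lambda>y::complex. indicator (ball c r) y * ln (dist x y)) = pi / 2 * disk_pot r (dist x c)"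
proof -
  define f where "f y = indicator (ball c r) y * ln (dist x y)" for y
  have "(\<lambda>y. dist x y) \<in> borel_measurable borel" "ball c r \<in> sets borel"
    by (auto intro!: borel_measurable_continuous_onI continuous_intros)
  then have [measurable]: "f \<in> borel_measurable borel" unfolding f_def[abs_def]
    by (intro borel_measurable_times borel_measurable_indicator borel_measurable_ln)
  have eq: "(\<lambda>y. f (c + y)) = (\<lambda>y. indicator (ball 0 r) y * ln (norm ((x - c) - y)))"
    by (auto simp: f_def fun_eq_iff indicator_def dist_norm algebra_simps)
  have d: "distr lborel borel ((+) c) = lborel" by (rule lborel_distr_plus)
  have "integrable (distr lborel borel ((+) c)) f"
    by (subst integrable_distr_eq) (use disk_potential_origin(1)[OF r, of "x - c"] eq in auto)
  then have "integrable lborel f" by (simp only: d)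
  then show "integrable lborel (\<lambda>y. indicator (ball c r) y * ln (dist x y))"
    by (simp only: f_def[abs_def])
  have "integral\<^sup>L lborel f = integral\<^sup>L (distr lborel borel ((+) c)) f" by (simp add: d)
  also have "\<dots> = integral\<^sup>L lborel (\<lambda>y. f (c + y))" by (subst integral_distr) auto
  also have "\<dots> = pi / 2 * disk_pot r (dist x c)"
    unfolding eq by (simp add: disk_potential_origin(2)[OF r] dist_norm)
  finally show "integral\<^sup>L lborel (\<lambda>y. indicator (ball c r) y * ln (dist x y)) = pi / 2 * disk_pot r (dist x c)"
    by (simp only: f_def[abs_def])
qed

text \<open>This is \<open>ln t \<le> t - 1\<close> at the square of \<open>\<rho> / r\<close>. A
  point mass has a smaller potential than the disk, with equality outside the disk; this supplies
  the logarithms that touch \<open>- disk_pot\<close> from above.\<close>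

lemma disk_pot_ge: "r > 0 \<Longrightarrow> \<rho> > 0 \<Longrightarrow> 2 * r\<^sup>2 * ln \<rho> \<le> disk_pot r \<rho>"
proof (cases "\<rho> < r")
  case True
  assume pos: "r > 0" "\<rho> > 0"
  have "ln ((\<rho> / r)\<^sup>2) \<le> (\<rho> / r)\<^sup>2 - 1" using pos by (intro ln_le_minus_one) auto
  then have "2 * (ln \<rho> - ln r) \<le> (\<rho> / r)\<^sup>2 - 1" using pos by (simp add: ln_realpow ln_div)
  then have "r\<^sup>2 * (2 * (ln \<rho> - ln r)) \<le> r\<^sup>2 * ((\<rho> / r)\<^sup>2 - 1)" by (intro mult_left_mono) auto
  also have "\<dots> = \<rho>\<^sup>2 - r\<^sup>2" using pos by (simp add: power_divide algebra_simps)
  finally show ?thesis using True by (simp add: disk_pot_def algebra_simps)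
qed (simp add: disk_pot_def)

text \<open>The slope is \<open>2 * \<rho>\<close> inside and \<open>2 * r\<^sup>2 / \<rho>\<close>
  outside, at most \<open>2 * r\<close> in both cases.\<close>

lemma disk_pot_lipschitz_aux:
  assumes r: "r > 0" and ab: "0 \<le> a" "a \<le> b"
  shows "disk_pot r a \<le> disk_pot r b" "disk_pot r b - disk_pot r a \<le> 2 * r * (b - a)"
proof -
  have in_le: "disk_pot r v - disk_pot r u \<le> 2 * r * (v - u) \<and> disk_pot r u \<le> disk_pot r v"
    if "0 \<le> u" "u \<le> v" "v \<le> r" for u v
  proof -
    have e: "disk_pot r w = w\<^sup>2 - r\<^sup>2 + 2 * r\<^sup>2 * ln r" if "w \<le> r" for w
      using that by (cases "w = r") (auto simp: disk_pot_def)
    have "(v - u) * (v + u) \<le> (v - u) * (2 * r)" using that by (intro mult_left_mono) auto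
    moreover have "0 \<le> (v - u) * (v + u)" using that by auto
    moreover have "disk_pot r v - disk_pot r u = (v - u) * (v + u)"
      using e[of u] e[of v] that by (simp add: power2_eq_square algebra_simps)
    ultimately show ?thesis by (simp add: algebra_simps)
  qed
  have out_le: "disk_pot r v - disk_pot r u \<le> 2 * r * (v - u) \<and> disk_pot r u \<le> disk_pot r v"
    if "r \<le> u" "u \<le> v" for u v
  proof -
    have pos: "u > 0" "v > 0" using r that by auto
    have "ln (v / u) \<le> v / u - 1" using pos by (intro ln_le_minus_one) auto
    then have l: "ln v - ln u \<le> (v - u) / u" using pos by (simp add: ln_div field_simps)
    have "r * (v - u) \<le> u * (v - u)" using that by (intro mult_right_mono) auto
    then have "r * ((v - u) / u) \<le> v - u" using pos by (simp add: field_simps)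
    moreover have "r * (ln v - ln u) \<le> r * ((v - u) / u)" using l r by (intro mult_left_mono) auto
    ultimately have "2 * r * (r * (ln v - ln u)) \<le> 2 * r * (v - u)" using r by (intro mult_left_mono) auto
    moreover have "disk_pot r v - disk_pot r u = 2 * r * (r * (ln v - ln u))"
      using that by (simp add: disk_pot_def power2_eq_square algebra_simps)
    moreover have "ln u \<le> ln v" using pos that by simp
    then have "disk_pot r u \<le> disk_pot r v" using that by (simp add: disk_pot_def mult_left_mono)
    ultimately show ?thesis by simp
  qed
  have "disk_pot r b - disk_pot r a \<le> 2 * r * (b - a) \<and> disk_pot r a \<le> disk_pot r b"
  proof -
    consider "b \<le> r" | "r \<le> a" | "a \<le> r" "r \<le> b" by linarith
    then show ?thesis
    proof cases
      case 3
      then show ?thesis using in_le[of a r] out_le[of r b] ab by (simp add: algebra_simps)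
    qed (use in_le out_le ab in auto)
  qed
  then show "disk_pot r a \<le> disk_pot r b" "disk_pot r b - disk_pot r a \<le> 2 * r * (b - a)" by auto
qed

lemma disk_pot_lipschitz:
  fixes c x y :: "'a::metric_space"
  assumes r: "r > 0" shows "\<bar>disk_pot r (dist x c) - disk_pot r (dist y c)\<bar> \<le> 2 * r * dist x y"
proof -
  have *: "disk_pot r (dist x c) - disk_pot r (dist y c) \<le> 2 * r * dist x y" for x y
  proof (cases "dist y c \<le> dist x c")
    case True
    have "disk_pot r (dist x c) - disk_pot r (dist y c) \<le> 2 * r * (dist x c - dist y c)"
      using True r by (intro disk_pot_lipschitz_aux) auto
    also have "\<dots> \<le> 2 * r * dist x y" using r dist_triangle[of x c y] by (intro mult_left_mono) auto
    finally show ?thesis .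
  next
    case False
    then have "disk_pot r (dist x c) \<le> disk_pot r (dist y c)" using r by (intro disk_pot_lipschitz_aux) auto
    moreover have "0 \<le> 2 * r * dist x y" using r by simp
    ultimately show ?thesis by simp
  qed
  show ?thesis using *[of x y] *[of y x] by (auto simp: abs_le_iff dist_commute)
qed

lemma continuous_on_disk_pot:
  fixes c :: "'a::metric_space"
  assumes "r > 0" shows "continuous_on A (\<lambda>x. disk_pot r (dist x c))"
proof (rule continuous_on_subset[OF _ subset_UNIV], rule uniformly_continuous_imp_continuous)
  show "uniformly_continuous_on UNIV (\<lambda>x. disk_pot r (dist x c))"
    unfolding uniformly_continuous_on_def
  proof (intro allI impI)
    fix e :: real assume e: "e > 0"
    show "\<exists>d>0. \<forall>x\<in>UNIV. \<forall>x'\<in>UNIV. dist x' x < d \<longrightarrow> dist (disk_pot r (dist x' c)) (disk_pot r (dist x c)) < e"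
    proof (intro exI[of _ "e / (2 * r)"] conjI ballI impI)
      fix x x' :: 'a assume "dist x' x < e / (2 * r)"
      then have "2 * r * dist x' x < e" using assms by (simp add: field_simps)
      then show "dist (disk_pot r (dist x' c)) (disk_pot r (dist x c)) < e"
        using disk_pot_lipschitz[OF assms, of x' c x] by (simp add: dist_real_def)
    qed (use e assms in auto)
  qed
qed

text \<open>Spreading the mass over \<open>k\<close> times the area with density
  \<open>1 / k\<close> raises the logarithmic potential and changes nothing outside the larger disk;
  an explicit majorant is built from this.\<close>

lemma disk_pot_scaled:
  assumes r: "r > 0" and k: "k \<ge> 1" and \<rho>: "\<rho> \<ge> 0"
  shows "disk_pot r \<rho> \<le> disk_pot (sqrt k * r) \<rho> / k" (is ?le)
    and "sqrt k * r \<le> \<rho> \<Longrightarrow> disk_pot (sqrt k * r) \<rho> / k = disk_pot r \<rho>"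
proof -
  have sk: "sqrt k \<ge> 1" using k by simp
  have R2: "(sqrt k * r)\<^sup>2 = k * r\<^sup>2" using k by (simp add: power_mult_distrib)
  have rR: "r \<le> sqrt k * r" using sk r by simp
  have lnR: "ln (sqrt k * r) = ln k / 2 + ln r" using k r by (simp add: ln_mult ln_sqrt)
  show "sqrt k * r \<le> \<rho> \<Longrightarrow> disk_pot (sqrt k * r) \<rho> / k = disk_pot r \<rho>"
    using rR k by (simp add: disk_pot_def R2)
  show ?le
  proof (cases "r \<le> \<rho>")
    case True
    then have "2 * (sqrt k * r)\<^sup>2 * ln \<rho> \<le> disk_pot (sqrt k * r) \<rho>"
      using r sk by (intro disk_pot_ge) auto
    then have "k * (2 * r\<^sup>2 * ln \<rho>) \<le> disk_pot (sqrt k * r) \<rho>" unfolding R2 by (simp add: mult_ac)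
    then show ?thesis using True k by (simp add: disk_pot_def field_simps)
  next
    case False
    have "\<rho>\<^sup>2 * (1 - 1 / k) \<le> r\<^sup>2 * (1 - 1 / k)"
      using False \<rho> k by (intro mult_right_mono power_mono) auto
    also have "\<dots> \<le> r\<^sup>2 * ln k"
    proof (rule mult_left_mono)
      have "ln (1 / k) \<le> 1 / k - 1" using k by (intro ln_le_minus_one) auto
      then show "1 - 1 / k \<le> ln k" using k by (simp add: ln_div)
    qed simp
    finally have "\<rho>\<^sup>2 - r\<^sup>2 + 2 * r\<^sup>2 * ln r \<le> \<rho>\<^sup>2 / k - r\<^sup>2 + 2 * r\<^sup>2 * (ln k / 2 + ln r)"
      by (simp add: algebra_simps)
    also have "\<dots> = disk_pot (sqrt k * r) \<rho> / k"
    proof -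
      have "disk_pot (sqrt k * r) \<rho> = \<rho>\<^sup>2 - k * r\<^sup>2 + 2 * (k * r\<^sup>2) * (ln k / 2 + ln r)"
        unfolding disk_pot_def R2 lnR using False rR by simp
      show ?thesis unfolding \<open>disk_pot (sqrt k * r) \<rho> = _\<close> using k by (simp add: field_simps)
    qed
    finally show ?thesis using False by (simp add: disk_pot_def)
  qed
qed

text \<open>Gradient estimate for positive harmonic functions, by the Schwarz lemma after a Moebius map
  of the right half plane.\<close>
lemma deriv_bound_of_Re_nonneg:
  assumes g: "g holomorphic_on ball x d" and d: "d > 0" and pos: "\<And>y. y \<in> ball x d \<Longrightarrow> Re (g y) \<ge> 0"
  shows "norm (deriv g x) \<le> 2 * Re (g x) / d"
proof -
  have dg: "(g has_field_derivative deriv g x) (at x)"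
    using g d by (intro holomorphic_derivI[OF _ open_ball]) auto
  have main: "norm (deriv g x) \<le> 2 * (Re (g x) + e) / d" if e: "e > 0" for e
  proof -
    define a where "a = g x + of_real e"
    define F where "F z = (g (x + of_real d * z) + of_real e - a) / (g (x + of_real d * z) + of_real e + cnj a)" for z
    have Rea: "Re a > 0" using pos[of x] d e by (simp add: a_def)
    have inb: "x + of_real d * z \<in> ball x d" if "norm z < 1" for z
      using that d by (simp add: dist_norm norm_mult)
    have ne: "g (x + of_real d * z) + of_real e + cnj a \<noteq> 0" if "norm z < 1" for z
    proof -
      have "Re (g (x + of_real d * z) + of_real e + cnj a) > 0" using pos[OF inb[OF that]] Rea e by simp
      then show ?thesis by force
    qed
    have holg: "(\<lambda>z. g (x + of_real d * z)) holomorphic_on ball 0 1"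
      by (rule holomorphic_on_compose_gen[where f="\<lambda>z. x + of_real d * z" and g=g and t="ball x d", unfolded o_def])
         (use inb in \<open>auto intro!: holomorphic_intros g\<close>)
    have holF: "F holomorphic_on ball 0 1"
      unfolding F_def using ne by (intro holomorphic_intros holg) auto
    have F0: "F 0 = 0" by (simp add: F_def a_def)
    have F1: "norm (F z) < 1" if "norm z < 1" for z
    proof -
      define w where "w = g (x + of_real d * z) + of_real e"
      have Rew: "Re w > 0" using pos[OF inb[OF that]] e by (simp add: w_def)
      have "(norm (w + cnj a))\<^sup>2 - (norm (w - a))\<^sup>2 = 4 * Re w * Re a"
        unfolding cmod_power2 by (simp add: power2_eq_square algebra_simps)
      moreover have "4 * Re w * Re a > 0" using Rew Rea by simp
      ultimately have "(norm (w - a))\<^sup>2 < (norm (w + cnj a))\<^sup>2" by linarith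
      then have "norm (w - a) < norm (w + cnj a)" by (rule power_less_imp_less_base) simp
      then show ?thesis using ne[OF that] by (simp add: F_def w_def norm_divide)
    qed
    have "norm (deriv F 0) \<le> 1" by (rule Schwarz_Lemma(2)[OF holF F0 F1, of 0]) auto
    moreover have "deriv F 0 = of_real d * deriv g x / (a + cnj a)"
    proof -
      have "((\<lambda>z. g (x + of_real d * z)) has_field_derivative deriv g x * of_real d) (at 0)"
        by (rule DERIV_chain2[where g="\<lambda>z. x + of_real d * z"]) (use dg in \<open>auto intro!: derivative_eq_intros\<close>)
      then have "(F has_field_derivative of_real d * deriv g x / (a + cnj a)) (at 0)"
        unfolding F_def using ne[of 0] by (auto intro!: derivative_eq_intros simp: a_def power2_eq_square)
      then show ?thesis by (rule DERIV_imp_deriv)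
    qed
    moreover have "a + cnj a = of_real (2 * Re a)" by (simp add: complex_eq_iff)
    ultimately have "norm (of_real d * deriv g x / of_real (2 * Re a)) \<le> 1" by simp
    then have "d * norm (deriv g x) / (2 * Re a) \<le> 1"
      using d Rea by (simp add: norm_mult norm_divide del: of_real_mult)
    then have "d * norm (deriv g x) \<le> 2 * Re a" using Rea by (simp add: divide_le_eq)
    then show ?thesis using d by (simp add: a_def le_divide_eq mult.commute)
  qed
  show ?thesis
  proof (rule field_le_epsilon)
    fix e :: real assume "e > 0"
    then have "norm (deriv g x) \<le> 2 * (Re (g x) + e * d / 2) / d" using d by (intro main) simp
    also have "\<dots> = 2 * Re (g x) / d + e" using d by (simp add: field_simps)
    finally show "norm (deriv g x) \<le> 2 * Re (g x) / d + e" .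
  qed
qed

text \<open>By the gradient estimate, polynomials with close real parts have close derivatives on
  the half ball. Once their imaginary parts are made \<open>0\<close> at the center, the polynomials
  themselves are uniformly Cauchy there.\<close>

lemma Re_holomorphic_of_approx:
  fixes s :: "complex \<Rightarrow> real"
  assumes R: "R > 0"
    and ap: "\<And>e. e > 0 \<Longrightarrow> \<exists>p :: complex poly. \<forall>y\<in>ball x R. \<bar>s y - Re (poly p (y - x))\<bar> \<le> e"
  shows "\<exists>g. g holomorphic_on ball x (R/2) \<and> (\<forall>y\<in>ball x (R/2). s y = Re (g y))"
proof -
  have "\<forall>n. \<exists>p :: complex poly. \<forall>y\<in>ball x R. \<bar>s y - Re (poly p (y - x))\<bar> \<le> inverse (real (Suc n))"
    by (intro allI ap) simp
  then obtain p :: "nat \<Rightarrow> complex poly" where p: "\<forall>n. \<forall>y\<in>ball x R. \<bar>s y - Re (poly (p n) (y - x))\<bar> \<le> inverse (real (Suc n))"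
    by (rule choice[THEN exE])
  define h where "h n y = poly (p n) (y - x) - \<i> * of_real (Im (poly (p n) 0))" for n y
  have Reh: "Re (h n y) = Re (poly (p n) (y - x))" for n y by (simp add: h_def)
  have holh: "h n holomorphic_on A" for n A unfolding h_def by (intro holomorphic_intros)
  define B where "B = ball x (R/2)"
  \<comment> \<open>\<open>8 * e\<close> comes from integrating the derivative bound,
    \<open>e\<close> from the center, where the difference is real.\<close>
  have key: "norm (h n y - h m y) \<le> 9 * e"
    if close: "\<And>y. y \<in> ball x R \<Longrightarrow> \<bar>Re (h n y) - Re (h m y)\<bar> \<le> e" and y: "y \<in> B" and e: "e > 0" for n m y e
  proof -
    define q where "q y = h n y - h m y" for y
    have holq: "q holomorphic_on A" for A unfolding q_def by (intro holomorphic_intros holh)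
    have dq: "norm (deriv q z) \<le> 8 * e / R" if z: "z \<in> B" for z
    proof -
      have sub: "ball z (R/2) \<subseteq> ball x R"
      proof
        fix u assume "u \<in> ball z (R/2)"
        then show "u \<in> ball x R" using z dist_triangle[of x u z] by (simp add: B_def)
      qed
      have zz: "z \<in> ball z (R/2)" using R by simp
      \<comment> \<open>The real part of \<open>q + e\<close> lies between \<open>0\<close> and
        \<open>2 * e\<close>, so the estimate for nonnegative real parts applies.\<close>
      have "norm (deriv (\<lambda>y. q y + of_real e) z) \<le> 2 * Re (q z + of_real e) / (R/2)"
      proof (rule deriv_bound_of_Re_nonneg)
        show "(\<lambda>y. q y + of_real e) holomorphic_on ball z (R/2)" by (intro holomorphic_intros holq)
        show "0 \<le> Re (q u + of_real e)" if "u \<in> ball z (R/2)" for u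
          using close[of u] that sub by (auto simp: q_def abs_le_iff)
      qed (use R in auto)
      also have "deriv (\<lambda>y. q y + of_real e) z = deriv q z"
      proof -
        have "(q has_field_derivative deriv q z) (at z)" using holq[of UNIV] by (intro holomorphic_derivI[OF _ open_UNIV]) auto
        then have "((\<lambda>y. q y + of_real e) has_field_derivative deriv q z) (at z)" by (auto intro!: derivative_eq_intros)
        then show ?thesis by (rule DERIV_imp_deriv)
      qed
      also have "2 * Re (q z + of_real e) / (R/2) \<le> 2 * (2 * e) / (R/2)"
      proof -
        have "z \<in> ball x R" using sub zz by blast
        then have "Re (q z) \<le> e" using close[of z] unfolding q_def by (simp add: abs_le_iff)
        then show ?thesis using R by (intro divide_right_mono mult_left_mono) simp_all
      qed
      finally show ?thesis using R by (simp add: field_simps)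
    qed
    have "norm (q y - q x) \<le> 8 * e / R * norm (y - x)"
    proof (rule field_differentiable_bound[where S=B])
      show "convex B" by (simp add: B_def)
      show "(q has_field_derivative deriv q z) (at z within B)" if "z \<in> B" for z
        by (rule has_field_derivative_at_within, rule holomorphic_derivI[OF holq[of UNIV] open_UNIV]) simp
    qed (use dq y R in \<open>auto simp: B_def\<close>)
    also have "\<dots> \<le> 8 * e / R * R"
    proof (rule mult_left_mono)
      show "norm (y - x) \<le> R" using y R by (simp add: B_def dist_norm norm_minus_commute)
      show "0 \<le> 8 * e / R" using R e by simp
    qed
    finally have 1: "norm (q y - q x) \<le> 8 * e" using R by simp
    have "q x = of_real (Re (h n x) - Re (h m x))" by (simp add: q_def h_def complex_eq_iff)
    then have 2: "norm (q x) \<le> e" using close[of x] R by (simp only: norm_of_real) simp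
    have "norm (q y) \<le> norm (q y - q x) + norm (q x)" using norm_triangle_ineq[of "q y - q x" "q x"] by simp
    then show ?thesis using 1 2 unfolding q_def by simp
  qed
  have "uniformly_Cauchy_on B h"
    unfolding uniformly_Cauchy_on_def
  proof (intro allI impI)
    fix e :: real assume e: "e > 0"
    obtain N where N: "inverse (real (Suc N)) < e / 20" using reals_Archimedean[of "e/20"] e by auto
    show "\<exists>M. \<forall>y\<in>B. \<forall>m\<ge>M. \<forall>n\<ge>M. dist (h m y) (h n y) < e"
    proof (intro exI[of _ N] ballI allI impI)
      fix y m n assume y: "y \<in> B" and mn: "N \<le> m" "N \<le> n"
      have cl: "\<bar>Re (h m y) - Re (h n y)\<bar> \<le> e / 10" if "y \<in> ball x R" for y
      proof -
        have "inverse (real (Suc m)) \<le> inverse (real (Suc N))" "inverse (real (Suc n)) \<le> inverse (real (Suc N))"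
          using mn by (auto intro!: le_imp_inverse_le)
        moreover have "\<bar>s y - Re (h m y)\<bar> \<le> inverse (real (Suc m))" "\<bar>s y - Re (h n y)\<bar> \<le> inverse (real (Suc n))"
          unfolding Reh using p that by blast+
        ultimately show ?thesis using N by linarith
      qed
      have "norm (h m y - h n y) \<le> 9 * (e / 10)" by (rule key[OF cl y]) (use e in auto)
      then show "dist (h m y) (h n y) < e" using e by (simp add: dist_norm)
    qed
  qed
  then obtain g where g: "uniform_limit B h g sequentially"
    using uniformly_convergent_eq_Cauchy uniformly_convergent_on_def by metis
  have "g holomorphic_on B"
  proof (rule holomorphic_uniform_sequence[where f=h])
    show "h n holomorphic_on B" for n by (rule holh)
    show "\<exists>d>0. cball y d \<subseteq> B \<and> uniform_limit (cball y d) h g sequentially" if y: "y \<in> B" for y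
    proof -
      have "open B" by (simp add: B_def)
      then obtain d where "d > 0" "cball y d \<subseteq> B" using y open_contains_cball[of B] by blast
      then show ?thesis using uniform_limit_on_subset[OF g] by blast
    qed
  qed (simp add: B_def)
  moreover have "s y = Re (g y)" if y: "y \<in> B" for y
  proof -
    have "(\<lambda>n. Re (h n y)) \<longlonglongrightarrow> Re (g y)" using tendsto_uniform_limitI[OF g y] by (rule tendsto_Re)
    moreover have "(\<lambda>n. Re (h n y)) \<longlonglongrightarrow> s y"
    proof (rule LIM_zero_cancel, rule Lim_null_comparison)
      show "eventually (\<lambda>n. norm (Re (h n y) - s y) \<le> inverse (real (Suc n))) sequentially"
      proof (rule always_eventually, rule allI)
        fix n
        have "y \<in> ball x R" using y R by (simp add: B_def)
        then have "\<bar>s y - Re (poly (p n) (y - x))\<bar> \<le> inverse (real (Suc n))" using p by blast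
        then show "norm (Re (h n y) - s y) \<le> inverse (real (Suc n))" by (simp only: Reh real_norm_def abs_minus_commute)
      qed
      show "(\<lambda>n. inverse (real (Suc n))) \<longlonglongrightarrow> 0" by (rule LIMSEQ_inverse_real_of_nat)
    qed
    ultimately show ?thesis using LIMSEQ_unique by blast
  qed
  ultimately show ?thesis unfolding B_def by blast
qed

section \<open>The obstacle problem\<close>

lemma norm_sq_expand: "(norm (y - c))\<^sup>2 = (norm (x - c))\<^sup>2 + 2 * Re (cnj (x - c) * (y - x)) + (norm (y - x))\<^sup>2"
  for x y c :: complex
  unfolding cmod_power2 by (simp add: power2_eq_square algebra_simps)

lemma Re_pos_quotient:
  fixes x y c :: complex
  assumes "norm (y - x) < norm (x - c)"
  shows "Re ((y - c) / (x - c)) > 0"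
proof -
  have xc: "x - c \<noteq> 0" using assms by auto
  have "norm ((y - x) / (x - c)) < 1" using assms xc by (simp add: norm_divide)
  moreover have "(y - c) / (x - c) = 1 + (y - x) / (x - c)" using xc by (simp add: field_simps)
  ultimately show ?thesis using abs_Re_le_cmod[of "(y - x) / (x - c)"] by simp
qed

text \<open>A branch of the logarithm around \<open>x\<close>: on the disk reaching up to
  \<open>c\<close> the quotient \<open>(y - c) / (x - c)\<close> has positive real part.\<close>

lemma log_holomorphic:
  fixes x c :: complex
  assumes "x \<noteq> c"
  shows "(\<lambda>y. Ln ((y - c) / (x - c)) + of_real (ln (norm (x - c)))) holomorphic_on ball x (norm (x - c))"
    and "\<And>y. y \<in> ball x (norm (x - c)) \<Longrightarrow> Re (Ln ((y - c) / (x - c)) + of_real (ln (norm (x - c)))) = ln (norm (y - c))"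
proof -
  have pos: "Re ((y - c) / (x - c)) > 0" if "y \<in> ball x (norm (x - c))" for y
    using that by (intro Re_pos_quotient) (simp add: dist_norm norm_minus_commute)
  show "(\<lambda>y. Ln ((y - c) / (x - c)) + of_real (ln (norm (x - c)))) holomorphic_on ball x (norm (x - c))"
  proof -
    have "(y - c) / (x - c) \<notin> \<real>\<^sub>\<le>\<^sub>0" if "y \<in> ball x (norm (x - c))" for y
      using pos[OF that] by (auto simp: complex_nonpos_Reals_iff)
    then show ?thesis using assms by (intro holomorphic_intros) (auto simp del: mem_ball)
  qed
  fix y assume y: "y \<in> ball x (norm (x - c))"
  then have "(y - c) / (x - c) \<noteq> 0" using pos[OF y] by force
  then show "Re (Ln ((y - c) / (x - c)) + of_real (ln (norm (x - c)))) = ln (norm (y - c))"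
    using assms by (simp add: norm_divide ln_div)
qed

lemma locally_supermean_cmult:
  assumes "locally_supermean f x" "a \<ge> 0"
  shows "locally_supermean (\<lambda>y. a * f y) x"
proof -
  obtain d where d: "d > 0" "\<And>r. 0 < r \<Longrightarrow> r < d \<Longrightarrow> set_integrable lborel (ball x r) f \<and> (LINT y:ball x r|lborel. f y) \<le> f x * measure lborel (ball x r)"
    using assms(1) by (auto simp: locally_supermean_def)
  show ?thesis unfolding locally_supermean_def
  proof (intro exI[of _ d] conjI allI impI)
    fix r assume r: "0 < r" "r < d"
    show "set_integrable lborel (ball x r) (\<lambda>y. a * f y)" using d(2)[OF r] by simp
    have "a * (LINT y:ball x r|lborel. f y) \<le> a * (f x * measure lborel (ball x r))"
      using d(2)[OF r] assms(2) by (intro mult_left_mono) auto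
    then show "(LINT y:ball x r|lborel. a * f y) \<le> a * f x * measure lborel (ball x r)"
      by (simp add: mult.assoc)
  qed (rule d(1))
qed

text \<open>Inside the disk, dropping the square of \<open>norm (y - x)\<close> leaves an affine
  function that touches from above; outside, \<open>disk_pot_ge\<close> supplies a touching
  logarithm.\<close>

lemma locally_supermean_neg_disk_pot:
  assumes r: "r > 0"
  shows "locally_supermean (\<lambda>y. - disk_pot r (dist y c)) x"
proof (cases "dist x c < r")
  case True
  define g where "g y = - (of_real ((norm (x - c))\<^sup>2 - r\<^sup>2 + 2 * r\<^sup>2 * ln r) + 2 * cnj (x - c) * (y - x))" for y
  show ?thesis
  proof (rule locally_supermean_touching[where g=g and R="r - dist x c"])
    show "continuous_on (ball x (r - dist x c)) (\<lambda>y. - disk_pot r (dist y c))"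
      by (intro continuous_intros continuous_on_disk_pot r)
    show "g holomorphic_on ball x (r - dist x c)" unfolding g_def by (intro holomorphic_intros)
    show "- disk_pot r (dist y c) \<le> Re (g y)" if "y \<in> ball x (r - dist x c)" for y
    proof -
      have "dist y c < r" using that dist_triangle[of y c x] by (simp add: dist_commute)
      then have "disk_pot r (dist y c) = (norm (y - c))\<^sup>2 - r\<^sup>2 + 2 * r\<^sup>2 * ln r"
        by (simp add: disk_pot_def dist_norm)
      then show ?thesis using norm_sq_expand[of y c x] by (simp add: g_def algebra_simps)
    qed
    show "- disk_pot r (dist x c) = Re (g x)" using True by (simp add: g_def disk_pot_def dist_norm)
  qed (use True in simp)
next
  case False
  then have xc: "x \<noteq> c" using r by auto
  define g where "g y = of_real (- 2 * r\<^sup>2) * (Ln ((y - c) / (x - c)) + of_real (ln (norm (x - c))))" for y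
  have Reg: "Re (g y) = - 2 * r\<^sup>2 * ln (norm (y - c))" if "y \<in> ball x (norm (x - c))" for y
    unfolding g_def Re_of_real_mult log_holomorphic(2)[OF xc that] ..
  show ?thesis
  proof (rule locally_supermean_touching[where g=g and R="norm (x - c)"])
    show "continuous_on (ball x (norm (x - c))) (\<lambda>y. - disk_pot r (dist y c))"
      by (intro continuous_intros continuous_on_disk_pot r)
    show "g holomorphic_on ball x (norm (x - c))" unfolding g_def by (intro holomorphic_intros log_holomorphic xc)
    show "- disk_pot r (dist y c) \<le> Re (g y)" if "y \<in> ball x (norm (x - c))" for y
    proof -
      have "y \<noteq> c" using that by (auto simp: dist_norm)
      then have "2 * r\<^sup>2 * ln (norm (y - c)) \<le> disk_pot r (norm (y - c))" using r by (intro disk_pot_ge) auto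
      then show ?thesis using Reg[OF that] by (simp add: dist_norm)
    qed
    show "- disk_pot r (dist x c) = Re (g x)"
      using False Reg[of x] xc by (simp add: disk_pot_def dist_norm)
  qed (use xc in simp)
qed

text \<open>With the square recentered at \<open>c\<close>, the function is constant on the disk and
  has its global maximum there, so a constant touches. Outside, the potential is a logarithm and the
  negative square lies below its tangent.\<close>

lemma locally_supermean_disk_pot_minus_sq:
  assumes R: "R > 0"
  shows "locally_supermean (\<lambda>y. disk_pot R (dist y c) - (norm y)\<^sup>2) x"
proof -
  define b where "b y = disk_pot R (dist y c) - (norm (y - c))\<^sup>2" for y
  have sq: "(norm y)\<^sup>2 = (norm (y - c))\<^sup>2 + Re (of_real ((norm c)\<^sup>2) + 2 * cnj c * (y - c))" for y
    using norm_sq_expand[of y 0 c] by simp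
  have cb: "continuous_on A b" for A unfolding b_def by (intro continuous_intros continuous_on_disk_pot R)
  have "locally_supermean b x"
  proof (cases "dist x c \<le> R")
    case True
    define K where "K = - R\<^sup>2 + 2 * R\<^sup>2 * ln R"
    have le: "b y \<le> K" for y
    proof (cases "dist y c < R")
      case True then show ?thesis by (simp add: b_def K_def disk_pot_def dist_norm)
    next
      case False
      define \<rho> where "\<rho> = norm (y - c)"
      have \<rho>: "\<rho> > 0" "\<rho> \<ge> R" using False R by (auto simp: \<rho>_def dist_norm)
      have "ln ((\<rho> / R)\<^sup>2) \<le> (\<rho> / R)\<^sup>2 - 1" using \<rho> R by (intro ln_le_minus_one) auto
      then have "2 * (ln \<rho> - ln R) \<le> (\<rho> / R)\<^sup>2 - 1" using \<rho> R by (simp add: ln_realpow ln_div)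
      then have "R\<^sup>2 * (2 * (ln \<rho> - ln R)) \<le> R\<^sup>2 * ((\<rho> / R)\<^sup>2 - 1)" by (intro mult_left_mono) auto
      also have "\<dots> = \<rho>\<^sup>2 - R\<^sup>2" using R by (simp add: power_divide algebra_simps)
      finally show ?thesis using \<rho>(2) by (simp add: b_def K_def disk_pot_def dist_norm \<rho>_def algebra_simps)
    qed
    have eq: "b x = K" using True R by (cases "dist x c = R") (auto simp: b_def K_def disk_pot_def dist_norm)
    show ?thesis
      by (rule locally_supermean_touching[where g="\<lambda>_. of_real K" and R=1, OF cb]) (use le eq in auto)
  next
    case False
    then have xc: "x \<noteq> c" using R by auto
    define g where "g y = of_real (2 * R\<^sup>2) * (Ln ((y - c) / (x - c)) + of_real (ln (norm (x - c))))
        - (of_real ((norm (x - c))\<^sup>2) + 2 * cnj (x - c) * (y - x))" for y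
    have Reg: "Re (g y) = 2 * R\<^sup>2 * ln (norm (y - c)) - ((norm (x - c))\<^sup>2 + 2 * Re (cnj (x - c) * (y - x)))"
      if "y \<in> ball x (norm (x - c))" for y
      unfolding g_def minus_complex.sel Re_of_real_mult log_holomorphic(2)[OF xc that] by (simp add: algebra_simps)
    have sub: "ball x (dist x c - R) \<subseteq> ball x (norm (x - c))" using R by (auto simp: dist_norm)
    show ?thesis
    proof (rule locally_supermean_touching[where g=g and R="dist x c - R", OF cb])
      show "g holomorphic_on ball x (dist x c - R)"
        unfolding g_def by (intro holomorphic_intros holomorphic_on_subset[OF log_holomorphic(1)[OF xc] sub])
      show "b y \<le> Re (g y)" if y: "y \<in> ball x (dist x c - R)" for y
      proof -
        have "dist x c \<le> dist x y + dist y c" by (rule dist_triangle)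
        then have "\<not> dist y c < R" using y by simp
        then have "b y = 2 * R\<^sup>2 * ln (norm (y - c)) - (norm (y - c))\<^sup>2" by (simp add: b_def disk_pot_def dist_norm)
        moreover have "y \<in> ball x (norm (x - c))" using y sub by blast
        ultimately show ?thesis using norm_sq_expand[of y c x] Reg[of y] by simp
      qed
      show "b x = Re (g x)" using Reg[of x] xc False by (simp add: b_def disk_pot_def dist_norm)
    qed (use False in simp)
  qed
  moreover have "locally_supermean (\<lambda>y. Re (- (of_real ((norm c)\<^sup>2) + 2 * cnj c * (y - c)))) x"
    by (rule locally_supermean_Re[where R=1]) (auto intro!: holomorphic_intros)
  ultimately have "locally_supermean (\<lambda>y. b y + Re (- (of_real ((norm c)\<^sup>2) + 2 * cnj c * (y - c)))) x"
    by (rule locally_supermean_add)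
  moreover have "b y + Re (- (of_real ((norm c)\<^sup>2) + 2 * cnj c * (y - c))) = disk_pot R (dist y c) - (norm y)\<^sup>2" for y
    using sq[of y] by (simp add: b_def)
  ultimately show ?thesis by simp
qed

lemma set_integral_ball_translate:
  fixes f :: "complex \<Rightarrow> real"
  assumes f: "continuous_on UNIV f"
  shows "(LINT y:ball x r|lborel. f (y + h)) = (LINT y:ball (x + h) r|lborel. f y)"
proof -
  define G where "G y = indicator (ball (x + h) r) y *\<^sub>R f y" for y
  have [measurable]: "G \<in> borel_measurable borel"
    unfolding G_def[abs_def] by (intro borel_measurable_continuous_on_indicator continuous_on_subset[OF f]) auto
  have "integral\<^sup>L lborel G = integral\<^sup>L (distr lborel borel ((+) h)) G" by (simp add: lborel_distr_plus)
  also have "\<dots> = integral\<^sup>L lborel (\<lambda>y. G (h + y))" by (subst integral_distr) auto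
  also have "(\<lambda>y. G (h + y)) = (\<lambda>y. indicator (ball x r) y *\<^sub>R f (y + h))"
    by (auto simp: G_def fun_eq_iff indicator_def dist_norm algebra_simps)
  finally show ?thesis by (simp add: set_lebesgue_integral_def G_def)
qed

lemma supermean_translate:
  assumes "supermean f" shows "supermean (\<lambda>x. f (x + h))"
proof -
  have f: "continuous_on UNIV f" using assms by (simp add: supermean_def)
  have "measure lborel (ball (x + h) r) = measure lborel (ball x r)" if "r > 0" for x :: complex and r
    using that by (simp add: measure_disk)
  moreover have "(LINT y:ball (x + h) r|lborel. f y) \<le> f (x + h) * measure lborel (ball (x + h) r)" if "r > 0" for x r
    using assms that by (simp add: supermean_def)
  ultimately show ?thesis
    unfolding supermean_def
    by (auto simp: set_integral_ball_translate[OF f] intro!: continuous_on_compose2[OF f] continuous_intros)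
qed

section \<open>The least superharmonic majorant of the disk obstacle\<close>

locale disk_obstacle =
  fixes k :: nat and c :: "nat \<Rightarrow> complex" and r :: "nat \<Rightarrow> real"
  assumes k: "0 < k" and r: "\<And>i. i < k \<Longrightarrow> 0 < r i" and inj_c: "inj_on c {..<k}"
begin

definition pot :: "complex \<Rightarrow> real" where
  "pot x = (\<Sum>i<k. disk_pot (r i) (dist x (c i)))"

definition obst :: "complex \<Rightarrow> real" where
  "obst x = - (norm x)\<^sup>2 + pot x"

definition majorants :: "(complex \<Rightarrow> real) set" where
  "majorants = {f. supermean f \<and> (\<forall>y. obst y \<le> f y)}"

definition env :: "complex \<Rightarrow> real" where
  "env x = Inf {f x |f. f \<in> majorants}"

lemma cont_pot: "continuous_on A pot"
  unfolding pot_def by (intro continuous_intros continuous_on_disk_pot r) auto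

lemma cont_obst: "continuous_on A obst"
  unfolding obst_def by (intro continuous_intros cont_pot)

text \<open>Each disk is spread over \<open>k\<close> times its area with density
  \<open>1 / k\<close>, so the total density is at most \<open>1\<close>, which
  \<open>- (norm x)^2\<close> compensates. Dividing the square among the disks makes every summand
  superharmonic.\<close>

definition spread :: "complex \<Rightarrow> real" where
  "spread x = (\<Sum>i<k. (1 / k) * (disk_pot (sqrt k * r i) (dist x (c i)) - (norm x)\<^sup>2))"

lemma spread_eq: "spread x = (\<Sum>i<k. disk_pot (sqrt k * r i) (dist x (c i)) / k) - (norm x)\<^sup>2"
  using k by (simp add: spread_def sum_subtractf diff_divide_distrib)

lemma spread_majorant: "spread \<in> majorants"
proof -
  have pos: "sqrt k * r i > 0" if "i < k" for i using k r[OF that] by simp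
  have "supermean spread"
  proof (rule supermean_of_local)
    show "continuous_on UNIV spread"
      unfolding spread_def using pos by (intro continuous_intros continuous_on_disk_pot) auto
    show "locally_supermean spread x" for x
      unfolding spread_def using pos
      by (intro locally_supermean_sum locally_supermean_cmult locally_supermean_disk_pot_minus_sq) auto
  qed
  moreover have "obst y \<le> spread y" for y
    unfolding spread_eq obst_def pot_def
    using k r by (auto intro!: sum_mono disk_pot_scaled)
  ultimately show ?thesis by (simp add: majorants_def)
qed

lemma obst_le_majorant: "f \<in> majorants \<Longrightarrow> obst x \<le> f x"
  by (simp add: majorants_def)

lemma env_le: "f \<in> majorants \<Longrightarrow> env x \<le> f x"
  unfolding env_def by (rule cInf_lower) (auto intro!: bdd_belowI[of _ "obst x"] dest: obst_le_majorant)

lemma le_env: "(\<And>f. f \<in> majorants \<Longrightarrow> a \<le> f x) \<Longrightarrow> a \<le> env x"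
  unfolding env_def using spread_majorant by (intro cInf_greatest) auto

lemma obst_le_env: "obst x \<le> env x"
  by (intro le_env obst_le_majorant)

definition lip :: real where "lip = (\<Sum>i<k. 2 * r i)"

lemma lip_nonneg: "lip \<ge> 0"
  unfolding lip_def using r by (intro sum_nonneg) (auto intro: less_imp_le)

lemma pot_lipschitz: "pot x - pot y \<le> lip * dist x y"
proof -
  have "pot x - pot y = (\<Sum>i<k. disk_pot (r i) (dist x (c i)) - disk_pot (r i) (dist y (c i)))"
    by (simp add: pot_def sum_subtractf)
  also have "\<dots> \<le> (\<Sum>i<k. 2 * r i * dist x y)"
    using disk_pot_lipschitz[OF r] by (intro sum_mono) (auto simp: abs_le_iff)
  finally show ?thesis by (simp add: lip_def sum_distrib_right)
qed

text \<open>The class of functions \<open>f + norm\<^sup>2\<close> with \<open>f\<close> a majorant is invariant under translations up to the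
  Lipschitz constant of \<open>pot\<close>, which makes the envelope continuous.\<close>
lemma majorant_translate:
  assumes f: "f \<in> majorants"
  shows "(\<lambda>x. f (x + h) + (norm (x + h))\<^sup>2 - (norm x)\<^sup>2 + lip * norm h) \<in> majorants"
proof -
  define A where "A x = of_real ((norm h)\<^sup>2 + lip * norm h) + 2 * cnj h * x" for x
  have A: "f (x + h) + (norm (x + h))\<^sup>2 - (norm x)\<^sup>2 + lip * norm h = f (x + h) + Re (A x)" for x
    unfolding A_def cmod_power2 by (simp add: power2_eq_square algebra_simps)
  have sf: "supermean (\<lambda>x. f (x + h))" using f by (intro supermean_translate) (simp add: majorants_def)
  then have cf: "continuous_on UNIV (\<lambda>x. f (x + h))" by (simp add: supermean_def)
  have "supermean (\<lambda>x. f (x + h) + Re (A x))"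
  proof (rule supermean_of_local)
    show "continuous_on UNIV (\<lambda>x. f (x + h) + Re (A x))" unfolding A_def by (intro continuous_intros cf)
    show "locally_supermean (\<lambda>x. f (x + h) + Re (A x)) x" for x
      by (intro locally_supermean_add supermean_imp_locally[OF sf] locally_supermean_Re[where R=1])
         (auto simp: A_def intro!: holomorphic_intros)
  qed
  moreover have "obst x \<le> f (x + h) + (norm (x + h))\<^sup>2 - (norm x)\<^sup>2 + lip * norm h" for x
    using obst_le_majorant[OF f, of "x + h"] pot_lipschitz[of x "x + h"] by (simp add: obst_def dist_norm)
  ultimately show ?thesis unfolding majorants_def A by simp
qed

lemma env_lipschitz: "(env x + (norm x)\<^sup>2) - (env y + (norm y)\<^sup>2) \<le> lip * dist x y"
proof -
  have "env x + (norm x)\<^sup>2 - (norm y)\<^sup>2 - lip * dist x y \<le> env y"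
  proof (rule le_env)
    fix f assume "f \<in> majorants"
    from env_le[OF majorant_translate[OF this, of "y - x"], of x]
    show "env x + (norm x)\<^sup>2 - (norm y)\<^sup>2 - lip * dist x y \<le> f y"
      by (simp add: dist_norm norm_minus_commute)
  qed
  then show ?thesis by simp
qed

lemma cont_env: "continuous_on A env"
proof -
  have "lip-lipschitz_on UNIV (\<lambda>x. env x + (norm x)\<^sup>2)"
    using env_lipschitz lip_nonneg
    by (auto simp: lipschitz_on_def dist_real_def abs_le_iff) (metis dist_commute env_lipschitz)
  then have "continuous_on UNIV (\<lambda>x. env x + (norm x)\<^sup>2)" by (rule lipschitz_on_continuous_on)
  then have "continuous_on UNIV (\<lambda>x. (env x + (norm x)\<^sup>2) - (norm x)\<^sup>2)"
    by (rule continuous_on_diff) (intro continuous_intros)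
  then have "continuous_on UNIV env" by (simp only: add_diff_cancel_right')
  then show ?thesis by (rule continuous_on_subset) simp
qed

text \<open>Every ball mean of \<open>env\<close> is at most that of each majorant, so the
  inequality passes to the infimum.\<close>

lemma supermean_env: "supermean env"
  unfolding supermean_def
proof (intro conjI cont_env allI impI)
  fix x :: complex and d :: real assume d: "0 < d"
  have m: "measure lborel (ball x d) > 0" using d by (simp add: measure_disk)
  have "(LINT y:ball x d|lborel. env y) / measure lborel (ball x d) \<le> env x"
  proof (rule le_env)
    fix f assume f: "f \<in> majorants"
    then have cf: "continuous_on UNIV f" by (simp add: majorants_def supermean_def)
    have "(LINT y:ball x d|lborel. env y) \<le> (LINT y:ball x d|lborel. f y)"
      by (intro set_integral_mono set_integrable_ball cont_env continuous_on_subset[OF cf] env_le f) auto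
    also have "\<dots> \<le> f x * measure lborel (ball x d)" using f d by (simp add: majorants_def supermean_def)
    finally show "(LINT y:ball x d|lborel. env y) / measure lborel (ball x d) \<le> f x"
      using m by (simp add: divide_le_eq)
  qed
  then show "(LINT y:ball x d|lborel. env y) \<le> env x * measure lborel (ball x d)"
    using m by (simp add: divide_le_eq)
qed

section \<open>The smash sum in complex coordinates and harmonicity of the envelope on it\<close>

definition coincidence_compl :: "complex set" where
  "coincidence_compl = {x. obst x < env x}"

definition Om :: "complex set" where
  "Om = (\<Union>i<k. ball (c i) (r i)) \<union> coincidence_compl"

lemma open_coincidence_compl: "open coincidence_compl"
  unfolding coincidence_compl_def by (intro open_Collect_less cont_obst cont_env)

lemma open_Om: "open Om"
  unfolding Om_def by (intro open_Un open_UN ballI open_coincidence_compl) auto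

text \<open>Outside the enlarged disks the majorant \<open>spread\<close> equals the obstacle, so
  the envelope is squeezed onto it.\<close>

lemma bounded_Om: "bounded Om"
proof -
  have "Om \<subseteq> (\<Union>i<k. ball (c i) (r i)) \<union> (\<Union>i<k. ball (c i) (sqrt k * r i))"
  proof
    fix x assume x: "x \<in> Om"
    show "x \<in> (\<Union>i<k. ball (c i) (r i)) \<union> (\<Union>i<k. ball (c i) (sqrt k * r i))"
    proof (rule ccontr)
      assume n: "\<not> ?thesis"
      then have far: "sqrt k * r i \<le> dist x (c i)" if "i < k" for i using that by (force simp: dist_commute not_less)
      have "spread x = obst x"
        unfolding spread_eq obst_def pot_def
        using far k r by (simp add: disk_pot_scaled(2))
      then have "env x \<le> obst x" using env_le[OF spread_majorant, of x] by simp
      then have "x \<notin> coincidence_compl" by (simp add: coincidence_compl_def)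
      then show False using x n by (auto simp: Om_def)
    qed
  qed
  then show ?thesis by (rule bounded_subset[rotated]) (intro bounded_Un[THEN iffD2] conjI bounded_UN ballI; simp)
qed

text \<open>Perron's argument. The hypothesis \<open>H\<close> says that the obstacle does not
  interfere in the ball. Lowering \<open>env\<close> to its minimum with a harmonic polynomial that
  exceeds it on the sphere then gives a majorant, so \<open>env\<close> is below the polynomial, and
  by the minimum principle below it by at most \<open>e\<close>.\<close>

lemma env_harmonic_ball:
  assumes R: "R > 0"
    and H: "\<And>p :: complex poly. \<lbrakk>\<And>y. y \<in> sphere x R \<Longrightarrow> env y < Re (poly p (y - x))\<rbrakk>
        \<Longrightarrow> (\<And>y. y \<in> ball x R \<Longrightarrow> obst y \<le> Re (poly p (y - x)))"
  shows "\<exists>g. g holomorphic_on ball x (R/2) \<and> (\<forall>y\<in>ball x (R/2). env y = Re (g y))"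
proof (rule Re_holomorphic_of_approx[OF R])
  fix e :: real assume e: "e > 0"
  \<comment> \<open>The shift by \<open>e/2\<close> puts the polynomial above \<open>env\<close> on
    the sphere, so that the modified function is continuous across it.\<close>
  have "\<exists>p :: complex poly. \<forall>y\<in>sphere x R. \<bar>(env y + e/2) - Re (poly p (y - x))\<bar> < e/2"
    using e by (intro harmonic_approximation continuous_intros cont_env) simp
  then obtain p :: "complex poly" where p: "\<forall>y\<in>sphere x R. \<bar>(env y + e/2) - Re (poly p (y - x))\<bar> < e/2"
    by blast
  define h where "h y = Re (poly p (y - x))" for y
  have ch: "continuous_on A h" for A unfolding h_def by (intro continuous_intros)
  have up: "env y < h y" and low: "h y < env y + e" if "y \<in> sphere x R" for y
    using p that unfolding h_def by (fastforce simp: abs_if split: if_splits)+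
  have obst_h: "obst y \<le> h y" if "y \<in> ball x R" for y
    using H[of p y] up that unfolding h_def by blast
  define f where "f y = (if y \<in> ball x R then min (env y) (h y) else env y)" for y
  have f_le: "f y \<le> env y" for y by (simp add: f_def)
  have cf: "continuous_on UNIV f"
  proof -
    have "continuous_on (cball x R) (\<lambda>y. min (env y) (h y))" by (intro continuous_intros cont_env ch)
    then have 1: "continuous_on (cball x R) f"
    proof (rule continuous_on_eq)
      fix y assume y: "y \<in> cball x R"
      show "min (env y) (h y) = f y"
      proof (cases "y \<in> ball x R")
        case False
        then have "y \<in> sphere x R" using y by auto
        then show ?thesis using up[of y] by (simp add: f_def)
      qed (simp add: f_def)
    qed
    have 2: "continuous_on (- ball x R) f"
      by (rule continuous_on_eq[OF cont_env]) (simp add: f_def)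
    have "continuous_on (cball x R \<union> - ball x R) f"
      by (rule continuous_on_closed_Un[OF _ _ 1 2]) auto
    moreover have "cball x R \<union> - ball x R = UNIV" by auto
    ultimately show ?thesis by simp
  qed
  have "supermean f"
  proof (rule supermean_of_local[OF cf])
    fix y
    show "locally_supermean f y"
    \<comment> \<open>Where \<open>f\<close> equals \<open>env\<close> it inherits the inequality of
      the larger function \<open>env\<close>; elsewhere it touches the harmonic \<open>h\<close>
      from below.\<close>
    proof (cases "f y = env y")
      case True
      show ?thesis unfolding locally_supermean_def
      proof (intro exI[of _ 1] conjI allI impI)
        fix d :: real assume d: "0 < d"
        show i: "set_integrable lborel (ball y d) f"
          by (rule set_integrable_ball) (rule continuous_on_subset[OF cf], simp)
        have "(LINT u:ball y d|lborel. f u) \<le> (LINT u:ball y d|lborel. env u)"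
          by (intro set_integral_mono i set_integrable_ball cont_env f_le)
        also have "\<dots> \<le> env y * measure lborel (ball y d)" using supermean_env d by (simp add: supermean_def)
        finally show "(LINT u:ball y d|lborel. f u) \<le> f y * measure lborel (ball y d)" using True by simp
      qed simp
    next
      case False
      then have y: "y \<in> ball x R" and fy: "f y = h y" by (auto simp: f_def min_def split: if_splits)
      show ?thesis
      proof (rule locally_supermean_touching[where g="\<lambda>u. poly p (u - x)" and R="R - dist x y"])
        show "continuous_on (ball y (R - dist x y)) f" by (rule continuous_on_subset[OF cf]) simp
        show "f u \<le> Re (poly p (u - x))" if "u \<in> ball y (R - dist x y)" for u
        proof -
          have "u \<in> ball x R" using that dist_triangle[of x u y] by simp
          then show ?thesis by (simp add: f_def h_def)
        qed
        show "f y = Re (poly p (y - x))" using fy by (simp add: h_def)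
      qed (use y in \<open>auto intro!: holomorphic_intros\<close>)
    qed
  qed
  moreover have "obst y \<le> f y" for y using obst_h[of y] obst_le_env[of y] by (simp add: f_def)
  ultimately have "f \<in> majorants" by (simp add: majorants_def)
  then have 1: "env y \<le> h y" if "y \<in> ball x R" for y
    using env_le[of f y] that by (simp add: f_def)
  have 2: "env y - h y + e \<ge> 0" if "y \<in> ball x R" for y
  proof (rule minimum_principle[where f="\<lambda>y. env y - h y + e" and R=R and x=x])
    show "continuous_on (cball x R) (\<lambda>y. env y - h y + e)" by (intro continuous_intros cont_env ch)
    show "locally_supermean (\<lambda>y. env y - h y + e) u" for u
      using locally_supermean_add[OF supermean_imp_locally[OF supermean_env] locally_supermean_poly[of "[:of_real e:] - p" x]]
      by (simp add: h_def algebra_simps)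
    show "0 \<le> env u - h u + e" if "u \<in> sphere x R" for u using low[OF that] by simp
  qed (use R that in auto)
  show "\<exists>p :: complex poly. \<forall>y\<in>ball x R. \<bar>env y - Re (poly p (y - x))\<bar> \<le> e"
  proof (intro exI[of _ p] ballI)
    fix y assume y: "y \<in> ball x R"
    show "\<bar>env y - Re (poly p (y - x))\<bar> \<le> e" using 1[OF y] 2[OF y] by (simp add: h_def abs_le_iff)
  qed
qed

text \<open>Off the coincidence set a constant \<open>m\<close> separates obstacle and envelope near
  \<open>x\<close>. Inside a disk its own potential cancels the square up to a harmonic term, so the
  obstacle is subharmonic there and the minimum principle keeps it below the polynomial; this covers
  points of a disk where \<open>env\<close> touches \<open>obst\<close>.\<close>

lemma env_harmonic:
  assumes x: "x \<in> Om"
  shows "\<exists>g R. R > 0 \<and> g holomorphic_on ball x R \<and> (\<forall>y\<in>ball x R. env y = Re (g y))"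
proof -
  have "\<exists>g R. R > 0 \<and> g holomorphic_on ball x (R/2) \<and> (\<forall>y\<in>ball x (R/2). env y = Re (g y))"
  proof (cases "x \<in> coincidence_compl")
    case True
    define m where "m = (env x + obst x) / 2"
    have m: "obst x < m" "m < env x" using True by (auto simp: m_def coincidence_compl_def)
    have "open ({y. m < env y} \<inter> {y. obst y < m})"
      by (intro open_Int open_Collect_less cont_obst cont_env continuous_intros)
    moreover have "x \<in> {y. m < env y} \<inter> {y. obst y < m}" using m by simp
    ultimately obtain R where R: "R > 0" "cball x R \<subseteq> {y. m < env y} \<inter> {y. obst y < m}"
      using open_contains_cball by blast
    have "\<exists>g. g holomorphic_on ball x (R/2) \<and> (\<forall>y\<in>ball x (R/2). env y = Re (g y))"
    proof (rule env_harmonic_ball[OF R(1)])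
      fix p :: "complex poly" and y
      assume p: "\<And>y. y \<in> sphere x R \<Longrightarrow> env y < Re (poly p (y - x))" and y: "y \<in> ball x R"
      have "Re (poly p (y - x)) - m \<ge> 0"
      proof (rule minimum_principle[where f="\<lambda>y. Re (poly p (y - x)) - m" and R=R and x=x])
        show "continuous_on (cball x R) (\<lambda>y. Re (poly p (y - x)) - m)" by (intro continuous_intros)
        show "locally_supermean (\<lambda>y. Re (poly p (y - x)) - m) u" for u
          using locally_supermean_poly[of "p - [:of_real m:]" x u] by simp
        show "0 \<le> Re (poly p (u - x)) - m" if "u \<in> sphere x R" for u
        proof -
          have "m < env u" using R(2) that by (auto simp: subset_iff)
          then show ?thesis using p[OF that] by simp
        qed
      qed (use R y in auto)
      moreover have "obst y < m" using R(2) y by (auto simp: subset_iff)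
      ultimately show "obst y \<le> Re (poly p (y - x))" by simp
    qed
    then show ?thesis using R(1) by blast
  next
    case False
    then obtain i where i: "i < k" "x \<in> ball (c i) (r i)" using x by (auto simp: Om_def)
    have "open (ball (c i) (r i))" by simp
    with i(2) obtain R where R: "R > 0" "cball x R \<subseteq> ball (c i) (r i)"
      using open_contains_cball[of "ball (c i) (r i)"] by blast
    have "\<exists>g. g holomorphic_on ball x (R/2) \<and> (\<forall>y\<in>ball x (R/2). env y = Re (g y))"
    proof (rule env_harmonic_ball[OF R(1)])
      fix p :: "complex poly" and y
      assume p: "\<And>y. y \<in> sphere x R \<Longrightarrow> env y < Re (poly p (y - x))" and y: "y \<in> ball x R"
      define a where "a y = (norm y)\<^sup>2 - disk_pot (r i) (dist y (c i))" for y
      have a: "locally_supermean a u" if u: "u \<in> ball x R" for u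
      proof -
        have "open (ball (c i) (r i))" by simp
        moreover have ui: "u \<in> ball (c i) (r i)"
        proof -
          have "u \<in> cball x R" using u by auto
          then show ?thesis using R(2) by blast
        qed
        ultimately obtain d where d: "d > 0" "ball u d \<subseteq> ball (c i) (r i)" by (meson open_contains_ball)
        define A where "A y = of_real ((norm (c i))\<^sup>2 + (r i)\<^sup>2 - 2 * (r i)\<^sup>2 * ln (r i)) + 2 * cnj (c i) * (y - c i)" for y
        have eq: "a y = Re (A y)" if "y \<in> ball (c i) (r i)" for y
        proof -
          have "disk_pot (r i) (dist y (c i)) = (norm (y - c i))\<^sup>2 - (r i)\<^sup>2 + 2 * (r i)\<^sup>2 * ln (r i)"
            using that by (simp add: disk_pot_def dist_norm norm_minus_commute)
          then show ?thesis using norm_sq_expand[of y 0 "c i"] by (simp add: a_def A_def)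
        qed
        show ?thesis
        proof (rule locally_supermean_touching[where g=A and R=d])
          show "continuous_on (ball u d) a"
            unfolding a_def by (intro continuous_intros continuous_on_disk_pot r i)
          show "A holomorphic_on ball u d" unfolding A_def by (intro holomorphic_intros)
          show "a y \<le> Re (A y)" if "y \<in> ball u d" for y using eq[of y] d(2) that by auto
          show "a u = Re (A u)" by (rule eq[OF ui])
        qed (rule d(1))
      qed
      have eq: "Re (poly p (y - x)) - obst y = (a y + (\<Sum>j\<in>{..<k} - {i}. - disk_pot (r j) (dist y (c j)))) + Re (poly p (y - x))" for y
        using i(1) by (simp add: a_def obst_def pot_def sum.remove[of "{..<k}" i] sum_negf)
      have "Re (poly p (y - x)) - obst y \<ge> 0"
      proof (rule minimum_principle[where f="\<lambda>y. Re (poly p (y - x)) - obst y" and R=R and x=x])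
        show "continuous_on (cball x R) (\<lambda>y. Re (poly p (y - x)) - obst y)" by (intro continuous_intros cont_obst)
        show "locally_supermean (\<lambda>y. Re (poly p (y - x)) - obst y) u" if "u \<in> ball x R" for u
          unfolding eq
          by (intro locally_supermean_add a that locally_supermean_sum locally_supermean_neg_disk_pot
              locally_supermean_poly r) auto
        show "0 \<le> Re (poly p (u - x)) - obst u" if "u \<in> sphere x R" for u
          using p[OF that] obst_le_env[of u] by simp
      qed (use R y in auto)
      then show "obst y \<le> Re (poly p (y - x))" by simp
    qed
    then show ?thesis using R(1) by blast
  qed
  then obtain g R where "R > 0" "g holomorphic_on ball x (R/2)" "\<forall>y\<in>ball x (R/2). env y = Re (g y)" by blast
  then show ?thesis by (intro exI[of _ g] exI[of _ "R/2"]) auto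
qed

end

section \<open>The Schwarz function of the smash sum\<close>

text \<open>The linear approximation of \<open>Ln (1 + \<zeta>)\<close> for
  \<open>norm \<zeta> \<le> 1/2\<close>, where the denominator \<open>1 - norm \<zeta>\<close> costs
  a factor \<open>2\<close>.\<close>

lemma ln_norm_ge:
  fixes x w c :: complex
  assumes "norm (x - w) \<le> norm (w - c) / 2" "w \<noteq> c"
  shows "ln (norm (w - c)) + Re ((x - w) / (w - c)) - 2 * (norm (x - w) / norm (w - c))\<^sup>2 \<le> ln (norm (x - c))"
proof -
  define \<zeta> where "\<zeta> = (x - w) / (w - c)"
  have wc: "w - c \<noteq> 0" using assms by simp
  have n: "norm \<zeta> \<le> 1/2" using assms wc by (simp add: \<zeta>_def norm_divide field_simps)
  then have "norm (Ln (1 + \<zeta>) - \<zeta>) \<le> (norm \<zeta>)\<^sup>2 / (1 - norm \<zeta>)"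
    by (intro Ln_approx_linear) simp
  also have "\<dots> \<le> (norm \<zeta>)\<^sup>2 / (1/2)" using n by (intro divide_left_mono) auto
  finally have "norm (Ln (1 + \<zeta>) - \<zeta>) \<le> 2 * (norm \<zeta>)\<^sup>2" by simp
  then have "- (2 * (norm \<zeta>)\<^sup>2) \<le> Re (Ln (1 + \<zeta>) - \<zeta>)"
    using abs_Re_le_cmod[of "Ln (1 + \<zeta>) - \<zeta>"] by linarith
  moreover have "1 + \<zeta> \<noteq> 0"
  proof
    assume "1 + \<zeta> = 0"
    then have "\<zeta> = -1" by (simp add: add_eq_0_iff)
    then show False using n by simp
  qed
  then have "Re (Ln (1 + \<zeta>)) = ln (norm (1 + \<zeta>))" by simp
  moreover have "norm (x - c) = norm (w - c) * norm (1 + \<zeta>)"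
  proof -
    have "x - c = (w - c) * (1 + \<zeta>)" using wc by (simp add: \<zeta>_def distrib_left)
    then show ?thesis by (simp only: norm_mult)
  qed
  then have "ln (norm (x - c)) = ln (norm (w - c)) + ln (norm (1 + \<zeta>))"
    using wc \<open>1 + \<zeta> \<noteq> 0\<close> by (simp add: ln_mult)
  moreover have "norm \<zeta> = norm (x - w) / norm (w - c)" by (simp add: \<zeta>_def norm_divide)
  ultimately show ?thesis by (simp add: \<zeta>_def)
qed

section \<open>Boundary behaviour of the derivative of the envelope\<close>

context disk_obstacle
begin

text \<open>The Wirtinger derivative in \<open>z\<close>. Using the Frechet derivative gives one
  function on all of \<open>Om\<close>, although \<open>env\<close> is the real part of a
  holomorphic function only locally.\<close>

definition env_dz :: "complex \<Rightarrow> complex" where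
  "env_dz z = (let D = frechet_derivative env (at z) in (of_real (D 1) - \<i> * of_real (D \<i>)) / 2)"

lemma env_dz_eq:
  assumes g: "g holomorphic_on ball x R" and eq: "\<And>y. y \<in> ball x R \<Longrightarrow> env y = Re (g y)" and z: "z \<in> ball x R"
  shows "env_dz z = deriv g z / 2" "(env has_derivative (\<lambda>h. Re (deriv g z * h))) (at z)"
proof -
  have "(g has_field_derivative deriv g z) (at z)" using g z by (intro holomorphic_derivI[OF _ open_ball])
  then have "(g has_derivative (\<lambda>h. deriv g z * h)) (at z)" by (simp add: has_field_derivative_def)
  then have "((\<lambda>y. Re (g y)) has_derivative (\<lambda>h. Re (deriv g z * h))) (at z)"
    by (rule has_derivative_Re)
  then show d: "(env has_derivative (\<lambda>h. Re (deriv g z * h))) (at z)"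
    by (rule has_derivative_transform_within_open[OF _ open_ball z]) (use eq in simp)
  have "frechet_derivative env (at z) = (\<lambda>h. Re (deriv g z * h))" by (rule frechet_derivative_at[OF d, symmetric])
  then show "env_dz z = deriv g z / 2"
    by (simp add: env_dz_def complex_eq_iff)
qed

lemma env_dz_holomorphic: "env_dz holomorphic_on Om"
proof -
  have "env_dz field_differentiable (at x)" if x: "x \<in> Om" for x
  proof -
    obtain g R where R: "R > 0" and g: "g holomorphic_on ball x R" and eq: "\<forall>y\<in>ball x R. env y = Re (g y)"
      using env_harmonic[OF x] by blast
    have "(\<lambda>z. deriv g z / 2) holomorphic_on ball x R"
      by (intro holomorphic_intros holomorphic_deriv g) auto
    then have "env_dz holomorphic_on ball x R"
      by (rule holomorphic_transform) (use env_dz_eq(1)[OF g] eq in auto)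
    then show ?thesis using R by (intro holomorphic_on_imp_differentiable_at[OF _ open_ball]) auto
  qed
  then show ?thesis by (auto simp: holomorphic_on_def intro: field_differentiable_at_within)
qed

text \<open>\<open>env_harmonic\<close> gives only some small radius. A primitive of
  \<open>2 * env_dz\<close>, corrected by a real constant, serves the whole ball, as the
  quantitative estimate requires.\<close>

lemma env_Re_on_ball:
  assumes sub: "ball z d \<subseteq> Om" and d: "d > 0"
  shows "\<exists>G. G holomorphic_on ball z d \<and> (\<forall>y\<in>ball z d. env y = Re (G y)) \<and> deriv G z = 2 * env_dz z"
proof -
  have "(\<lambda>y. 2 * env_dz y) holomorphic_on ball z d"
    by (intro holomorphic_intros holomorphic_on_subset[OF env_dz_holomorphic sub])
  then obtain G where G: "\<And>y. y \<in> ball z d \<Longrightarrow> (G has_field_derivative 2 * env_dz y) (at y within ball z d)"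
    using holomorphic_convex_primitive'[of "ball z d" "\<lambda>y. 2 * env_dz y"] by auto
  have G': "(G has_field_derivative 2 * env_dz y) (at y)" if "y \<in> ball z d" for y
    using G[OF that] unfolding at_within_open[OF that open_ball] .
  have "((\<lambda>y. env y - Re (G y)) has_derivative (\<lambda>h. 0)) (at y within ball z d)" if y: "y \<in> ball z d" for y
  proof -
    obtain g R where R: "R > 0" and g: "g holomorphic_on ball y R" and eq: "\<forall>u\<in>ball y R. env u = Re (g u)"
      using env_harmonic[of y] sub y by blast
    have "y \<in> ball y R" using R by simp
    from env_dz_eq[OF g _ this] eq have 1: "env_dz y = deriv g y / 2" "(env has_derivative (\<lambda>h. Re (deriv g y * h))) (at y)" by auto
    have "(G has_derivative (\<lambda>h. 2 * env_dz y * h)) (at y)" using G'[OF y] by (simp add: has_field_derivative_def)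
    then have "((\<lambda>y. Re (G y)) has_derivative (\<lambda>h. Re (2 * env_dz y * h))) (at y)" by (rule has_derivative_Re)
    from has_derivative_diff[OF 1(2) this] have "((\<lambda>y. env y - Re (G y)) has_derivative (\<lambda>h. 0)) (at y)"
      by (simp add: 1(1))
    then show ?thesis by (rule has_derivative_at_withinI)
  qed
  then have "\<exists>c. \<forall>y\<in>ball z d. env y - Re (G y) = c"
    by (intro has_derivative_zero_constant) auto
  then obtain c where c: "\<And>y. y \<in> ball z d \<Longrightarrow> env y - Re (G y) = c" by blast
  define H where "H y = G y + of_real c" for y
  have H': "(H has_field_derivative 2 * env_dz y) (at y)" if "y \<in> ball z d" for y
    unfolding H_def using G'[OF that] by (auto intro!: derivative_eq_intros)
  have "H holomorphic_on ball z d"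
    unfolding holomorphic_on_def field_differentiable_def using H' has_field_derivative_at_within by blast
  moreover have "env y = Re (H y)" if "y \<in> ball z d" for y using c[OF that] by (simp add: H_def)
  moreover have "deriv H z = 2 * env_dz z" using H'[of z] d by (intro DERIV_imp_deriv) simp
  ultimately show ?thesis by blast
qed

text \<open>The \<open>z\<close>-derivative of \<open>pot\<close> outside the disks, where the
  summands are \<open>2 * (r i)\<^sup>2 * ln (norm (z - c i))\<close>.\<close>

definition cauchy :: "complex \<Rightarrow> complex" where
  "cauchy z = (\<Sum>i<k. of_real ((r i)\<^sup>2) / (z - c i))"

definition schwarz :: "complex \<Rightarrow> complex" where
  "schwarz z = cauchy z - env_dz z"

definition rmin :: real where "rmin = Min (r ` {..<k})"

lemma rmin: "rmin > 0" "i < k \<Longrightarrow> rmin \<le> r i"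
proof -
  have "r ` {..<k} \<noteq> {}" using k by auto
  then show "rmin > 0" using r by (auto simp: rmin_def)
  show "i < k \<Longrightarrow> rmin \<le> r i" by (simp add: rmin_def)
qed

lemma center_in_Om: "i < k \<Longrightarrow> c i \<in> Om"
  unfolding Om_def using r[of i] by (force simp: centre_in_ball)

text \<open>A point outside \<open>Om\<close> lies in no disk, so each summand of \<open>pot\<close>
  equals a logarithm at \<open>w\<close> and stays above it nearby, even if \<open>x\<close> enters
  the disk. The quadratic error is \<open>1\<close> from the square and \<open>4\<close> from each
  logarithm, uniformly in \<open>w\<close>.\<close>

lemma obst_ge_affine:
  assumes w: "w \<notin> Om" and x: "norm (x - w) \<le> rmin / 2"
  shows "obst w + Re ((2 * cauchy w - 2 * cnj w) * (x - w)) - (1 + 4 * real k) * (norm (x - w))\<^sup>2 \<le> obst x"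
proof -
  have far: "r i \<le> norm (w - c i)" if "i < k" for i
    using w that by (auto simp: Om_def dist_norm norm_minus_commute not_less)
  have "pot w + (\<Sum>i<k. Re (2 * of_real ((r i)\<^sup>2) / (w - c i) * (x - w)) - 4 * (norm (x - w))\<^sup>2) \<le> pot x"
    unfolding pot_def sum.distrib[symmetric]
  proof (rule sum_mono)
    fix i assume "i \<in> {..<k}"
    then have i: "i < k" by simp
    have pos: "norm (w - c i) > 0" using far[OF i] r[OF i] by linarith
    then have ne: "w \<noteq> c i" by auto
    have half: "norm (x - w) \<le> norm (w - c i) / 2" using x far[OF i] rmin(2)[OF i] by linarith
    have "x \<noteq> c i"
    proof
      assume "x = c i"
      then show False using half pos by (simp add: norm_minus_commute)
    qed
    have "disk_pot (r i) (dist w (c i)) + (Re (2 * of_real ((r i)\<^sup>2) / (w - c i) * (x - w)) - 4 * (norm (x - w))\<^sup>2)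
       \<le> 2 * (r i)\<^sup>2 * (ln (norm (w - c i)) + Re ((x - w) / (w - c i)) - 2 * (norm (x - w) / norm (w - c i))\<^sup>2)"
    proof -
      have 1: "disk_pot (r i) (dist w (c i)) = 2 * (r i)\<^sup>2 * ln (norm (w - c i))"
        using far[OF i] by (simp add: disk_pot_def dist_norm)
      have "2 * of_real ((r i)\<^sup>2) / (w - c i) * (x - w) = of_real (2 * (r i)\<^sup>2) * ((x - w) / (w - c i))" by simp
      then have 2: "Re (2 * of_real ((r i)\<^sup>2) / (w - c i) * (x - w)) = 2 * (r i)\<^sup>2 * Re ((x - w) / (w - c i))"
        by (simp only: Re_of_real_mult)
      have "(r i)\<^sup>2 / (norm (w - c i))\<^sup>2 \<le> 1"
        using far[OF i] r[OF i] pos by (simp add: divide_le_eq_1 power_mono)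
      then have "(r i)\<^sup>2 / (norm (w - c i))\<^sup>2 * (norm (x - w))\<^sup>2 \<le> 1 * (norm (x - w))\<^sup>2" by (intro mult_right_mono) auto
      then have 3: "2 * (r i)\<^sup>2 * (2 * (norm (x - w) / norm (w - c i))\<^sup>2) \<le> 4 * (norm (x - w))\<^sup>2"
        by (simp add: power_divide)
      show ?thesis unfolding 1 2 using 3 by (simp add: algebra_simps)
    qed
    also have "\<dots> \<le> 2 * (r i)\<^sup>2 * ln (norm (x - c i))"
      by (intro mult_left_mono ln_norm_ge half ne) auto
    also have "\<dots> \<le> disk_pot (r i) (dist x (c i))"
      unfolding dist_norm using r[OF i] \<open>x \<noteq> c i\<close> by (intro disk_pot_ge) auto
    finally show "disk_pot (r i) (dist w (c i)) + (Re (2 * of_real ((r i)\<^sup>2) / (w - c i) * (x - w)) - 4 * (norm (x - w))\<^sup>2)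
       \<le> disk_pot (r i) (dist x (c i))" .
  qed
  moreover have "(\<Sum>i<k. Re (2 * of_real ((r i)\<^sup>2) / (w - c i) * (x - w)) - 4 * (norm (x - w))\<^sup>2)
      = Re (2 * cauchy w * (x - w)) - 4 * k * (norm (x - w))\<^sup>2"
    by (simp add: sum_subtractf cauchy_def sum_distrib_left sum_distrib_right flip: Re_sum)
  moreover have "(norm x)\<^sup>2 = (norm w)\<^sup>2 + 2 * Re (cnj w * (x - w)) + (norm (x - w))\<^sup>2"
    using norm_sq_expand[of x 0 w] by simp
  moreover have "Re ((2 * cauchy w - 2 * cnj w) * (x - w)) = Re (2 * cauchy w * (x - w)) - 2 * Re (cnj w * (x - w))"
    by (simp add: algebra_simps)
  ultimately show ?thesis by (simp add: obst_def algebra_simps)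
qed

text \<open>At \<open>w\<close> envelope and obstacle agree. Minus an affine minorant of the
  obstacle, \<open>env\<close> is nonnegative on \<open>ball w (2 * d)\<close> and of order
  \<open>d^2\<close> at \<open>w\<close>; comparing ball means shows the same order at
  \<open>z\<close>, and the gradient estimate on \<open>ball z d\<close> turns this into order
  \<open>d\<close> for the derivative.\<close>

lemma env_dz_estimate:
  fixes d :: real
  assumes w: "w \<notin> Om" and sub: "ball z d \<subseteq> Om" and d: "d > 0" "norm (z - w) = d" "2 * d \<le> rmin / 2"
  shows "norm (env_dz z + cnj w - cauchy w) \<le> 64 * (1 + 4 * real k) * d"
proof -
  define m where "m = 2 * cauchy w - 2 * cnj w"
  define K where "K = (1 + 4 * real k)"
  have K: "K \<ge> 0" by (simp add: K_def)
  \<comment> \<open>Lowering the tangent by \<open>K * (2 * d)\<^sup>2\<close> absorbs the quadratic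
    error on all of \<open>ball w (2 * d)\<close>.\<close>
  define A where "A x = of_real (obst w - K * (2 * d)\<^sup>2) + m * (x - w)" for x
  define p where "p x = env x - Re (A x)" for x
  have cp: "continuous_on X p" for X unfolding p_def A_def by (intro continuous_intros cont_env)
  have env_w: "env w = obst w"
    using w obst_le_env[of w] by (auto simp: Om_def coincidence_compl_def)
  have p0: "p x \<ge> 0" if "x \<in> ball w (2 * d)" for x
  proof -
    have xd: "norm (x - w) \<le> 2 * d" using that by (simp add: dist_norm norm_minus_commute)
    then have "obst w + Re (m * (x - w)) - K * (norm (x - w))\<^sup>2 \<le> obst x"
      unfolding m_def K_def using d by (intro obst_ge_affine[OF w]) auto
    moreover have "K * (norm (x - w))\<^sup>2 \<le> K * (2 * d)\<^sup>2" using K xd by (intro mult_left_mono power_mono) auto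
    ultimately show ?thesis using obst_le_env[of x] by (simp add: p_def A_def)
  qed
  have int_w: "(LINT y:ball w (2 * d)|lborel. p y) \<le> K * (2 * d)\<^sup>2 * measure lborel (ball w (2 * d))"
  proof -
    have iA: "(LINT y:ball w (2 * d)|lborel. Re (A y)) = Re (A w) * measure lborel (ball w (2 * d))"
      using d by (intro ball_mean_harmonic[where R="3 * d"]) (auto simp: A_def intro!: holomorphic_intros)
    have "(LINT y:ball w (2 * d)|lborel. p y) = (LINT y:ball w (2 * d)|lborel. env y) - (LINT y:ball w (2 * d)|lborel. Re (A y))"
      unfolding p_def by (intro set_integral_diff set_integrable_ball cont_env) (auto simp: A_def intro!: continuous_intros)
    also have "\<dots> \<le> env w * measure lborel (ball w (2 * d)) - Re (A w) * measure lborel (ball w (2 * d))"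
      unfolding iA using supermean_env d by (simp add: supermean_def)
    also have "\<dots> = K * (2 * d)\<^sup>2 * measure lborel (ball w (2 * d))"
      by (simp add: A_def env_w algebra_simps)
    finally show ?thesis .
  qed
  obtain G where G: "G holomorphic_on ball z d" "\<And>y. y \<in> ball z d \<Longrightarrow> env y = Re (G y)" "deriv G z = 2 * env_dz z"
    using env_Re_on_ball[OF sub d(1)] by blast
  define P where "P y = G y - A y" for y
  have holP: "P holomorphic_on ball z d" unfolding P_def A_def by (intro holomorphic_intros G)
  have Pp: "Re (P y) = p y" if "y \<in> ball z d" for y using G(2)[OF that] by (simp add: P_def p_def)
  have zw: "ball z d \<subseteq> ball w (2 * d)"
  proof
    fix u assume "u \<in> ball z d"
    then show "u \<in> ball w (2 * d)" using dist_triangle[of w u z] d(2) by (simp add: dist_norm norm_minus_commute)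
  qed
  have "Re (P z) * measure lborel (ball z (d/2)) = (LINT y:ball z (d/2)|lborel. Re (P y))"
    using d holP by (intro ball_mean_harmonic[symmetric, where R=d]) auto
  also have "\<dots> = (LINT y:ball z (d/2)|lborel. p y)"
    using d by (intro set_lebesgue_integral_cong) (auto simp: Pp)
  also have "\<dots> \<le> (LINT y:ball w (2 * d)|lborel. p y)"
    unfolding set_lebesgue_integral_def
  proof (rule integral_mono)
    show "integrable lborel (\<lambda>y. indicator (ball z (d/2)) y *\<^sub>R p y)" "integrable lborel (\<lambda>y. indicator (ball w (2 * d)) y *\<^sub>R p y)"
      using set_integrable_ball[OF cp] by (simp_all add: set_integrable_def)
    fix y
    have "ball z (d/2) \<subseteq> ball w (2 * d)" using zw d by (intro order_trans[OF subset_ball zw]) auto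
    then show "indicator (ball z (d/2)) y *\<^sub>R p y \<le> indicator (ball w (2 * d)) y *\<^sub>R p y"
      using p0[of y] by (auto simp: indicator_def)
  qed
  also have "\<dots> \<le> K * (2 * d)\<^sup>2 * measure lborel (ball w (2 * d))" by (rule int_w)
  \<comment> \<open>The two areas differ by the factor \<open>16\<close>, which together with
    \<open>(2 * d)\<^sup>2\<close> yields \<open>64\<close>.\<close>
  finally have "Re (P z) * (pi * (d/2)\<^sup>2) \<le> K * (2 * d)\<^sup>2 * (pi * (2 * d)\<^sup>2)"
    using d by (simp add: measure_disk)
  then have "(pi * d\<^sup>2) * (Re (P z) / 4) \<le> (pi * d\<^sup>2) * (16 * K * d\<^sup>2)"
    by (simp add: power2_eq_square algebra_simps)
  then have Pz: "Re (P z) \<le> 64 * K * d\<^sup>2" using d by (subst (asm) mult_le_cancel_left_pos) auto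
  have "norm (deriv P z) \<le> 2 * Re (P z) / d"
    by (rule deriv_bound_of_Re_nonneg[OF holP d(1)]) (use Pp p0 zw in auto)
  also have "\<dots> \<le> 2 * (64 * K * d\<^sup>2) / d" using Pz d by (intro divide_right_mono mult_left_mono) auto
  also have "\<dots> = 128 * K * d" using d by (simp add: power2_eq_square)
  finally have "norm (deriv P z) \<le> 128 * K * d" .
  moreover have "deriv P z = 2 * env_dz z - m"
  proof -
    have "(G has_field_derivative 2 * env_dz z) (at z)"
      using holomorphic_derivI[OF G(1) open_ball, of z] d by (simp add: G(3))
    then have "(P has_field_derivative 2 * env_dz z - m) (at z)"
      unfolding P_def A_def by (auto intro!: derivative_eq_intros)
    then show ?thesis by (rule DERIV_imp_deriv)
  qed
  moreover have "2 * env_dz z - m = 2 * (env_dz z + cnj w - cauchy w)" by (simp add: m_def algebra_simps)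
  ultimately have "norm (2 * (env_dz z + cnj w - cauchy w)) \<le> 128 * K * d" by (simp only:)
  then have "2 * norm (env_dz z + cnj w - cauchy w) \<le> 128 * K * d" unfolding norm_mult by simp
  then have "norm (env_dz z + cnj w - cauchy w) \<le> 64 * K * d" by linarith
  then show ?thesis by (simp only: K_def)
qed

lemma cauchy_holomorphic: "cauchy holomorphic_on - c ` {..<k}"
  unfolding cauchy_def by (intro holomorphic_intros) auto

lemma schwarz_boundary:
  assumes w: "w \<in> frontier Om"
  shows "(schwarz \<longlongrightarrow> cnj w) (at w within Om)"
  unfolding tendsto_iff
proof (intro allI impI)
  fix e :: real assume e: "e > 0"
  have wO: "w \<notin> Om" using w open_Om by (simp add: frontier_def interior_open)
  have "w \<in> - c ` {..<k}" using wO center_in_Om by auto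
  moreover have op: "open (- c ` {..<k})" by (intro open_Compl finite_imp_closed) auto
  ultimately have "isCont cauchy w"
    using cauchy_holomorphic by (metis continuous_on_eq_continuous_at holomorphic_on_imp_continuous_on)
  then obtain \<delta>1 where \<delta>1: "\<delta>1 > 0" "\<And>x. dist x w < \<delta>1 \<Longrightarrow> dist (cauchy x) (cauchy w) < e / 8"
    using e unfolding continuous_at_eps_delta by (metis divide_pos_pos zero_less_numeral)
  define K where "K = 64 * (1 + 4 * real k)"
  have K: "K > 0" by (simp add: K_def)
  \<comment> \<open>\<open>dist v w\<close> will only be below \<open>2 * \<delta>\<close>, hence
    \<open>\<delta>1 / 2\<close> and \<open>e / 8\<close>; \<open>rmin / 4\<close> meets the
    hypothesis \<open>2 * d \<le> rmin / 2\<close>, and \<open>e / (4 * K)\<close> makes the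
    estimate smaller than \<open>e / 4\<close>.\<close>
  define \<delta> where "\<delta> = min (\<delta>1 / 2) (min (rmin / 4) (min (e / (4 * K)) (e / 8)))"
  have \<delta>: "\<delta> > 0" using \<delta>1 rmin(1) e K by (simp add: \<delta>_def)
  show "eventually (\<lambda>z. dist (schwarz z) (cnj w) < e) (at w within Om)"
    unfolding eventually_at
  proof (intro exI[of _ \<delta>] conjI ballI impI \<delta>)
    fix z assume z: "z \<in> Om" "z \<noteq> w \<and> dist z w < \<delta>"
    have cl: "closed (- Om)" using open_Om by (rule closed_Compl)
    \<comment> \<open>The estimate is used at a point \<open>v\<close> of the complement nearest to
      \<open>z\<close> and not at \<open>w\<close>, because the ball around \<open>z\<close> that
      reaches to that point must lie in \<open>Om\<close>.\<close>
    obtain v where v: "v \<in> - Om" "infdist z (- Om) = dist z v"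
      using infdist_attains_inf[OF cl, of z] wO by blast
    define d where "d = dist z v"
    have d0: "d > 0" using v(1) z(1) by (auto simp: d_def)
    have dw: "d \<le> dist z w" unfolding d_def v(2)[symmetric] using wO by (intro infdist_le) simp
    have sub: "ball z d \<subseteq> Om"
    proof
      fix u assume "u \<in> ball z d"
      then have "\<not> infdist z (- Om) \<le> dist z u" using v(2) by (simp add: d_def)
      then show "u \<in> Om" using infdist_le[of u "- Om" z] by blast
    qed
    have small: "d < \<delta>" using dw z(2) by simp
    have vw: "dist v w < 2 * \<delta>"
      using dist_triangle[of v w z] small z(2) by (simp add: d_def dist_commute)
    have "norm (env_dz z + cnj v - cauchy v) \<le> K * d"
      unfolding K_def
      by (rule env_dz_estimate[OF _ sub d0]) (use v(1) small in \<open>auto simp: d_def dist_norm \<delta>_def\<close>)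
    also have "\<dots> < K * (e / (4 * K))" using K small by (intro mult_strict_left_mono) (auto simp: \<delta>_def)
    finally have 1: "norm (env_dz z + cnj v - cauchy v) < e / 4" using K by simp
    have 2: "norm (cauchy z - cauchy w) < e / 8" using \<delta>1(2)[of z] z(2) \<delta>1(1) by (simp add: dist_norm \<delta>_def)
    have 3: "norm (cauchy w - cauchy v) < e / 8" using \<delta>1(2)[of v] vw by (simp add: dist_norm \<delta>_def norm_minus_commute)
    have 4: "norm (cnj v - cnj w) < e / 4"
    proof -
      have "norm (cnj v - cnj w) = dist v w" by (simp add: dist_norm flip: complex_cnj_diff)
      then show ?thesis using vw by (simp add: \<delta>_def)
    qed
    have "schwarz z - cnj w = (cauchy z - cauchy w) + (cauchy w - cauchy v) - (env_dz z + cnj v - cauchy v) + (cnj v - cnj w)"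
      by (simp add: schwarz_def)
    also have "norm \<dots> \<le> norm (cauchy z - cauchy w) + norm (cauchy w - cauchy v) + norm (env_dz z + cnj v - cauchy v) + norm (cnj v - cnj w)"
      by (intro norm_triangle_le norm_triangle_le_diff add_mono order_refl)
    finally show "dist (schwarz z) (cnj w) < e" using 1 2 3 4 e by (simp add: dist_norm)
  qed
qed

text \<open>The centers are distinct and \<open>env_dz\<close> is holomorphic at \<open>p\<close>,
  so a single summand is singular there, with the squared radius as residue.\<close>

lemma schwarz_pole:
  assumes "p \<in> c ` {..<k}"
  shows "\<exists>\<rho>. \<rho> \<noteq> 0 \<and> ((\<lambda>z. (z - p) * schwarz z) \<longlongrightarrow> \<rho>) (at p)"
proof -
  obtain i where i: "i < k" "p = c i" using assms by auto
  have pO: "p \<in> Om" using i center_in_Om by simp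
  define rest where "rest z = (\<Sum>j\<in>{..<k} - {i}. of_real ((r j)\<^sup>2) / (z - c j)) - env_dz z" for z
  have ne: "c j \<noteq> c i" if "j \<in> {..<k} - {i}" for j
    using inj_c that i by (auto dest: inj_onD)
  have "isCont env_dz p"
    using env_dz_holomorphic open_Om pO by (metis continuous_on_eq_continuous_at holomorphic_on_imp_continuous_on)
  then have rest: "isCont rest p"
    unfolding rest_def
    by (intro continuous_intros) (use ne i in \<open>simp add: eq_commute[of _ "c i"]\<close>)
  then have "((\<lambda>z. of_real ((r i)\<^sup>2) + (z - p) * rest z) \<longlongrightarrow> of_real ((r i)\<^sup>2) + (p - p) * rest p) (at p)"
    using rest unfolding isCont_def by (intro tendsto_intros)
  then have lim: "((\<lambda>z. of_real ((r i)\<^sup>2) + (z - p) * rest z) \<longlongrightarrow> of_real ((r i)\<^sup>2)) (at p)" by simp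
  have "((\<lambda>z. (z - p) * schwarz z) \<longlongrightarrow> of_real ((r i)\<^sup>2)) (at p)"
  proof (rule Lim_transform_eventually[OF lim])
    have "(z - p) * schwarz z = of_real ((r i)\<^sup>2) + (z - p) * rest z" if "z \<noteq> p" for z
    proof -
      have "schwarz z = of_real ((r i)\<^sup>2) / (z - p) + rest z"
        using i by (simp add: schwarz_def cauchy_def rest_def sum.remove[of "{..<k}" i])
      then show ?thesis using that by (simp add: distrib_left)
    qed
    then show "eventually (\<lambda>z. of_real ((r i)\<^sup>2) + (z - p) * rest z = (z - p) * schwarz z) (at p)"
      by (simp add: eventually_at_filter)
  qed
  moreover have "complex_of_real ((r i)\<^sup>2) \<noteq> 0" using r[OF i(1)] by simp
  ultimately show ?thesis by blast
qed

sublocale schwarz: schwarz_domain Om "c ` {..<k}" schwarz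
proof
  show "schwarz holomorphic_on Om - c ` {..<k}"
    unfolding schwarz_def
    by (intro holomorphic_intros holomorphic_on_subset[OF cauchy_holomorphic] holomorphic_on_subset[OF env_dz_holomorphic]) auto
  show "c ` {..<k} \<subseteq> Om" using center_in_Om by auto
qed (use open_Om bounded_Om schwarz_pole schwarz_boundary in auto)

end

section \<open>Transfer to the plane as a vector space\<close>

lemma dist_of_vec [simp]: "dist (of_vec x) (of_vec y) = dist x y"
  by (metis dist_to_vec to_vec_of_vec)

lemma norm_of_vec [simp]: "norm (of_vec x) = norm x"
  by (metis norm_to_vec to_vec_of_vec)

lemma of_vec_mem_ball: "of_vec y \<in> ball (of_vec x) r \<longleftrightarrow> y \<in> ball x r"
  by simp

lemma integral_of_vec:
  fixes f :: "complex \<Rightarrow> real"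
  assumes [measurable]: "f \<in> borel_measurable borel"
  shows "(LINT x|lborel. f (of_vec x)) = (LINT z|lborel. f z)"
    and "integrable lborel f \<Longrightarrow> integrable lborel (\<lambda>x. f (of_vec x))"
proof -
  show "(LINT x|lborel. f (of_vec x)) = (LINT z|lborel. f z)"
    unfolding distr_of_vec[symmetric] by (subst integral_distr) auto
  assume "integrable lborel f"
  then show "integrable lborel (\<lambda>x. f (of_vec x))"
    unfolding distr_of_vec[symmetric] by (subst (asm) integrable_distr_eq) auto
qed

text \<open>Ball integrals and areas agree under the isometry, and continuity implies lower
  semicontinuity.\<close>

lemma superharmonic_iff_supermean:
  assumes f: "continuous_on UNIV f"
  shows "superharmonic f \<longleftrightarrow> supermean (\<lambda>z. f (to_vec z))"
proof -
  have cont: "continuous_on A (\<lambda>z. f (to_vec z))" for A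
    by (rule continuous_on_compose2[OF f]) (auto intro: continuous_intros)
  have lsc: "lower_semicont f"
    unfolding lower_semicont_def using f by (auto intro: open_Collect_less continuous_intros)
  have int: "(LINT y:ball x d|lborel. f y) = (LINT z:ball (of_vec x) d|lborel. f (to_vec z))" for x d
  proof -
    define G where "G z = indicator (ball (of_vec x) d) z *\<^sub>R f (to_vec z)" for z
    have "G \<in> borel_measurable borel"
      unfolding G_def[abs_def] by (intro borel_measurable_continuous_on_indicator cont) auto
    then have "(LINT y|lborel. G (of_vec y)) = (LINT z|lborel. G z)" by (rule integral_of_vec)
    moreover have "G (of_vec y) = indicator (ball x d) y *\<^sub>R f y" for y
      by (simp add: G_def indicator_def)
    ultimately show ?thesis by (simp only: set_lebesgue_integral_def G_def[abs_def])
  qed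
  have m: "measure lborel (ball x d) = pi * d\<^sup>2" if "d > 0" for x :: "real^2" and d
  proof -
    have "measure lborel (ball x d) = measure lborel (ball (of_vec x) d)"
      using that by (simp add: content_ball)
    then show ?thesis using that by (simp add: measure_disk)
  qed
  have "(LINT y:ball x d|lborel. f y) / measure lborel (ball x d) \<le> f x \<longleftrightarrow>
      (LINT z:ball (of_vec x) d|lborel. f (to_vec z)) \<le> f (to_vec (of_vec x)) * measure lborel (ball (of_vec x) d)"
    if "d > 0" for x d
    unfolding int m[OF that] measure_disk[OF less_imp_le[OF that]] using that by (simp add: pos_divide_le_eq)
  then have "superharmonic f \<longleftrightarrow> (\<forall>x d. 0 < d \<longrightarrow>
      (LINT z:ball (of_vec x) d|lborel. f (to_vec z)) \<le> f (to_vec (of_vec x)) * measure lborel (ball (of_vec x) d))"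
    using lsc by (simp add: superharmonic_def)
  also have "\<dots> \<longleftrightarrow> supermean (\<lambda>z. f (to_vec z))"
    unfolding supermean_def using cont by (metis of_vec_to_vec)
  finally show ?thesis .
qed

context disk_obstacle
begin

abbreviation disk :: "nat \<Rightarrow> (real^2) set" where
  "disk i \<equiv> ball (to_vec (c i)) (r i)"

text \<open>The factor \<open>- (2 / pi)\<close> of the Green function cancels the
  \<open>pi / 2\<close> of the disk potentials.\<close>

lemma obstacle_eq_obst: "obstacle (\<lambda>y. \<Sum>i<k. indicator (disk i) y) x = obst (of_vec x)"
proof -
  define F where "F i z = indicator (ball (c i) (r i)) z * ln (dist (of_vec x) z)" for i z
  have F: "F i \<in> borel_measurable borel" "integrable lborel (F i)" if "i < k" for i
    using disk_potential(1)[OF r[OF that]] borel_measurable_integrable[of lborel "F i"]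
    by (auto simp: F_def[abs_def])
  have "green x y * (\<Sum>i<k. indicator (disk i) y) = - (2 / pi) * (\<Sum>i<k. F i (of_vec y))" for y
  proof -
    have "indicator (disk i) y = (indicator (ball (c i) (r i)) (of_vec y) :: real)" for i
      using of_vec_mem_ball[of y "to_vec (c i)" "r i"] by (simp add: indicator_def)
    then show ?thesis by (simp only: green_def F_def dist_of_vec flip: sum_distrib_right) simp
  qed
  then have "(LINT y|lborel. green x y * (\<Sum>i<k. indicator (disk i) y))
      = - (2 / pi) * (LINT y|lborel. (\<Sum>i<k. F i (of_vec y)))" by simp
  also have "(LINT y|lborel. (\<Sum>i<k. F i (of_vec y))) = (\<Sum>i<k. LINT y|lborel. F i (of_vec y))"
    by (rule Bochner_Integration.integral_sum) (auto intro: integral_of_vec(2) F)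
  also have "\<dots> = (\<Sum>i<k. pi / 2 * disk_pot (r i) (dist (of_vec x) (c i)))"
  proof (intro sum.cong refl)
    fix i assume "i \<in> {..<k}"
    then have i: "i < k" by simp
    have "(LINT y|lborel. F i (of_vec y)) = integral\<^sup>L lborel (F i)" by (rule integral_of_vec(1)[OF F(1)[OF i]])
    also have "\<dots> = pi / 2 * disk_pot (r i) (dist (of_vec x) (c i))"
      unfolding F_def by (rule disk_potential(2)[OF r[OF i]])
    finally show "(LINT y|lborel. F i (of_vec y)) = pi / 2 * disk_pot (r i) (dist (of_vec x) (c i))" .
  qed
  also have "- (2 / pi) * \<dots> = - pot (of_vec x)"
    by (simp only: pot_def sum_distrib_left[symmetric]) simp
  finally show ?thesis by (simp add: obstacle_def obst_def)
qed

lemma odometer_s_eq_env: "odometer_s (\<lambda>y. \<Sum>i<k. indicator (disk i) y) x = env (of_vec x)"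
proof -
  have "{f x | f. continuous_on UNIV f \<and> superharmonic f \<and> (\<forall>y. obst (of_vec y) \<le> f y)}
      = (\<lambda>g. g (of_vec x)) ` majorants" (is "?A = _")
  proof (intro equalityI subsetI)
    fix v assume "v \<in> ?A"
    then obtain f where f: "v = f x" "continuous_on UNIV f" "superharmonic f" "\<And>y. obst (of_vec y) \<le> f y" by blast
    have "(\<lambda>z. f (to_vec z)) \<in> majorants"
      using f superharmonic_iff_supermean[OF f(2)] f(4)[of "to_vec _"] by (simp add: majorants_def)
    moreover have "v = f (to_vec (of_vec x))" using f(1) by simp
    ultimately show "v \<in> (\<lambda>g. g (of_vec x)) ` majorants" by (intro image_eqI[of v _ "\<lambda>z. f (to_vec z)"])
  next
    fix v assume "v \<in> (\<lambda>g. g (of_vec x)) ` majorants"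
    then obtain g where g: "v = g (of_vec x)" "supermean g" "\<And>z. obst z \<le> g z" by (auto simp: majorants_def)
    have "continuous_on UNIV (\<lambda>y. g (of_vec y))"
    proof (rule continuous_on_compose2[OF _ continuous_on_of_vec subset_UNIV])
      show "continuous_on UNIV g" using g(2) by (simp add: supermean_def)
    qed
    moreover from superharmonic_iff_supermean[OF this] have "superharmonic (\<lambda>y. g (of_vec y))" using g(2) by simp
    ultimately show "v \<in> ?A"
      by (intro CollectI exI[of _ "\<lambda>y. g (of_vec y)"]) (simp add: g(1,3))
  qed
  then show ?thesis by (simp add: odometer_s_def obstacle_eq_obst env_def Setcompr_eq_image)
qed

lemma smash_sum_eq: "smash_sum k disk = to_vec ` Om"
proof -
  have "x \<in> smash_sum k disk \<longleftrightarrow> of_vec x \<in> Om" for x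
    using of_vec_mem_ball[of x "to_vec (c _)"]
    by (simp add: smash_sum_def Dset_def obstacle_eq_obst odometer_s_eq_env Om_def coincidence_compl_def)
  moreover have "x \<in> to_vec ` Om \<longleftrightarrow> of_vec x \<in> Om" for x
    by (metis image_iff of_vec_to_vec to_vec_of_vec)
  ultimately show ?thesis by blast
qed

end

lemma frontier_to_vec_image: "frontier (to_vec ` A) = to_vec ` frontier A"
proof -
  have "closure (to_vec ` A) = to_vec ` closure A"
    by (rule closure_injective_linear_image[symmetric, OF linear_to_vec]) (metis injI of_vec_to_vec)
  moreover have bij: "bij to_vec" by (rule o_bij[of of_vec]) (auto simp: fun_eq_iff)
  then have "interior (to_vec ` A) = to_vec ` interior A"
    by (rule interior_bijective_linear_image[OF linear_to_vec])
  moreover have "inj to_vec" by (rule bij_is_inj[OF bij])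
  ultimately show ?thesis by (simp add: frontier_def image_set_diff)
qed

section \<open>Polynomials in the real coordinates\<close>

definition coord_polys :: "nat \<Rightarrow> (complex \<Rightarrow> complex) set" where
  "coord_polys N = {f. \<exists>a. \<forall>z. f z = (\<Sum>i<N. \<Sum>j<N - i. a i j * of_real (Re z) ^ i * of_real (Im z) ^ j)}"

lemma coord_polysI:
  "(\<And>z. f z = (\<Sum>i<N. \<Sum>j<N - i. a i j * of_real (Re z) ^ i * of_real (Im z) ^ j)) \<Longrightarrow> f \<in> coord_polys N"
  by (auto simp: coord_polys_def)

lemma coord_polys_add:
  assumes "f \<in> coord_polys N" "g \<in> coord_polys N" shows "(\<lambda>z. f z + g z) \<in> coord_polys N"
proof -
  obtain a b where "\<And>z. f z = (\<Sum>i<N. \<Sum>j<N - i. a i j * of_real (Re z) ^ i * of_real (Im z) ^ j)"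
      "\<And>z. g z = (\<Sum>i<N. \<Sum>j<N - i. b i j * of_real (Re z) ^ i * of_real (Im z) ^ j)"
    using assms by (auto simp: coord_polys_def)
  then show ?thesis
    by (intro coord_polysI[where a="\<lambda>i j. a i j + b i j"]) (simp add: sum.distrib distrib_right)
qed

lemma coord_polys_cmult:
  assumes "f \<in> coord_polys N" shows "(\<lambda>z. C * f z) \<in> coord_polys N"
proof -
  obtain a where "\<And>z. f z = (\<Sum>i<N. \<Sum>j<N - i. a i j * of_real (Re z) ^ i * of_real (Im z) ^ j)"
    using assms by (auto simp: coord_polys_def)
  then show ?thesis
    by (intro coord_polysI[where a="\<lambda>i j. C * a i j"]) (simp add: sum_distrib_left mult_ac)
qed

lemma coord_polys_const: "N > 0 \<Longrightarrow> (\<lambda>z. C) \<in> coord_polys N"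
  by (cases N)
     (auto intro!: coord_polysI[where a="\<lambda>i j. if i = 0 \<and> j = 0 then C else 0"]
       simp: sum.lessThan_Suc_shift simp del: sum.lessThan_Suc)

lemma coord_polys_sum:
  assumes "finite I" "N > 0" "\<And>i. i \<in> I \<Longrightarrow> f i \<in> coord_polys N" shows "(\<lambda>z. \<Sum>i\<in>I. f i z) \<in> coord_polys N"
  using assms(1,3) by (induction I rule: finite_induct) (auto intro: coord_polys_add coord_polys_const assms(2))

lemma coord_polys_mult_coord:
  assumes "f \<in> coord_polys N"
  shows "(\<lambda>z. of_real (Re z) * f z) \<in> coord_polys (Suc N)" "(\<lambda>z. of_real (Im z) * f z) \<in> coord_polys (Suc N)"
proof -
  obtain a where a: "\<And>z. f z = (\<Sum>i<N. \<Sum>j<N - i. a i j * of_real (Re z) ^ i * of_real (Im z) ^ j)"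
    using assms by (auto simp: coord_polys_def)
  show "(\<lambda>z. of_real (Re z) * f z) \<in> coord_polys (Suc N)"
  proof (rule coord_polysI[where a="\<lambda>i j. if i = 0 then 0 else a (i - 1) j"])
    fix z
    show "of_real (Re z) * f z = (\<Sum>i<Suc N. \<Sum>j<Suc N - i. (if i = 0 then 0 else a (i - 1) j) * of_real (Re z) ^ i * of_real (Im z) ^ j)"
      unfolding a by (subst sum.lessThan_Suc_shift) (simp add: sum_distrib_left mult_ac)
  qed
  show "(\<lambda>z. of_real (Im z) * f z) \<in> coord_polys (Suc N)"
  proof (rule coord_polysI[where a="\<lambda>i j. if j = 0 then 0 else a i (j - 1)"])
    fix z
    have "(\<Sum>j<Suc N - i. (if j = 0 then 0 else a i (j - 1)) * of_real (Re z) ^ i * of_real (Im z) ^ j)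
        = of_real (Im z) * (\<Sum>j<N - i. a i j * of_real (Re z) ^ i * of_real (Im z) ^ j)" if "i < N" for i
      unfolding Suc_diff_le[OF less_imp_le[OF that]]
      by (subst sum.lessThan_Suc_shift) (simp add: sum_distrib_left mult_ac)
    then show "of_real (Im z) * f z = (\<Sum>i<Suc N. \<Sum>j<Suc N - i. (if j = 0 then 0 else a i (j - 1)) * of_real (Re z) ^ i * of_real (Im z) ^ j)"
      unfolding a by (simp add: sum_distrib_left)
  qed
qed

lemma coord_polys_mult_z:
  assumes "f \<in> coord_polys N"
  shows "(\<lambda>z. z * f z) \<in> coord_polys (Suc N)" "(\<lambda>z. cnj z * f z) \<in> coord_polys (Suc N)"
proof -
  note m = coord_polys_mult_coord[OF assms]
  have z: "z = of_real (Re z) + \<i> * of_real (Im z)" for z by (simp add: complex_eq_iff)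
  have cz: "cnj z = of_real (Re z) + (- \<i>) * of_real (Im z)" for z by (simp add: complex_eq_iff)
  have "(\<lambda>z. of_real (Re z) * f z + C * (of_real (Im z) * f z)) \<in> coord_polys (Suc N)" for C
    by (intro coord_polys_add coord_polys_cmult m)
  from this[of \<i>] this[of "- \<i>"]
  show "(\<lambda>z. z * f z) \<in> coord_polys (Suc N)" "(\<lambda>z. cnj z * f z) \<in> coord_polys (Suc N)"
    unfolding mult.assoc[symmetric] distrib_right[symmetric] z[symmetric] cz[symmetric] .
qed

lemma coord_polys_monomial: "a + b < N \<Longrightarrow> (\<lambda>z. z ^ a * cnj z ^ b) \<in> coord_polys N"
proof (induction a arbitrary: N)
  case 0
  then show ?case
  proof (induction b arbitrary: N)
    case 0 then show ?case using coord_polys_const[of N 1] by simp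
  next
    case (Suc b)
    then obtain M where "N = Suc M" "b < M" by (cases N) auto
    then show ?case using coord_polys_mult_z(2)[OF Suc.IH[of M]] by simp
  qed
next
  case (Suc a)
  then obtain M where "N = Suc M" "a + b < M" by (cases N) auto
  then show ?case using coord_polys_mult_z(1)[OF Suc.IH[of M]] by (simp add: mult.assoc)
qed

text \<open>The pair \<open>(k, k)\<close> gives the leading term, and all other pairs have total
  degree below \<open>2 * k\<close>. Hermitian symmetry makes the sum real, so the coefficients
  found for the lower terms may be replaced by their real parts.\<close>

lemma hermitian_polynomial:
  fixes Q :: "nat \<Rightarrow> nat \<Rightarrow> complex"
  assumes k: "k > 0" and lead: "Q k k = 1" and herm: "\<And>a b. a \<le> k \<Longrightarrow> b \<le> k \<Longrightarrow> Q a b = cnj (Q b a)"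
  shows "\<exists>p :: nat \<Rightarrow> nat \<Rightarrow> real. \<forall>w. (\<Sum>a\<le>k. \<Sum>b\<le>k. Q a b * w ^ a * cnj w ^ b)
    = of_real (((Re w)\<^sup>2 + (Im w)\<^sup>2) ^ k + (\<Sum>i<2 * k. \<Sum>j<2 * k - i. p i j * Re w ^ i * Im w ^ j))"
proof -
  define F where "F w = (\<Sum>a\<le>k. \<Sum>b\<le>k. Q a b * w ^ a * cnj w ^ b)" for w
  define L where "L w = (\<Sum>(a, b)\<in>{..k} \<times> {..k} - {(k, k)}. Q a b * w ^ a * cnj w ^ b)" for w
  have FL: "F w = of_real (((Re w)\<^sup>2 + (Im w)\<^sup>2) ^ k) + L w" for w
  proof -
    have "F w = (\<Sum>(a, b)\<in>{..k} \<times> {..k}. Q a b * w ^ a * cnj w ^ b)"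
      by (simp add: F_def sum.cartesian_product)
    also have "\<dots> = w ^ k * cnj w ^ k + L w"
      unfolding L_def by (subst sum.remove[of _ "(k, k)"]) (auto simp: lead)
    also have "w ^ k * cnj w ^ k = of_real (((Re w)\<^sup>2 + (Im w)\<^sup>2) ^ k)"
      by (simp only: power_mult_distrib[symmetric] complex_mult_cnj of_real_power)
    finally show ?thesis .
  qed
  have "L \<in> coord_polys (2 * k)"
  proof -
    have "(\<lambda>w. \<Sum>ab\<in>{..k} \<times> {..k} - {(k, k)}. Q (fst ab) (snd ab) * (w ^ fst ab * cnj w ^ snd ab)) \<in> coord_polys (2 * k)"
    proof (rule coord_polys_sum)
      fix ab assume "ab \<in> {..k} \<times> {..k} - {(k, k)}"
      then have "fst ab + snd ab < 2 * k" by (cases ab) auto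
      then show "(\<lambda>w. Q (fst ab) (snd ab) * (w ^ fst ab * cnj w ^ snd ab)) \<in> coord_polys (2 * k)"
        by (intro coord_polys_cmult coord_polys_monomial)
    qed (use k in auto)
    then show ?thesis by (simp add: L_def[abs_def] split_beta mult.assoc)
  qed
  then obtain p where p: "\<And>w. L w = (\<Sum>i<2 * k. \<Sum>j<2 * k - i. p i j * of_real (Re w) ^ i * of_real (Im w) ^ j)"
    by (auto simp: coord_polys_def)
  have "cnj (F w) = F w" for w
  proof -
    have "cnj (F w) = (\<Sum>a\<le>k. \<Sum>b\<le>k. cnj (Q a b) * cnj w ^ a * w ^ b)" by (simp add: F_def)
    also have "\<dots> = (\<Sum>a\<le>k. \<Sum>b\<le>k. Q b a * w ^ b * cnj w ^ a)"
      by (intro sum.cong refl) (simp add: herm[symmetric])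
    also have "\<dots> = F w" unfolding F_def by (rule sum.swap)
    finally show ?thesis .
  qed
  then have "Im (F w) = 0" for w by (simp add: complex_eq_iff)
  then have "F w = of_real (Re (F w))" for w by (simp add: complex_eq_iff)
  moreover have "Re (F w) = ((Re w)\<^sup>2 + (Im w)\<^sup>2) ^ k + (\<Sum>i<2 * k. \<Sum>j<2 * k - i. Re (p i j) * Re w ^ i * Im w ^ j)" for w
  proof -
    have "Re (p i j * of_real (Re w) ^ i * of_real (Im w) ^ j) = Re (p i j) * Re w ^ i * Im w ^ j" for i j
      by (simp flip: of_real_power)
    then show ?thesis by (simp only: FL p plus_complex.sel Re_complex_of_real Re_sum)
  qed
  ultimately have "\<And>w. F w = of_real (((Re w)\<^sup>2 + (Im w)\<^sup>2) ^ k + (\<Sum>i<2 * k. \<Sum>j<2 * k - i. Re (p i j) * Re w ^ i * Im w ^ j))"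
    by simp
  then show ?thesis unfolding F_def by (intro exI[of _ "\<lambda>i j. Re (p i j)"] allI)
qed

theorem mainTheorem6:
  fixes k :: nat and c :: "nat \<Rightarrow> real^2" and r :: "nat \<Rightarrow> real"
  assumes "0 < k"
    and "\<And>i. i < k \<Longrightarrow> 0 < r i"
    and "inj_on c {..<k}"
  shows "\<exists>(a :: nat \<Rightarrow> nat \<Rightarrow> real) (E :: (real^2) set). finite E \<and>
           frontier (smash_sum k (\<lambda>i. ball (c i) (r i))) =
             {x. ((x$1)^2 + (x$2)^2)^k
                 + (\<Sum>i<2*k. \<Sum>j<2*k - i. a i j * (x$1)^i * (x$2)^j) = 0} - E"
proof -
  have inj: "inj_on (\<lambda>i. of_vec (c i)) {..<k}"
    using assms(3) by (metis (mono_tags, lifting) inj_on_def to_vec_of_vec)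
  interpret disk_obstacle k "\<lambda>i. of_vec (c i)" r
    by unfold_locales (use assms inj in auto)
  \<comment> \<open>Distinct centers make the number of poles equal to \<open>k\<close>, which gives
    the degree \<open>2 * k\<close>.\<close>
  have card: "card ((\<lambda>i. of_vec (c i)) ` {..<k}) = k"
    using card_image[OF inj] by simp
  define V where "V Q = {w. (\<Sum>a\<le>k. \<Sum>b\<le>k. Q a b * w ^ a * cnj w ^ b) = 0}" for Q
  obtain Q where lead: "Q k k = 1"
    and herm: "\<And>a b. a \<le> k \<Longrightarrow> b \<le> k \<Longrightarrow> Q a b = cnj (Q b a)"
    and sub: "frontier Om \<subseteq> V Q" and fin: "finite (V Q - frontier Om)"
  proof (rule schwarz.boundary_algebraic[unfolded card, folded V_def])
    fix Q assume "Q k k = 1" "\<And>a b. a \<le> k \<Longrightarrow> b \<le> k \<Longrightarrow> Q a b = cnj (Q b a)"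
      "frontier Om \<subseteq> V Q" "finite (V Q - frontier Om)"
    then show thesis by (rule that)
  qed
  obtain p where p: "\<And>w. (\<Sum>a\<le>k. \<Sum>b\<le>k. Q a b * w ^ a * cnj w ^ b)
      = of_real (((Re w)\<^sup>2 + (Im w)\<^sup>2) ^ k + (\<Sum>i<2 * k. \<Sum>j<2 * k - i. p i j * Re w ^ i * Im w ^ j))"
    using hermitian_polynomial[of k Q, OF assms(1) lead herm] by blast
  define Z where "Z = {w. ((Re w)\<^sup>2 + (Im w)\<^sup>2) ^ k + (\<Sum>i<2 * k. \<Sum>j<2 * k - i. p i j * Re w ^ i * Im w ^ j) = 0}"
  have Z: "Z = V Q"
    unfolding Z_def V_def p of_real_eq_0_iff ..
  have vecZ: "{x. ((x$1)^2 + (x$2)^2)^k + (\<Sum>i<2*k. \<Sum>j<2*k - i. p i j * (x$1)^i * (x$2)^j) = 0} = to_vec ` Z"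
    (is "?P = _")
  proof -
    have "?P = of_vec -` Z" by (simp add: Z_def vimage_def)
    also have "\<dots> = to_vec ` Z" by (force intro: image_eqI[where f=to_vec] simp: image_iff)
    finally show ?thesis .
  qed
  \<comment> \<open>The set \<open>E\<close> of the theorem is the image of the zeros off the
    frontier.\<close>
  have "Z - (Z - frontier Om) = frontier Om" using sub Z by blast
  moreover have "inj to_vec" by (metis injI of_vec_to_vec)
  ultimately have "to_vec ` frontier Om = to_vec ` Z - to_vec ` (Z - frontier Om)"
    by (metis image_set_diff)
  moreover have "frontier (smash_sum k (\<lambda>i. ball (c i) (r i))) = to_vec ` frontier Om"
    using smash_sum_eq by (simp add: frontier_to_vec_image)
  ultimately have E: "frontier (smash_sum k (\<lambda>i. ball (c i) (r i))) =
      {x. ((x$1)^2 + (x$2)^2)^k + (\<Sum>i<2*k. \<Sum>j<2*k - i. p i j * (x$1)^i * (x$2)^j) = 0} - to_vec ` (Z - frontier Om)"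
    unfolding vecZ by (simp only:)
  have "finite (to_vec ` (Z - frontier Om))" using fin Z by simp
  with E show ?thesis by (intro exI conjI)
qed

end
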